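(* Let $j$ be a positive integer. Then, as an identity of polynomials in the complex variables $d,e$ (equivalently, for all $d,e\in\mathbb{C}$), \[ \operatorname{Ch}_{2j-1}\big( (e-d) \times (e+d) \big) = (-1)^{j-1} \operatorname{Cat}(j-1) \sum_{k=0}^j f_k(j) \left( \prod_{r=0}^{k-1} (d^2-r^2) \right) \left( \prod_{r=k}^{j-1} (e^2-r^2) \right), \] where $\operatorname{Cat}(j-1)=\frac{(2j-2)!}{(j-1)!\,j!}$ is the Catalan number, $f_0(j)=1$ and \[ f_k(j)= (-1)^k \frac{j^{\downarrow k} \, (2j-1)^{\uparrow \uparrow k}}{k! \, (2k-1)!!} \qquad (1\le k\le j). \]
   Context: For a partition $\pi$ of $k$ and a partition $\lambda$ of $n$, the normalized character is $\operatorname{Ch}_\pi(\lambda)= n^{\downarrow k}\, \chi^\lambda_{\pi\cup(1^{n-k})}/f^\lambda$ if $n\ge k$ and $0$ otherwise, where $n^{\downarrow k}=n(n-1)\cdots(n-k+1)$, $\chi^\lambda_\mu$ is the irreducible character of $\mathfrak{S}_n$ indexed by $\lambda$ evaluated on the class of cycle type $\mu$, and $f^\lambda=\chi^\lambda(\mathrm{id})$. We write $\operatorname{Ch}_k$ for $\operatorname{Ch}_{(k)}$ (a single $k$-cycle). For positive integers $p,q$, $p\times q$ denotes the rectangular Young diagram with $p$ rows each of length $q$. For fixed $\pi$ there is a unique polynomial in $\mathbb{Q}[p,q]$ whose value at all positive integers $p,q$ equals $\operatorname{Ch}_\pi(p\times q)$ (explicitly $(-1)^k\sum_{\sigma_1\sigma_2=w_\pi}(-q)^{\kappa(\sigma_1)}p^{\kappa(\sigma_2)}$,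 sum over $\sigma_1,\sigma_2\in\mathfrak{S}_k$, $w_\pi$ a fixed permutation of cycle type $\pi$, $\kappa$ = number of cycles); for arbitrary complex $p,q$, $\operatorname{Ch}_\pi(p\times q)$ denotes the value of this polynomial. The double rising factorial is $a^{\uparrow\uparrow k}=\prod_{r=0}^{k-1}(a+2r)$, with $a^{\uparrow\uparrow 0}=1$; $(2k-1)!!=1\cdot 3\cdots(2k-1)$. *)

theory Defs
  imports
    Complex_Main
    "HOL-Library.Function_Algebras"
    "HOL-Library.Multiset"
    "HOL-Combinatorics.Permutations"
    "HOL-Combinatorics.Orbits"
    "HOL-Computational_Algebra.Polynomial"
begin

text \<open>
  Partitions are lists of positive parts in weakly decreasing order, Young diagrams are in English
  notation, and the symmetric group of degree \<open>n\<close> is the set of permutations of \<open>{..<n}\<close>.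
\<close>

definition cells :: "nat list \<Rightarrow> (nat \<times> nat) set" where
  "cells lam = {(i, j). i < length lam \<and> j < lam ! i}"

definition rect :: "nat \<Rightarrow> nat \<Rightarrow> nat list" where
  "rect p q = replicate p q"

definition is_tableau :: "nat list \<Rightarrow> (nat \<Rightarrow> nat \<times> nat) \<Rightarrow> bool" where
  "is_tableau lam T \<longleftrightarrow> bij_betw T {..<sum_list lam} (cells lam)"

definition row_stabilizer :: "nat \<Rightarrow> (nat \<Rightarrow> nat \<times> nat) \<Rightarrow> (nat \<Rightarrow> nat) set" where
  "row_stabilizer n T = {g. g permutes {..<n} \<and> (\<forall>m<n. fst (T (g m)) = fst (T m))}"

definition column_stabilizer :: "nat \<Rightarrow> (nat \<Rightarrow> nat \<times> nat) \<Rightarrow> (nat \<Rightarrow> nat) set" where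
  "column_stabilizer n T = {g. g permutes {..<n} \<and> (\<forall>m<n. snd (T (g m)) = snd (T m))}"

text \<open>
  An element \<open>\<Sum>g. x g \<cdot> g\<close> of the complex group algebra of the symmetric group is represented
  by its coefficient function \<open>x\<close>, which vanishes outside the group.
\<close>

definition group_algebra :: "nat \<Rightarrow> ((nat \<Rightarrow> nat) \<Rightarrow> complex) set" where
  "group_algebra n = {x. \<forall>g. \<not> g permutes {..<n} \<longrightarrow> x g = 0}"

definition convolution ::
  "nat \<Rightarrow> ((nat \<Rightarrow> nat) \<Rightarrow> complex) \<Rightarrow> ((nat \<Rightarrow> nat) \<Rightarrow> complex) \<Rightarrow> (nat \<Rightarrow> nat) \<Rightarrow> complex" where
  "convolution n x y = (\<lambda>g. \<Sum>h | h permutes {..<n}. x h * y (inv h \<circ> g))"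

definition left_action ::
  "(nat \<Rightarrow> nat) \<Rightarrow> ((nat \<Rightarrow> nat) \<Rightarrow> complex) \<Rightarrow> (nat \<Rightarrow> nat) \<Rightarrow> complex" where
  "left_action w x = (\<lambda>g. x (inv w \<circ> g))"

definition row_symmetrizer :: "nat \<Rightarrow> (nat \<Rightarrow> nat \<times> nat) \<Rightarrow> (nat \<Rightarrow> nat) \<Rightarrow> complex" where
  "row_symmetrizer n T = (\<lambda>g. if g \<in> row_stabilizer n T then 1 else 0)"

definition column_antisymmetrizer :: "nat \<Rightarrow> (nat \<Rightarrow> nat \<times> nat) \<Rightarrow> (nat \<Rightarrow> nat) \<Rightarrow> complex" where
  "column_antisymmetrizer n T =
     (\<lambda>g. if g \<in> column_stabilizer n T then of_int (sign g) else 0)"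

definition young_symmetrizer :: "nat \<Rightarrow> (nat \<Rightarrow> nat \<times> nat) \<Rightarrow> (nat \<Rightarrow> nat) \<Rightarrow> complex" where
  "young_symmetrizer n T = convolution n (row_symmetrizer n T) (column_antisymmetrizer n T)"

text \<open>
  The Specht module of a tableau is the left ideal generated by its Young symmetrizer; tableaux of
  the same shape give isomorphic modules. The shape \<open>[n]\<close> gives the trivial representation.
\<close>

definition specht_module :: "nat \<Rightarrow> (nat \<Rightarrow> nat \<times> nat) \<Rightarrow> ((nat \<Rightarrow> nat) \<Rightarrow> complex) set" where
  "specht_module n T = (\<lambda>x. convolution n x (young_symmetrizer n T)) ` group_algebra n"

definition (in vector_space) subspace_trace :: "'b set \<Rightarrow> ('b \<Rightarrow> 'b) \<Rightarrow> 'a" where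
  "subspace_trace V f =
     (let B = (SOME B. independent B \<and> span B = V) in \<Sum>b\<in>B. representation B (f b) b)"

global_interpretation fun_space:
  vector_space "\<lambda>(c::complex) (x::(nat \<Rightarrow> nat) \<Rightarrow> complex) g. c * x g"
  by unfold_locales (auto simp: fun_eq_iff algebra_simps)

definition irr_char :: "nat list \<Rightarrow> (nat \<Rightarrow> nat) \<Rightarrow> complex" where
  "irr_char lam w =
     fun_space.subspace_trace
       (specht_module (sum_list lam) (SOME T. is_tableau lam T)) (left_action w)"

definition cycle_type :: "nat \<Rightarrow> (nat \<Rightarrow> nat) \<Rightarrow> nat multiset" where
  "cycle_type n w = image_mset card (mset_set (orbit w ` {..<n}))"

definition irr_char_at :: "nat list \<Rightarrow> nat list \<Rightarrow> complex" where
  "irr_char_at lam mu =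
     irr_char lam (SOME w. w permutes {..<sum_list lam} \<and> cycle_type (sum_list lam) w = mset mu)"

definition falling_factorial :: "complex \<Rightarrow> nat \<Rightarrow> complex" where
  "falling_factorial a k = (\<Prod>r<k. a - of_nat r)"

definition double_rising_factorial :: "complex \<Rightarrow> nat \<Rightarrow> complex" where
  "double_rising_factorial a k = (\<Prod>r<k. a + 2 * of_nat r)"

definition Ch :: "nat list \<Rightarrow> nat list \<Rightarrow> complex" where
  "Ch rho lam =
     (let k = sum_list rho; n = sum_list lam in
      if k \<le> n
      then falling_factorial (of_nat n) k * irr_char_at lam (rho @ replicate (n - k) 1) / irr_char lam id
      else 0)"

text \<open>
  A polynomial in \<open>\<rat>[p, q]\<close> is represented as a polynomial in \<open>p\<close> with coefficients in \<open>\<rat>[q]\<close>.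
\<close>

definition eval2 :: "rat poly poly \<Rightarrow> complex \<Rightarrow> complex \<Rightarrow> complex" where
  "eval2 P p q = poly (map_poly (\<lambda>c. poly (map_poly of_rat c) q) P) p"

definition Ch_rect_poly :: "nat list \<Rightarrow> rat poly poly" where
  "Ch_rect_poly rho =
     (THE P. \<forall>p q::nat. p > 0 \<longrightarrow> q > 0 \<longrightarrow> eval2 P (of_nat p) (of_nat q) = Ch rho (rect p q))"

definition Ch_rect :: "nat list \<Rightarrow> complex \<Rightarrow> complex \<Rightarrow> complex" where
  "Ch_rect rho p q = eval2 (Ch_rect_poly rho) p q"

definition Cat :: "nat \<Rightarrow> complex" where
  "Cat m = fact (2 * m) / (fact m * fact (m + 1))"

definition odd_double_factorial :: "nat \<Rightarrow> complex" where
  \<comment> \<open>the value at \<open>k\<close> is \<open>(2 k - 1)!!\<close>\<close>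
  "odd_double_factorial k = (\<Prod>i=1..k. 2 * of_nat i - 1)"

definition f_coeff :: "nat \<Rightarrow> nat \<Rightarrow> complex" where
  "f_coeff k j =
     (if k = 0 then 1
      else (-1) ^ k * (falling_factorial (of_nat j) k * double_rising_factorial (2 * of_nat j - 1) k)
             / (fact k * odd_double_factorial k))"

end

theory Submission
  imports Defs
begin

text \<open>
  Right multiplication by a Young symmetrizer \<open>Y\<close> acts on its Specht module by a scalar, so the
  normalized character at \<open>w\<close> is the average of \<open>Y (g\<inverse> w\<inverse> g)\<close> over all \<open>g\<close>. Expanding \<open>Y\<close> for a
  rectangle, and noting that placements of \<open>k\<close> labels with a repeated cell cancel in pairs, gives
  \<open>Ch_k (p \<times> q) = \<Sum> sgn \<tau> \<cdot> p ^ cyc \<sigma> \<cdot> q ^ cyc \<tau>\<close> over the factorizations \<open>\<sigma> \<tau>\<close> of a \<open>k\<close>-cycle.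

  The alternating sum of all hook symmetrizers is supported on \<open>k\<close>-cycles, and class functions act on
  them by scalars, which for \<open>\<Sum> x ^ cyc \<sigma> \<cdot> \<sigma>\<close> are products over contents. Hence the sum above is
  \<open>1 / k!\<close> times the difference of order \<open>k - 1\<close> in \<open>d\<close> of \<open>\<Prod>i<k. (e\<^sup>2 - (d - i)\<^sup>2)\<close>, where \<open>p = e - d\<close>,
  \<open>q = e + d\<close>. For \<open>k = 2 j - 1\<close> this is even in \<open>d\<close>; its central differences at \<open>0\<close> of order \<open>2 m\<close> are
  polynomials in \<open>e\<^sup>2\<close> of degree at most \<open>j - m\<close> that vanish at \<open>e = m, \<dots>, j - 1\<close> and reduce to a single
  term at \<open>e = j\<close>, which determines them.
\<close>

section \<open>Finite differences\<close>

text \<open>The scalar of \<open>Y\<close> and the dimension of the Specht module enter only through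
  their product, which the value at the identity shows to be n!, so neither has to be found
  separately. The von Neumann argument serves twice: for the rectangle, to turn a character into a
  sum over factorizations, and for hooks, to evaluate that sum at a long cycle. A hook with
  \<open>k\<close> cells and leg length \<open>a\<close> has the contents -a, ..., k - 1 - a, so all
  hooks contribute translates of one product, weighted by (-1)^a and the number of choices of the
  leg; this is the origin of the difference in \<open>d\<close>.

  The shape of the answer is then forced. The products of d^2 - r^2 are central factorials, dual to
  the central differences at 0, so the coefficient of the k-th one is such a difference of order 2
  k. Its zeros in e^2 give the second product, and its value at e = j, one binomial coefficient
  times the square of (2 j - 1)!, gives the constant Cat(j - 1) f_k(j).\<close>

definition bdiff :: "(complex \<Rightarrow> complex) \<Rightarrow> complex \<Rightarrow> complex" where
  "bdiff f = (\<lambda>x. f x - f (x + 1))"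

text \<open>Subtracting the shifted value, and not the other way round, gives the term of index
  \<open>a\<close> the sign (-1)^a for every order \<open>N\<close>, which is the sign of a hook
  with leg length \<open>a\<close>.\<close>

lemma bdiff_funpow:
  "(bdiff ^^ N) f x = (\<Sum>a\<le>N. (-1) ^ a * of_nat (N choose a) * f (x + of_nat a))"
proof (induction N arbitrary: x)
  case 0
  then show ?case by simp
next
  case (Suc N)
  let ?c = "\<lambda>N a. (-1) ^ a * of_nat (N choose a) :: complex"
  have "(bdiff ^^ Suc N) f x = (\<Sum>a\<le>N. ?c N a * f (x + of_nat a)) - (\<Sum>a\<le>N. ?c N a * f (x + 1 + of_nat a))"
    by (simp add: bdiff_def[of "(bdiff ^^ N) f"] Suc)
  also have "(\<Sum>a\<le>N. ?c N a * f (x + of_nat a)) = f x + (\<Sum>a\<le>N. ?c N (Suc a) * f (x + of_nat (Suc a)))"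
  proof -
    have "(\<Sum>a\<le>N. ?c N a * f (x + of_nat a)) = (\<Sum>a\<le>Suc N. ?c N a * f (x + of_nat a))"
      by (simp add: binomial_eq_0)
    also have "\<dots> = f x + (\<Sum>a\<le>N. ?c N (Suc a) * f (x + of_nat (Suc a)))"
      by (subst sum.atMost_Suc_shift) simp
    finally show ?thesis .
  qed
  also have "f x + (\<Sum>a\<le>N. ?c N (Suc a) * f (x + of_nat (Suc a))) - (\<Sum>a\<le>N. ?c N a * f (x + 1 + of_nat a))
     = f x + (\<Sum>a\<le>N. ?c (Suc N) (Suc a) * f (x + of_nat (Suc a)))"
    unfolding add_diff_eq[symmetric] sum_subtractf[symmetric]
    by (intro arg_cong2[of _ _ _ _ "(+)"] sum.cong refl) (simp add: algebra_simps)
  also have "\<dots> = (\<Sum>a\<le>Suc N. ?c (Suc N) a * f (x + of_nat a))"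
    by (subst sum.atMost_Suc_shift) simp
  finally show ?case .
qed

text \<open>The leading coefficients of \<open>p\<close> and of its translate cancel. The
  alternative \<open>q = 0\<close> covers constants, whose degree 0 cannot drop.\<close>

lemma bdiff_poly:
  obtains q where "bdiff (poly p) = poly q" "q = 0 \<or> degree q < degree p"
proof
  let ?q = "p - pcompose p [:1, 1:]"
  show "bdiff (poly p) = poly ?q"
    by (auto simp: bdiff_def poly_pcompose fun_eq_iff add.commute)
  have d: "degree (pcompose p [:1, 1:]) = degree p"
    by (simp add: degree_pcompose)
  have "lead_coeff (pcompose p [:1, 1:]) = lead_coeff p"
    by (subst lead_coeff_comp) auto
  then have "coeff ?q (degree p) = 0" using d by simp
  moreover have "degree ?q \<le> degree p" using d by (intro degree_diff_le) auto
  ultimately show "?q = 0 \<or> degree ?q < degree p"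
    by (metis leading_coeff_0_iff le_neq_implies_less)
qed

lemma bdiff_funpow_poly:
  obtains q where "(bdiff ^^ N) (poly p) = poly q" "q = 0 \<or> degree q + N \<le> degree p"
proof -
  have "\<exists>q. (bdiff ^^ N) (poly p) = poly q \<and> (q = 0 \<or> degree q + N \<le> degree p)"
  proof (induction N)
    case 0
    then show ?case by auto
  next
    case (Suc N)
    then obtain q where q: "(bdiff ^^ N) (poly p) = poly q" "q = 0 \<or> degree q + N \<le> degree p" by auto
    obtain q' where q': "bdiff (poly q) = poly q'" "q' = 0 \<or> degree q' < degree q"
      by (rule bdiff_poly)
    have "(bdiff ^^ Suc N) (poly p) = poly q'" using q q' by simp
    moreover have "q' = 0 \<or> degree q' + Suc N \<le> degree p"
      using q(2) q'(2) by auto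
    ultimately show ?case by blast
  qed
  then show ?thesis using that by blast
qed

lemma bdiff_funpow_poly_eq_0:
  assumes "degree p < N"
  shows "(bdiff ^^ N) (poly p) x = 0"
proof -
  obtain q where "(bdiff ^^ N) (poly p) = poly q" "q = 0 \<or> degree q + N \<le> degree p"
    by (rule bdiff_funpow_poly)
  then show ?thesis using assms by auto
qed

text \<open>At E = e^2 and x = d + a this is the product of (p + c) (q - c) over the contents c = i
  - a of the hook with \<open>K\<close> cells and leg length \<open>a\<close>, where p = e - d and q
  = e + d.\<close>

definition Phi :: "nat \<Rightarrow> complex \<Rightarrow> complex \<Rightarrow> complex" where
  "Phi K E x = (\<Prod>i<K. E - (x - of_nat i)\<^sup>2)"

text \<open>If \<open>E\<close> has weight 2 and \<open>x\<close> has weight 1, every factor has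
  weight at most 2. Hence a difference in \<open>x\<close> of high order kills the high powers of
  \<open>E\<close>.\<close>

lemma Phi_expand_E:
  obtains q where "\<And>E x. Phi K E x = (\<Sum>m\<le>K. E ^ m * poly (q m) x)" "\<And>m. degree (q m) \<le> 2 * (K - m)"
proof -
  \<comment> \<open>The clause for \<open>m > K\<close> lets the sum be extended to
    \<open>Suc K\<close> in the induction.\<close>
  have "\<exists>q. (\<forall>E x. Phi K E x = (\<Sum>m\<le>K. E ^ m * poly (q m) x)) \<and> (\<forall>m. degree (q m) \<le> 2 * (K - m) \<and> (m > K \<longrightarrow> q m = 0))"
  proof (induction K)
    case 0
    show ?case
      by (rule exI[of _ "\<lambda>m. if m = 0 then 1 else 0"]) (auto simp: Phi_def)
  next
    case (Suc K)
    then obtain q where q: "\<And>E x. Phi K E x = (\<Sum>m\<le>K. E ^ m * poly (q m) x)"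
      "\<And>m. degree (q m) \<le> 2 * (K - m)" "\<And>m. m > K \<Longrightarrow> q m = 0" by auto
    define s where "s = [:- of_nat K, 1 :: complex:] ^ 2"
    have ds: "degree s \<le> 2" unfolding s_def by (rule order.trans[OF degree_power_le]) auto
    define q' where "q' m = (if m = 0 then 0 else q (m - 1)) - s * q m" for m
    have "Phi (Suc K) E x = (\<Sum>m\<le>Suc K. E ^ m * poly (q' m) x)" for E x
    proof -
      have "Phi (Suc K) E x = (\<Sum>m\<le>K. E ^ m * poly (q m) x) * (E - (x - of_nat K)\<^sup>2)"
        by (simp add: Phi_def q(1)[symmetric, unfolded Phi_def])
      also have "\<dots> = (\<Sum>m\<le>K. E ^ Suc m * poly (q m) x) - (\<Sum>m\<le>K. E ^ m * poly (s * q m) x)"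
        by (simp add: s_def sum_subtractf sum_distrib_left sum_distrib_right algebra_simps)
      also have "(\<Sum>m\<le>K. E ^ m * poly (s * q m) x) = (\<Sum>m\<le>Suc K. E ^ m * poly (s * q m) x)"
        using q(3)[of "Suc K"] by simp
      also have "(\<Sum>m\<le>K. E ^ Suc m * poly (q m) x) = (\<Sum>m\<le>Suc K. E ^ m * poly (if m = 0 then 0 else q (m - 1)) x)"
        by (subst sum.atMost_Suc_shift) simp
      finally show ?thesis
        by (simp only: q'_def poly_diff right_diff_distrib sum_subtractf)
    qed
    moreover have "degree (q' m) \<le> 2 * (Suc K - m) \<and> (m > Suc K \<longrightarrow> q' m = 0)" for m
    proof
      have a: "degree (if m = 0 then 0 else q (m - 1)) \<le> 2 * (Suc K - m)"
        using q(2)[of "m - 1"] by auto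
      have b: "degree (s * q m) \<le> 2 * (Suc K - m)"
      proof (cases "m \<le> K")
        case True
        then show ?thesis using ds q(2)[of m] degree_mult_le[of s "q m"] by linarith
      qed (simp add: q(3))
      show "degree (q' m) \<le> 2 * (Suc K - m)"
        unfolding q'_def using a b by (rule degree_diff_le)
      show "m > Suc K \<longrightarrow> q' m = 0" using q(3)[of m] q(3)[of "m-1"] by (auto simp: q'_def)
    qed
    ultimately show ?case by blast
  qed
  then show ?thesis using that by blast
qed

lemma Phi_poly:
  obtains p where "Phi K E = poly p" "degree p \<le> 2 * K"
proof
  let ?p = "\<Prod>i<K. [:E:] - [:- of_nat i, 1:] ^ 2"
  show "Phi K E = poly ?p" by (auto simp: Phi_def poly_prod fun_eq_iff)
  have "degree ?p \<le> (\<Sum>i<K. 2)"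
    by (rule order.trans[OF degree_prod_sum_le])
      (auto simp del: sum_constant intro!: sum_mono degree_diff_le order.trans[OF degree_power_le])
  then show "degree ?p \<le> 2 * K" by simp
qed

lemma Phi_sq_eq_0:
  assumes "i < K" "int i = x - int r \<or> int i = x + int r"
  shows "Phi K ((of_nat r)\<^sup>2) (of_int x) = 0"
proof -
  have "(of_nat r)\<^sup>2 - (of_int x - of_nat i :: complex)\<^sup>2 = of_int ((int r)\<^sup>2 - (x - int i)\<^sup>2)" by simp
  also have "(int r)\<^sup>2 - (x - int i)\<^sup>2 = 0" using assms(2) by (auto simp: power2_eq_square algebra_simps)
  finally show ?thesis unfolding Phi_def using assms(1) by (intro prod_zero) auto
qed

text \<open>At E = j^2 and x = j - 1 the indices x - j = -1 and x + j = 2 j - 1 of a possible zero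
  factor both lie just outside the range. Each factor is (i + 1) (2 j - 1 - i), and either family
  multiplies to (2 j - 1)!.\<close>

lemma Phi_at_boundary:
  assumes "j \<ge> 1"
  shows "Phi (2 * j - 1) ((of_nat j)\<^sup>2) (of_nat (j - 1)) = (fact (2 * j - 1))\<^sup>2"
proof -
  let ?K = "2 * j - 1"
  have "Phi ?K ((of_nat j)\<^sup>2) (of_nat (j - 1)) = (\<Prod>i<?K. of_nat (i + 1) * of_nat (?K - i))"
    unfolding Phi_def
  proof (rule prod.cong[OF refl])
    fix i assume "i \<in> {..<?K}"
    then have "of_nat (?K - i) = (2 * of_nat j - 1 - of_nat i :: complex)"
      using assms by (simp add: of_nat_diff)
    moreover have "of_nat (j - 1) = (of_nat j - 1 :: complex)" using assms by (simp add: of_nat_diff)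
    ultimately show "(of_nat j)\<^sup>2 - (of_nat (j - 1) - of_nat i)\<^sup>2 = (of_nat (i + 1) * of_nat (?K - i) :: complex)"
      by (simp only: power2_eq_square of_nat_add of_nat_1) (simp add: algebra_simps)
  qed
  also have "\<dots> = (\<Prod>i<?K. of_nat (i + 1)) * (\<Prod>i<?K. of_nat (?K - i))" by (rule prod.distrib)
  also have "(\<Prod>i<?K. of_nat (?K - i)) = (\<Prod>i<?K. of_nat (i + 1) :: complex)"
    by (rule prod.reindex_bij_witness[of _ "\<lambda>i. ?K - 1 - i" "\<lambda>i. ?K - 1 - i"]) (auto simp: of_nat_diff)
  also have "(\<Prod>i<?K. of_nat (i + 1) :: complex) = fact ?K"
    unfolding fact_prod_Suc by (simp add: atLeast0LessThan)
  finally show ?thesis by (simp add: power2_eq_square)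
qed

section \<open>Closed forms of the constants by factorials\<close>

lemma odd_double_factorial_closed:
  "odd_double_factorial k = fact (2 * k) / (2 ^ k * fact k)"
proof (induction k)
  case (Suc k)
  have nz: "(1 + of_nat k :: complex) \<noteq> 0" using of_nat_neq_0[of k] by simp
  have "odd_double_factorial (Suc k) = odd_double_factorial k * (2 * of_nat k + 1)"
    by (simp add: odd_double_factorial_def)
  also have "\<dots> = fact (2 * Suc k) / (2 ^ Suc k * fact (Suc k))"
    using nz unfolding Suc by (simp add: divide_simps)
  finally show ?case .
qed (simp add: odd_double_factorial_def)

lemma double_rising_factorial_closed:
  assumes "j \<ge> 1"
  shows "double_rising_factorial (2 * of_nat j - 1) k =
    fact (2 * j + 2 * k - 2) * fact (j - 1) / (fact (2 * j - 2) * 2 ^ k * fact (j + k - 1))"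
proof (induction k)
  case 0
  then show ?case by (simp add: double_rising_factorial_def)
next
  case (Suc k)
  obtain i where j: "j = Suc i" using assms by (cases j) auto
  have nz: "(1 + of_nat i + of_nat k :: complex) \<noteq> 0"
    using of_nat_neq_0[of "i + k"] by (simp add: ac_simps)
  show ?case using Suc nz unfolding j
    by (simp add: double_rising_factorial_def divide_simps ac_simps) (simp add: algebra_simps)
qed

lemma falling_factorial_closed:
  assumes "k \<le> j"
  shows "falling_factorial (of_nat j) k = fact j / fact (j - k)"
  using assms
proof (induction k)
  case 0
  then show ?case by (simp add: falling_factorial_def)
next
  case (Suc k)
  then have "j - k = Suc (j - Suc k)" by simp
  then have "(fact (j - k) :: complex) = of_nat (j - k) * fact (j - Suc k)" by simp
  then show ?case using Suc by (simp add: falling_factorial_def of_nat_diff divide_simps mult.assoc)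
qed

text \<open>Up to sign this is the central binomial coefficient of 2 j + 2 k - 2 times (j + k - 1)!
  / ((2 k)! (j - k)!), the form in which the constant comes out of the comparison at E = j^2 in
  \<open>bdiff_Phi_central\<close>.\<close>

lemma Cat_f_coeff_closed:
  assumes "j \<ge> 1" "k \<le> j"
  shows "(-1) ^ (j - 1) * Cat (j - 1) * f_coeff k j =
    (-1) ^ (k + j - 1) * fact (2 * j + 2 * k - 2) / (fact (2 * k) * fact (j + k - 1) * fact (j - k))"
proof -
  \<comment> \<open>At \<open>k = 0\<close> all products are empty, so the general formula gives 1
    there as well.\<close>
  have 1: "f_coeff k j = (-1) ^ k * (falling_factorial (of_nat j) k * double_rising_factorial (2 * of_nat j - 1) k)
             / (fact k * odd_double_factorial k)"
    by (simp add: f_coeff_def falling_factorial_def double_rising_factorial_def odd_double_factorial_def)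
  have s: "(-1 :: complex) ^ (k + j - 1) = (-1) ^ (j - 1) * (-1) ^ k"
    using assms by (simp add: power_add[symmetric] add.commute)
  show ?thesis
    unfolding 1 s odd_double_factorial_closed double_rising_factorial_closed[OF assms(1)]
      falling_factorial_closed[OF assms(2)] Cat_def
    using assms(1) by (simp add: divide_simps diff_mult_distrib2)
qed

text \<open>The factors j - r run through j - k, ..., 1 and the factors j + r through j + k, ..., 2
  j - 1.\<close>

lemma prod_sq_diff_at_boundary:
  assumes "j \<ge> 1" "k \<le> j"
  shows "(\<Prod>r=k..<j. (of_nat j)\<^sup>2 - (of_nat r)\<^sup>2) = (fact (j - k) * fact (2 * j - 1) / fact (j + k - 1) :: complex)"
  using assms(2)
proof (induction "j - k" arbitrary: k)
  case 0
  then have "k = j" by simp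
  then show ?case by (simp add: mult_2)
next
  case (Suc n)
  then have kj: "k < j" "j - k = Suc (j - Suc k)" by auto
  have IH: "(\<Prod>r=Suc k..<j. (of_nat j)\<^sup>2 - (of_nat r)\<^sup>2) = (fact (j - Suc k) * fact (2 * j - 1) / fact (j + k) :: complex)"
    using Suc.hyps(1)[of "Suc k"] Suc.hyps(2) kj by simp
  have f1: "(fact (j - k) :: complex) = (of_nat j - of_nat k) * fact (j - Suc k)"
    using kj by (simp add: of_nat_diff)
  have "j + k = Suc (j + k - 1)" using kj by simp
  then have f2: "(fact (j + k) :: complex) = (of_nat j + of_nat k) * fact (j + k - 1)"
    by (metis fact_Suc of_nat_add)
  have nz: "(of_nat j + of_nat k :: complex) \<noteq> 0"
    using kj by (metis of_nat_add of_nat_eq_0_iff add_is_0 not_less_zero)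
  have "(\<Prod>r=k..<j. (of_nat j)\<^sup>2 - (of_nat r)\<^sup>2 :: complex) = ((of_nat j)\<^sup>2 - (of_nat k)\<^sup>2) * (\<Prod>r=Suc k..<j. (of_nat j)\<^sup>2 - (of_nat r)\<^sup>2)"
    using kj(1) by (rule prod.atLeast_Suc_lessThan)
  also have "\<dots> = ((of_nat j - of_nat k) * fact (j - Suc k)) * fact (2 * j - 1) / fact (j + k - 1)"
    unfolding IH f2 using nz by (simp add: divide_simps power2_eq_square) (simp add: algebra_simps)
  finally show ?case unfolding f1 .
qed

text \<open>The order is 2 j - 2, from the sum over hooks, plus 2 k: an iterated difference of order
  2 k started at -k is the central one at 0. Both sides are compared as polynomials in
  \<open>E\<close> at the j - k + 1 points r^2 with k \<le> r \<le> j.\<close>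

lemma bdiff_Phi_central:
  assumes "j \<ge> 1" "k \<le> j"
  shows "(bdiff ^^ (2 * j - 2 + 2 * k)) (Phi (2 * j - 1) E) (- of_nat k) =
    fact (2 * k) * fact (2 * j - 1) * ((-1) ^ (j - 1) * Cat (j - 1) * f_coeff k j) * (\<Prod>r=k..<j. E - (of_nat r)\<^sup>2)"
proof -
  let ?K = "2 * j - 1" and ?N = "2 * j - 2 + 2 * k"
  define c where "c = fact (2 * k) * fact ?K * ((-1) ^ (j - 1) * Cat (j - 1) * f_coeff k j)"
  obtain q where q: "\<And>E x. Phi ?K E x = (\<Sum>m\<le>?K. E ^ m * poly (q m) x)" "\<And>m. degree (q m) \<le> 2 * (?K - m)"
    using Phi_expand_E[of ?K] by blast
  define b where "b m = (bdiff ^^ ?N) (poly (q m)) (- of_nat k)" for m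
  define B where "B = (\<Sum>m\<le>j - k. monom (b m) m)"
  have B: "(bdiff ^^ ?N) (Phi ?K E) (- of_nat k) = poly B E" for E
  proof -
    have "(bdiff ^^ ?N) (Phi ?K E) (- of_nat k) = (\<Sum>m\<le>?K. E ^ m * b m)"
      unfolding b_def bdiff_funpow q(1) sum_distrib_left
      by (subst sum.swap) (simp add: mult_ac)
    also have "\<dots> = (\<Sum>m\<le>j - k. E ^ m * b m)"
    proof (rule sum.mono_neutral_right)
      show "\<forall>m\<in>{..?K} - {..j - k}. E ^ m * b m = 0"
      proof
        fix m assume "m \<in> {..?K} - {..j - k}"
        \<comment> \<open>For m > j - k the bound 2 (K - m) = 4 j - 2 - 2 m lies below 2 j - 2 + 2
          k.\<close>
        then have "degree (q m) < ?N" using q(2)[of m] assms by auto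
        then show "E ^ m * b m = 0" unfolding b_def by (simp add: bdiff_funpow_poly_eq_0)
      qed
    qed (use assms in auto)
    finally show ?thesis by (simp add: B_def poly_sum poly_monom mult.commute)
  qed
  define R where "R = smult c (\<Prod>r=k..<j. [:- (of_nat r)\<^sup>2, 1:])"
  have R: "poly R E = c * (\<Prod>r=k..<j. E - (of_nat r)\<^sup>2)" for E
    by (simp add: R_def poly_prod)
  have "B = R"
  proof (rule poly_eqI_degree)
    let ?A = "(\<lambda>r. (of_nat r)\<^sup>2 :: complex) ` {k..j}"
    have "inj_on (\<lambda>r. (of_nat r)\<^sup>2 :: complex) {k..j}"
      by (rule inj_onI) (metis of_nat_power of_nat_eq_iff power2_eq_iff_nonneg zero_le)
    then have cA: "card ?A = j - k + 1" using assms by (simp add: card_image Suc_diff_le)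
    have "degree B \<le> j - k" unfolding B_def
      by (rule degree_sum_le) (auto intro: order.trans[OF degree_monom_le])
    then show "degree B < card ?A" unfolding cA by simp
    have "degree R \<le> (\<Sum>r=k..<j. 1)" unfolding R_def
      by (rule order.trans[OF degree_smult_le], rule order.trans[OF degree_prod_sum_le]) auto
    then show "degree R < card ?A" unfolding cA by simp
    fix x assume "x \<in> ?A"
    then obtain r where r: "k \<le> r" "r \<le> j" "x = (of_nat r)\<^sup>2" by auto
    have Bx: "poly B x = (\<Sum>a\<le>?N. (-1) ^ a * of_nat (?N choose a) * Phi ?K x (of_int (int a - int k)))"
      by (simp add: B[symmetric] bdiff_funpow)
    \<comment> \<open>The factor of index a - k - r vanishes if that number is nonnegative,
      otherwise the factor of index a - k + r; k \<le> r keeps the first index below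
      \<open>K\<close> and the second nonnegative. Only for r = j and a = k + j - 1 are the two
      numbers -1 and K.\<close>
    have z: "Phi ?K x (of_int (int a - int k)) = 0" if "a \<le> ?N" "\<not> (r = j \<and> a = k + j - 1)" for a
    proof (cases "a \<ge> k + r")
      case True
      then show ?thesis unfolding r(3) using r that assms
        by (intro Phi_sq_eq_0[of "a - k - r"]) auto
    next
      case False
      then show ?thesis unfolding r(3) using r that assms
        by (intro Phi_sq_eq_0[of "a + r - k"]) auto
    qed
    show "poly B x = poly R x"
    proof (cases "r = j")
      case False
      then have "poly B x = 0" unfolding Bx using z by (intro sum.neutral) auto
      moreover have "poly R x = 0" unfolding R r(3) using r False
        by (intro mult_zero_right[THEN trans[rotated]] arg_cong[of _ _ "(*) c"] prod_zero) auto
      ultimately show ?thesis by simp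
    next
      case True
      let ?a = "k + j - 1"
      have a: "?a \<le> ?N" using assms by auto
      have "poly B x = (\<Sum>a\<in>{?a}. (-1) ^ a * of_nat (?N choose a) * Phi ?K x (of_int (int a - int k)))"
        unfolding Bx by (rule sum.mono_neutral_right) (use a z in auto)
      also have "\<dots> = (-1) ^ ?a * of_nat (?N choose ?a) * Phi ?K x (of_nat (j - 1))"
        using assms by (simp add: of_nat_diff)
      also have "\<dots> = (-1) ^ ?a * of_nat (?N choose ?a) * (fact ?K)\<^sup>2"
        unfolding r(3) True Phi_at_boundary[OF assms(1)] ..
      also have "of_nat (?N choose ?a) = (fact (2 * j + 2 * k - 2) / (fact ?a * fact ?a) :: complex)"
      proof -
        have "?N - ?a = ?a" "?N = 2 * j + 2 * k - 2" using assms by auto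
        then show ?thesis using binomial_fact[OF a, where ?'a = complex] by simp
      qed
      finally have l: "poly B x = (-1) ^ ?a * (fact (2 * j + 2 * k - 2) / (fact ?a * fact ?a)) * (fact ?K)\<^sup>2" .
      have "poly R x = c * (fact (j - k) * fact ?K / fact (j + k - 1))"
        unfolding R r(3) True using prod_sq_diff_at_boundary[OF assms] by simp
      then show ?thesis unfolding l c_def Cat_f_coeff_closed[OF assms]
        by (simp add: field_simps power2_eq_square add.commute)
    qed
  qed
  then show ?thesis using B R by (simp add: c_def)
qed


section \<open>Evenness in d and expansion in central factorials\<close>

lemma Phi_reflect: "K \<ge> 1 \<Longrightarrow> Phi K E (of_nat (K - 1) - x) = Phi K E x"
  unfolding Phi_def
  by (rule prod.reindex_bij_witness[of _ "\<lambda>i. K - 1 - i" "\<lambda>i. K - 1 - i"])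
    (auto simp: of_nat_diff power2_eq_square algebra_simps)

text \<open>\<open>Phi\<close> is symmetric about (K - 1) / 2 = j - 1, and a difference of order 2 j
  - 2 moves the centre of symmetry by j - 1, to 0. The order is even because \<open>K\<close> is
  odd, so reversing the summation keeps the signs.\<close>

lemma bdiff_Phi_even:
  assumes "j \<ge> 1"
  shows "(bdiff ^^ (2 * j - 2)) (Phi (2 * j - 1) E) (- x) = (bdiff ^^ (2 * j - 2)) (Phi (2 * j - 1) E) x"
  unfolding bdiff_funpow
proof (rule sum.reindex_bij_witness[of _ "\<lambda>a. 2 * j - 2 - a" "\<lambda>a. 2 * j - 2 - a"])
  fix a assume a: "a \<in> {..2 * j - 2}"
  have "Phi (2 * j - 1) E (x + of_nat (2 * j - 2 - a)) = Phi (2 * j - 1) E (of_nat (2 * j - 1 - 1) - (- x + of_nat a))"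
    by (rule arg_cong[of _ _ "Phi (2 * j - 1) E"]) (use a assms in \<open>auto simp: of_nat_diff\<close>)
  also have "\<dots> = Phi (2 * j - 1) E (- x + of_nat a)" using assms by (intro Phi_reflect) auto
  finally show "(-1) ^ (2 * j - 2 - a) * of_nat ((2 * j - 2) choose (2 * j - 2 - a)) * Phi (2 * j - 1) E (x + of_nat (2 * j - 2 - a)) =
         (-1) ^ a * of_nat ((2 * j - 2) choose a) * Phi (2 * j - 1) E (- x + of_nat a)"
    using a assms binomial_symmetric[of a "2 * j - 2"] by (auto simp: minus_one_power_iff)
qed auto

text \<open>Central factorials, a basis of the even polynomials adapted to central differences at 0;
  these are the products in \<open>d\<close> of the theorem.\<close>

definition cfact :: "nat \<Rightarrow> complex \<Rightarrow> complex" where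
  "cfact m x = (\<Prod>r=0..<m. x\<^sup>2 - (of_nat r)\<^sup>2)"

lemma cfact_poly:
  obtains p where "cfact m = poly p" "degree p \<le> 2 * m"
proof
  let ?p = "\<Prod>r=0..<m. [:0, 1 :: complex:] ^ 2 - [:(of_nat r)\<^sup>2:]"
  show "cfact m = poly ?p" by (auto simp: cfact_def poly_prod fun_eq_iff)
  have "degree ([:0, 1 :: complex:] ^ 2 - [:c:]) \<le> 2" for c
    by (rule degree_diff_le) (simp_all add: power2_eq_square)
  then have "degree ?p \<le> (\<Sum>r=0..<m. 2)"
    by (intro order.trans[OF degree_prod_sum_le] sum_mono) auto
  then show "degree ?p \<le> 2 * m" by simp
qed

lemma cfact_even: "cfact m (- x) = cfact m x"
  by (simp add: cfact_def)

lemma cfact_eq_0: "i < m \<Longrightarrow> cfact m (of_nat i) = 0"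
  unfolding cfact_def by (rule prod_zero) (auto intro!: bexI[of _ i])

lemma cfact_top: "k \<ge> 1 \<Longrightarrow> 2 * cfact k (of_nat k) = fact (2 * k)"
  using prod_sq_diff_at_boundary[of k 0] fact_reduce[of "2 * k", where ?'a = complex] fact_reduce[of k, where ?'a = complex]
  by (simp add: cfact_def)

lemma sum_atMost_ends:
  fixes k :: nat
  assumes "k \<ge> 1" "\<And>a. 0 < a \<Longrightarrow> a < 2 * k \<Longrightarrow> f a = (0 :: complex)"
  shows "(\<Sum>a\<le>2 * k. f a) = f 0 + f (2 * k)"
proof -
  have "(\<Sum>a\<le>2 * k. f a) = (\<Sum>a\<in>{0, 2 * k}. f a)"
    by (rule sum.mono_neutral_right) (use assms in auto)
  then show ?thesis using assms by simp
qed

text \<open>In the window -k, ..., k only the two ends survive. Both have coefficient 1 and the same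
  value; for \<open>k = 0\<close> they coincide, whence the factor 1 in place of 2.\<close>

lemma bdiff_even_ends:
  assumes even: "\<And>x. f (- x) = f x" and z: "\<And>i. i < k \<Longrightarrow> f (of_nat i) = 0"
  shows "(bdiff ^^ (2 * k)) f (- of_nat k) = (if k = 0 then 1 else 2) * f (of_nat k)"
proof (cases "k = 0")
  case False
  have "f (- of_nat k + of_nat a) = 0" if "0 < a" "a < 2 * k" for a
  proof (cases "a \<le> k")
    case True
    then have "- of_nat k + of_nat a = - (of_nat (k - a) :: complex)" by (simp add: of_nat_diff)
    then show ?thesis using even[of "of_nat (k - a)"] z[of "k - a"] True that by (simp only:)
  next
    case False
    then have "- of_nat k + of_nat a = (of_nat (a - k) :: complex)" by (simp add: of_nat_diff)
    then show ?thesis using z[of "a - k"] that by simp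
  qed
  then show ?thesis using False unfolding bdiff_funpow
    by (subst sum_atMost_ends) (auto simp: even)
qed simp

text \<open>Duality of central factorials and central differences: for \<open>m < k\<close> the
  degree is below the order, and for \<open>m > k\<close> the ends of the window are zeros
  too.\<close>

lemma bdiff_cfact:
  "(bdiff ^^ (2 * k)) (cfact m) (- of_nat k) = (if m = k then fact (2 * k) else 0)"
proof (cases "m < k")
  case True
  obtain p where "cfact m = poly p" "degree p \<le> 2 * m" by (rule cfact_poly)
  then show ?thesis using True by (simp add: bdiff_funpow_poly_eq_0)
next
  case False
  then have "(bdiff ^^ (2 * k)) (cfact m) (- of_nat k) = (if k = 0 then 1 else 2) * cfact m (of_nat k)"
    by (intro bdiff_even_ends cfact_even cfact_eq_0) auto
  then show ?thesis using False cfact_top[of k] by (auto simp: cfact_eq_0) (simp add: cfact_def)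
qed

lemma bdiff_funpow_diff: "(bdiff ^^ N) (\<lambda>x. f x - g x) x = (bdiff ^^ N) f x - (bdiff ^^ N) g x"
  by (simp add: bdiff_funpow algebra_simps sum_subtractf)

lemma bdiff_funpow_sum:
  "(bdiff ^^ N) (\<lambda>x. \<Sum>m\<in>A. c m * f m x) x = (\<Sum>m\<in>A. c m * (bdiff ^^ N) (f m) x)"
  unfolding bdiff_funpow sum_distrib_left by (subst sum.swap) (simp add: mult_ac)

text \<open>The difference \<open>g\<close> of both sides is even in \<open>d\<close>, of degree at
  most 2 j, and all its central differences at 0 of orders 0, 2, ..., 2 j vanish. This forces the 2
  j + 1 zeros -j, ..., j, one more than the degree allows.\<close>

theorem bdiff_Phi:
  assumes j: "j \<ge> 1"
  shows "(bdiff ^^ (2 * j - 2)) (Phi (2 * j - 1) E) d = fact (2 * j - 1) * ((-1) ^ (j - 1) * Cat (j - 1) *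
    (\<Sum>k=0..j. f_coeff k j * (\<Prod>r=0..<k. d\<^sup>2 - (of_nat r)\<^sup>2) * (\<Prod>r=k..<j. E - (of_nat r)\<^sup>2)))"
proof -
  let ?K = "2 * j - 1"
  define b where "b k = fact ?K * ((-1) ^ (j - 1) * Cat (j - 1) * f_coeff k j) * (\<Prod>r=k..<j. E - (of_nat r)\<^sup>2)" for k
  define L where "L = (bdiff ^^ (2 * j - 2)) (Phi ?K E)"
  define R where "R = (\<lambda>x. \<Sum>k=0..j. b k * cfact k x)"
  define g where "g = (\<lambda>x. L x - R x)"
  have even: "g (- x) = g x" for x
    unfolding g_def L_def R_def using bdiff_Phi_even[OF j] by (simp add: cfact_even)
  have central: "(bdiff ^^ (2 * k)) g (- of_nat k) = 0" if "k \<le> j" for k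
  proof -
    have "(bdiff ^^ (2 * k)) L (- of_nat k) = fact (2 * k) * b k"
      unfolding L_def funpow_add[symmetric, THEN fun_cong, unfolded o_def]
      using bdiff_Phi_central[OF j that, of E] by (simp add: b_def add.commute)
    moreover have "(bdiff ^^ (2 * k)) R (- of_nat k) = fact (2 * k) * b k"
      unfolding R_def bdiff_funpow_sum bdiff_cfact using that by (simp add: if_distrib sum.delta' cong: if_cong)
    ultimately show ?thesis unfolding g_def bdiff_funpow_diff by simp
  qed
  have nat: "g (of_nat k) = 0" if "k \<le> j" for k
    using that
  proof (induction k rule: less_induct)
    case (less k)
    \<comment> \<open>Once \<open>g\<close> vanishes at 0, ..., k - 1, its central difference of
      order 2 k is a nonzero multiple of its value at \<open>k\<close>.\<close>
    then show ?case using bdiff_even_ends[of g k, OF even] central[of k] by (auto split: if_splits)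
  qed
  obtain P where P: "Phi ?K E = poly P" "degree P \<le> 2 * ?K" by (rule Phi_poly)
  obtain l where l: "L = poly l" "l = 0 \<or> degree l + (2 * j - 2) \<le> degree P"
    unfolding L_def P by (rule bdiff_funpow_poly)
  \<comment> \<open>The differences lower the degree to 2 (2 j - 1) - (2 j - 2) = 2 j.\<close>
  have dl: "degree l \<le> 2 * j" using l(2) P(2) j by auto
  have "\<forall>m. \<exists>p. cfact m = poly p \<and> degree p \<le> 2 * m" using cfact_poly by metis
  then obtain u where u: "\<And>m. cfact m = poly (u m)" "\<And>m. degree (u m) \<le> 2 * m" by metis
  define G where "G = l - (\<Sum>k=0..j. smult (b k) (u k))"
  have G: "g = poly G" by (simp add: G_def g_def R_def l u poly_sum fun_eq_iff)
  have "degree (\<Sum>k=0..j. smult (b k) (u k)) \<le> 2 * j"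
    by (rule degree_sum_le) (auto intro!: order.trans[OF degree_smult_le] order.trans[OF u(2)])
  then have dG: "degree G \<le> 2 * j" unfolding G_def using dl by (intro degree_diff_le)
  have "G = 0"
  proof (rule poly_eqI_degree)
    let ?A = "of_int ` {- int j..int j} :: complex set"
    have "card ?A = 2 * j + 1" by (subst card_image) (auto simp: inj_on_def)
    then show "degree G < card ?A" "degree 0 < card ?A" using dG by auto
    fix x assume "x \<in> ?A"
    then obtain i where i: "x = of_int i" "\<bar>i\<bar> \<le> int j" by auto
    have "g x = g (of_nat (nat \<bar>i\<bar>))" using even[of x] i by (auto simp: abs_if)
    then show "poly G x = poly 0 x" using nat[of "nat \<bar>i\<bar>"] i by (simp add: G[symmetric])
  qed
  then have "L d = R d" using fun_cong[OF G, of d] by (simp add: g_def)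
  then show ?thesis unfolding L_def R_def b_def cfact_def sum_distrib_left by (simp add: mult_ac)
qed

section \<open>Young symmetrizers\<close>

lemma permutes_inv_comp_cancel:
  assumes "g permutes A"
  shows "inv g \<circ> g = id" "g \<circ> inv g = id" "inv g \<circ> (g \<circ> h) = h" "g \<circ> (inv g \<circ> h) = h"
    "(h \<circ> g) \<circ> inv g = h" "(h \<circ> inv g) \<circ> g = h"
  using permutes_inv_o[OF assms] by (simp_all add: fun_eq_iff permutes_inverses[OF assms])

lemma permutes_inv_comp:
  assumes "g permutes A" "h permutes A"
  shows "inv (g \<circ> h) = inv h \<circ> inv g"
  using assms by (intro o_inv_distrib permutes_bij)

lemma sign_comp_permutes:
  assumes "finite A" "p permutes A" "q permutes A"
  shows "sign (p \<circ> q) = sign p * sign q"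
  using assms by (meson sign_compose permutes_imp_permutation)

lemma sign_inv_permutes:
  assumes "finite A" "p permutes A"
  shows "sign (inv p) = sign p"
  using assms by (meson sign_inverse permutes_imp_permutation)

lemma sum_permutations_conj:
  assumes "q permutes A"
  shows "(\<Sum>p | p permutes A. f p) = (\<Sum>p | p permutes A. f (q \<circ> p \<circ> inv q))"
  by (subst setum_permutations_compose_left[OF assms],
      subst sum_permutations_compose_right[OF permutes_inv[OF assms]]) (simp add: o_assoc)

lemma convolution_assoc:
  "convolution n (convolution n x y) z = convolution n x (convolution n y z)"
proof
  fix g
  let ?P = "{h. h permutes {..<n}}"
  have "convolution n (convolution n x y) z g = (\<Sum>h\<in>?P. \<Sum>u\<in>?P. x h * y (inv h \<circ> u) * z (inv u \<circ> g))"
    unfolding convolution_def sum_distrib_right by (rule sum.swap)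
  also have "\<dots> = (\<Sum>h\<in>?P. \<Sum>u\<in>?P. x h * y u * z (inv u \<circ> (inv h \<circ> g)))"
  proof (rule sum.cong[OF refl])
    fix h assume "h \<in> ?P"
    then have h: "h permutes {..<n}" by simp
    show "(\<Sum>u\<in>?P. x h * y (inv h \<circ> u) * z (inv u \<circ> g)) = (\<Sum>u\<in>?P. x h * y u * z (inv u \<circ> (inv h \<circ> g)))"
      by (subst setum_permutations_compose_left[OF h])
        (auto intro!: sum.cong simp: permutes_inv_comp[OF h] permutes_inv_comp_cancel[OF h] o_assoc[symmetric])
  qed
  also have "\<dots> = convolution n x (convolution n y z) g"
    unfolding convolution_def sum_distrib_left by (simp add: mult.assoc)
  finally show "convolution n (convolution n x y) z g = convolution n x (convolution n y z) g" .
qed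

text \<open>Values off the group are left free, since the weights x ^ \<open>ncyc\<close> used below
  do not vanish there.\<close>

definition class_function :: "nat \<Rightarrow> ((nat \<Rightarrow> nat) \<Rightarrow> complex) \<Rightarrow> bool" where
  "class_function n F \<longleftrightarrow> (\<forall>g h. g permutes {..<n} \<longrightarrow> h permutes {..<n} \<longrightarrow> F (h \<circ> g \<circ> inv h) = F g)"

lemma class_function_convolution:
  assumes "class_function n F" "class_function n G"
  shows "class_function n (convolution n F G)"
  unfolding class_function_def
proof (intro allI impI)
  fix g h assume g: "g permutes {..<n}" and h: "h permutes {..<n}"
  have "convolution n F G (h \<circ> g \<circ> inv h) =
      (\<Sum>u | u permutes {..<n}. F (h \<circ> u \<circ> inv h) * G (inv (h \<circ> u \<circ> inv h) \<circ> (h \<circ> g \<circ> inv h)))"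
    unfolding convolution_def by (rule sum_permutations_conj[OF h])
  also have "\<dots> = (\<Sum>u | u permutes {..<n}. F u * G (inv u \<circ> g))"
  proof (rule sum.cong[OF refl])
    fix u assume "u \<in> {u. u permutes {..<n}}"
    then have u: "u permutes {..<n}" by simp
    have "inv (h \<circ> u \<circ> inv h) = h \<circ> inv u \<circ> inv h"
      using u h by (simp add: permutes_inv_comp[of _ "{..<n}"] permutes_compose permutes_inv permutes_inv_inv o_assoc)
    then have "inv (h \<circ> u \<circ> inv h) \<circ> (h \<circ> g \<circ> inv h) = h \<circ> (inv u \<circ> g) \<circ> inv h"
      by (simp add: o_assoc[symmetric] permutes_inv_comp_cancel[OF h])
    then show "F (h \<circ> u \<circ> inv h) * G (inv (h \<circ> u \<circ> inv h) \<circ> (h \<circ> g \<circ> inv h)) = F u * G (inv u \<circ> g)"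
      using assms u g h by (simp add: class_function_def permutes_compose permutes_inv)
  qed
  finally show "convolution n F G (h \<circ> g \<circ> inv h) = convolution n F G g"
    by (simp add: convolution_def)
qed

text \<open>
  The second assumption is the combinatorial core of von Neumann's lemma; it holds for every Young
  diagram and is checked here only for rectangles and hooks.
\<close>

locale young =
  fixes n :: nat and T :: "nat \<Rightarrow> nat \<times> nat"
  assumes inj: "inj_on T {..<n}"
    and full: "\<And>g. g permutes {..<n} \<Longrightarrow> inj_on (\<lambda>m. (fst (T m), snd (T (g m)))) {..<n} \<Longrightarrow>
      (\<lambda>m. (fst (T m), snd (T (g m)))) ` {..<n} \<subseteq> T ` {..<n}"
begin

abbreviation "R \<equiv> row_stabilizer n T"
abbreviation "C \<equiv> column_stabilizer n T"
abbreviation "Y \<equiv> young_symmetrizer n T"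

lemma R_permutes: "r \<in> R \<Longrightarrow> r permutes {..<n}"
  and C_permutes: "s \<in> C \<Longrightarrow> s permutes {..<n}"
  by (auto simp: row_stabilizer_def column_stabilizer_def)

lemma id_in_R: "id \<in> R" and id_in_C: "id \<in> C"
  by (auto simp: row_stabilizer_def column_stabilizer_def)

lemma comp_in_R: "r \<in> R \<Longrightarrow> r' \<in> R \<Longrightarrow> r \<circ> r' \<in> R"
  and comp_in_C: "s \<in> C \<Longrightarrow> s' \<in> C \<Longrightarrow> s \<circ> s' \<in> C"
  unfolding row_stabilizer_def column_stabilizer_def
  by (auto simp: permutes_compose) (metis permutes_in_image lessThan_iff)+

lemma inv_in_R:
  assumes "r \<in> R"
  shows "inv r \<in> R"
proof -
  have r: "r permutes {..<n}" using assms by (rule R_permutes)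
  have "fst (T (inv r m)) = fst (T m)" if "m < n" for m
  proof -
    have "inv r m < n" using that permutes_in_image[OF permutes_inv[OF r], of m] by simp
    then have "fst (T (r (inv r m))) = fst (T (inv r m))" using assms by (auto simp: row_stabilizer_def)
    then show ?thesis by (simp add: permutes_inverses[OF r])
  qed
  then show ?thesis using permutes_inv[OF r] by (auto simp: row_stabilizer_def)
qed

lemma inv_in_C:
  assumes "s \<in> C"
  shows "inv s \<in> C"
proof -
  have s: "s permutes {..<n}" using assms by (rule C_permutes)
  have "snd (T (inv s m)) = snd (T m)" if "m < n" for m
  proof -
    have "inv s m < n" using that permutes_in_image[OF permutes_inv[OF s], of m] by simp
    then have "snd (T (s (inv s m))) = snd (T (inv s m))" using assms by (auto simp: column_stabilizer_def)
    then show ?thesis by (simp add: permutes_inverses[OF s])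
  qed
  then show ?thesis using permutes_inv[OF s] by (auto simp: column_stabilizer_def)
qed

lemma R_Int_C:
  assumes "g \<in> R" "g \<in> C"
  shows "g = id"
proof
  fix m
  have g: "g permutes {..<n}" using assms by (auto intro: R_permutes)
  show "g m = id m"
  proof (cases "m < n")
    case True
    then have "T (g m) = T m" using assms by (auto simp: row_stabilizer_def column_stabilizer_def prod_eq_iff)
    moreover have "g m < n" using True permutes_in_image[OF g, of m] by simp
    ultimately show ?thesis using inj True by (auto simp: inj_on_def)
  next
    case False
    then show ?thesis using permutes_not_in[OF g, of m] by simp
  qed
qed

text \<open>Assign to each \<open>a\<close> the cell in the row of \<open>a\<close> and the column
  of \<open>inv g a\<close>. By \<open>sep\<close> these cells are distinct and by
  \<open>full\<close> they belong to the diagram, so sending \<open>a\<close> to the entry of its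
  cell is a row permutation \<open>\<rho>\<close>; the choice of columns makes
  \<open>\<rho> \<circ> g\<close> a column permutation.\<close>

lemma factor_RC:
  assumes g: "g permutes {..<n}"
    and sep: "\<And>a b. a < n \<Longrightarrow> b < n \<Longrightarrow> a \<noteq> b \<Longrightarrow> fst (T a) = fst (T b) \<Longrightarrow> snd (T (inv g a)) \<noteq> snd (T (inv g b))"
  obtains r s where "r \<in> R" "s \<in> C" "g = r \<circ> s"
proof -
  define \<phi> where "\<phi> = (\<lambda>m. (fst (T m), snd (T (inv g m))))"
  have \<phi>: "inj_on \<phi> {..<n}" unfolding \<phi>_def inj_on_def using sep by auto
  have sub: "\<phi> ` {..<n} \<subseteq> T ` {..<n}" unfolding \<phi>_def
    by (rule full[OF permutes_inv[OF g]]) (use \<phi> in \<open>simp add: \<phi>_def\<close>)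
  define \<rho> where "\<rho> = (\<lambda>a. if a < n then inv_into {..<n} T (\<phi> a) else a)"
  have T\<rho>: "T (\<rho> a) = \<phi> a" "\<rho> a < n" if "a < n" for a
    using that sub unfolding \<rho>_def by (auto intro!: f_inv_into_f) (metis image_subset_iff inv_into_into lessThan_iff)
  have \<rho>: "\<rho> permutes {..<n}"
  proof (rule inj_imp_permutes)
    show "inj_on \<rho> {..<n}"
      by (rule inj_onI) (metis \<phi> T\<rho>(1) inj_on_def lessThan_iff)
  qed (use T\<rho> in \<open>auto simp: \<rho>_def\<close>)
  have "\<rho> \<in> R" using \<rho> T\<rho> by (auto simp: row_stabilizer_def \<phi>_def)
  moreover have "\<rho> \<circ> g \<in> C"
  proof -
    have "snd (T (\<rho> (g m))) = snd (T m)" if "m < n" for m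
      using that T\<rho>(1)[of "g m"] permutes_in_image[OF g, of m] by (simp add: \<phi>_def permutes_inverses[OF g])
    then show ?thesis using g \<rho> by (simp add: column_stabilizer_def permutes_compose)
  qed
  moreover have "g = inv \<rho> \<circ> (\<rho> \<circ> g)" using permutes_inv_comp_cancel[OF \<rho>] by simp
  ultimately show ?thesis using that inv_in_R by blast
qed

text \<open>As \<open>R\<close> and \<open>C\<close> meet only in \<open>id\<close>, the
  factorization is unique and a single term of the convolution survives.\<close>

lemma Y_RC:
  assumes "r \<in> R" "s \<in> C"
  shows "Y (r \<circ> s) = of_int (sign s)"
proof -
  have r: "r permutes {..<n}" using assms by (auto intro: R_permutes)
  have z: "row_symmetrizer n T h * column_antisymmetrizer n T (inv h \<circ> (r \<circ> s)) = 0"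
    if h: "h permutes {..<n}" "h \<noteq> r" for h
  proof (rule ccontr)
    assume "\<not> ?thesis"
    then have hR: "h \<in> R" and hC: "inv h \<circ> (r \<circ> s) \<in> C"
      by (auto simp: row_symmetrizer_def column_antisymmetrizer_def split: if_splits)
    have "inv h \<circ> r = (inv h \<circ> (r \<circ> s)) \<circ> inv s"
      using permutes_inv_comp_cancel[OF C_permutes[OF assms(2)]] by (simp add: o_assoc[symmetric])
    then have "inv h \<circ> r \<in> C" using hC assms comp_in_C inv_in_C by metis
    moreover have "inv h \<circ> r \<in> R" using hR assms comp_in_R inv_in_R by metis
    ultimately have "inv h \<circ> r = id" by (rule R_Int_C[rotated])
    then have "h = r" using permutes_inv_comp_cancel(4)[OF h(1), of r] by simp
    then show False using h by simp
  qed
  have "Y (r \<circ> s) = (\<Sum>h\<in>{r}. row_symmetrizer n T h * column_antisymmetrizer n T (inv h \<circ> (r \<circ> s)))"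
    unfolding young_symmetrizer_def convolution_def
    by (rule sum.mono_neutral_right) (use z r in \<open>auto simp: finite_permutations\<close>)
  then show ?thesis using assms permutes_inv_comp_cancel[OF r]
    by (simp add: row_symmetrizer_def column_antisymmetrizer_def)
qed

lemma Y_not_RC:
  assumes "\<And>r s. r \<in> R \<Longrightarrow> s \<in> C \<Longrightarrow> g \<noteq> r \<circ> s"
  shows "Y g = 0"
  unfolding young_symmetrizer_def convolution_def
proof (rule sum.neutral, rule ballI)
  fix h assume "h \<in> {h. h permutes {..<n}}"
  then have h: "h permutes {..<n}" by simp
  have "g = h \<circ> (inv h \<circ> g)" using permutes_inv_comp_cancel[OF h] by simp
  then have "h \<notin> R \<or> inv h \<circ> g \<notin> C" using assms by blast
  then show "row_symmetrizer n T h * column_antisymmetrizer n T (inv h \<circ> g) = 0"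
    by (auto simp: row_symmetrizer_def column_antisymmetrizer_def)
qed

lemma Y_id: "Y id = 1"
  using Y_RC[OF id_in_R id_in_C] by simp

lemma Y_not_permutes: "\<not> g permutes {..<n} \<Longrightarrow> Y g = 0"
  by (rule Y_not_RC) (auto intro: permutes_compose R_permutes C_permutes)

lemma Y_left:
  assumes "r \<in> R"
  shows "Y (r \<circ> g) = Y g"
proof (cases "\<exists>r'\<in>R. \<exists>s\<in>C. g = r' \<circ> s")
  case True
  then show ?thesis using Y_RC comp_in_R[OF assms] by (auto simp: o_assoc)
next
  case False
  have "r \<circ> g \<noteq> r' \<circ> s" if "r' \<in> R" "s \<in> C" for r' s
  proof
    assume "r \<circ> g = r' \<circ> s"
    then have "g = (inv r \<circ> r') \<circ> s"
      using permutes_inv_comp_cancel(3)[OF R_permutes[OF assms], of g] by (simp add: o_assoc)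
    then show False using False that assms comp_in_R inv_in_R by blast
  qed
  then have "Y (r \<circ> g) = 0" by (rule Y_not_RC)
  moreover have "Y g = 0" using False by (intro Y_not_RC) auto
  ultimately show ?thesis by simp
qed

lemma Y_right:
  assumes "s \<in> C"
  shows "Y (g \<circ> s) = of_int (sign s) * Y g"
proof (cases "\<exists>r\<in>R. \<exists>s'\<in>C. g = r \<circ> s'")
  case True
  then obtain r s' where *: "r \<in> R" "s' \<in> C" "g = r \<circ> s'" by blast
  then have "Y (g \<circ> s) = of_int (sign (s' \<circ> s))" using Y_RC[of r "s' \<circ> s"] comp_in_C assms by (simp add: o_assoc)
  then show ?thesis using * Y_RC[of r s'] assms C_permutes by (simp add: sign_comp_permutes[of "{..<n}"])
next
  case False
  have "g \<circ> s \<noteq> r \<circ> s'" if "r \<in> R" "s' \<in> C" for r s'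
  proof
    assume "g \<circ> s = r \<circ> s'"
    then have "g = r \<circ> (s' \<circ> inv s)"
      using permutes_inv_comp_cancel(5)[OF C_permutes[OF assms], of g] by (simp add: o_assoc)
    then show False using False that assms comp_in_C inv_in_C by blast
  qed
  then have "Y (g \<circ> s) = 0" by (rule Y_not_RC)
  moreover have "Y g = 0" using False by (intro Y_not_RC) auto
  ultimately show ?thesis by simp
qed

text \<open>Off the products \<open>r \<circ> s\<close>, \<open>factor_RC\<close> must fail: some
  \<open>a\<close> and \<open>b\<close> share a row while their preimages under \<open>g\<close>
  share a column. The transposition of \<open>a\<close> and \<open>b\<close> on the left of
  \<open>g\<close> equals that of the preimages on its right, so the two symmetries give z g = - z
  g.\<close>

lemma von_Neumann:
  assumes out: "\<And>g. \<not> g permutes {..<n} \<Longrightarrow> z g = 0"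
    and left: "\<And>r g. r \<in> R \<Longrightarrow> g permutes {..<n} \<Longrightarrow> z (r \<circ> g) = z g"
    and right: "\<And>s g. s \<in> C \<Longrightarrow> g permutes {..<n} \<Longrightarrow> z (g \<circ> s) = of_int (sign s) * z g"
  shows "z g = z id * Y g"
proof -
  consider "\<not> g permutes {..<n}" | r s where "r \<in> R" "s \<in> C" "g = r \<circ> s"
    | "g permutes {..<n}" "\<And>r s. r \<in> R \<Longrightarrow> s \<in> C \<Longrightarrow> g \<noteq> r \<circ> s" by blast
  then show ?thesis
  proof cases
    case 1
    then show ?thesis by (simp add: out Y_not_permutes)
  next
    case 2
    then have "z g = of_int (sign s) * z id"
      using left[of r s] right[of s id] C_permutes by (simp add: permutes_id)
    then show ?thesis using 2 by (simp add: Y_RC)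
  next
    case 3
    note g = 3(1)
    from 3 factor_RC[OF g] obtain a b where ab: "a < n" "b < n" "a \<noteq> b" "fst (T a) = fst (T b)"
      "snd (T (inv g a)) = snd (T (inv g b))" by metis
    let ?t = "transpose a b" and ?u = "transpose (inv g a) (inv g b)"
    have lt: "inv g a < n" "inv g b < n" using ab permutes_in_image[OF permutes_inv[OF g]] by auto
    have ne: "inv g a \<noteq> inv g b" using ab by (metis g permutes_inverses(1))
    have "?t \<in> R" unfolding row_stabilizer_def
      using ab by (auto simp: permutes_swap_id transpose_def)
    moreover have "?u \<in> C" unfolding column_stabilizer_def
      using ab lt by (auto simp: permutes_swap_id transpose_def)
    moreover have "?t \<circ> g = g \<circ> ?u"
      using g by (auto simp: fun_eq_iff transpose_def permutes_inverses permutes_inv_eq)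
    ultimately have "z g = - z g" using left[of ?t g] right[of ?u g] g ne by (simp add: sign_swap_id)
    then have "z g = 0" by simp
    moreover have "Y g = 0" using 3(2) by (rule Y_not_RC)
    ultimately show ?thesis by simp
  qed
qed

text \<open>Support and antisymmetry under \<open>C\<close> on the right are inherited from
  \<open>Y\<close>, so only invariance under \<open>R\<close> on the left is left to check.\<close>

lemma convolution_Y_scalar:
  assumes left: "\<And>r g. r \<in> R \<Longrightarrow> g permutes {..<n} \<Longrightarrow> convolution n x Y (r \<circ> g) = convolution n x Y g"
  shows "convolution n x Y = (\<lambda>g. convolution n x Y id * Y g)"
proof (rule ext, rule von_Neumann)
  fix g assume g: "\<not> g permutes {..<n}"
  have "Y (inv h \<circ> g) = 0" if h: "h permutes {..<n}" for h
  proof (rule Y_not_permutes)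
    show "\<not> inv h \<circ> g permutes {..<n}"
      using g permutes_compose[of "inv h \<circ> g" "{..<n}" h] h permutes_inv_comp_cancel[OF h] by auto
  qed
  then show "convolution n x Y g = 0" by (simp add: convolution_def)
next
  fix s g assume s: "s \<in> C"
  show "convolution n x Y (g \<circ> s) = of_int (sign s) * convolution n x Y g"
    unfolding convolution_def sum_distrib_left
    using Y_right[OF s] by (simp add: o_assoc mult_ac)
qed (rule left)

text \<open>Invariance under \<open>R\<close> comes from the left factor. The scalar stays implicit;
  that it is nonzero emerges in \<open>specht_normalized_trace\<close>.\<close>

lemma Y_idempotent: "convolution n Y Y = (\<lambda>g. convolution n Y Y id * Y g)"
proof (rule convolution_Y_scalar)
  fix r g assume r: "r \<in> R"
  note p = R_permutes[OF r]
  show "convolution n Y Y (r \<circ> g) = convolution n Y Y g"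
    unfolding convolution_def
    by (subst setum_permutations_compose_left[OF p])
      (auto intro!: sum.cong simp: Y_left[OF r] permutes_inv_comp[OF p] o_assoc[symmetric] permutes_inv_comp_cancel[OF p])
qed

text \<open>A class function is central in the group algebra, so a row permutation on the left
  passes through it and is absorbed by \<open>Y\<close>.\<close>

lemma class_function_Y:
  assumes "class_function n F"
  shows "convolution n F Y = (\<lambda>g. convolution n F Y id * Y g)"
proof (rule convolution_Y_scalar)
  fix r g assume r: "r \<in> R"
  note p = R_permutes[OF r]
  have "convolution n F Y (r \<circ> g) = (\<Sum>h | h permutes {..<n}. F (r \<circ> h \<circ> inv r) * Y (inv (r \<circ> h \<circ> inv r) \<circ> (r \<circ> g)))"
    unfolding convolution_def by (rule sum_permutations_conj[OF p])
  also have "\<dots> = (\<Sum>h | h permutes {..<n}. F h * Y (inv h \<circ> g))"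
  proof (rule sum.cong[OF refl])
    fix h assume "h \<in> {h. h permutes {..<n}}"
    then have h: "h permutes {..<n}" by simp
    have "inv (r \<circ> h \<circ> inv r) = r \<circ> inv h \<circ> inv r"
      using h p by (simp add: permutes_inv_comp[of _ "{..<n}"] permutes_compose permutes_inv permutes_inv_inv o_assoc)
    then have "inv (r \<circ> h \<circ> inv r) \<circ> (r \<circ> g) = r \<circ> (inv h \<circ> g)"
      by (simp add: o_assoc[symmetric] permutes_inv_comp_cancel[OF p])
    then show "F (r \<circ> h \<circ> inv r) * Y (inv (r \<circ> h \<circ> inv r) \<circ> (r \<circ> g)) = F h * Y (inv h \<circ> g)"
      using assms h p Y_left[OF r] by (simp add: class_function_def)
  qed
  finally show "convolution n F Y (r \<circ> g) = convolution n F Y g"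
    by (simp add: convolution_def)
qed

text \<open>The scalar \<open>convolution n F Y id\<close> is the central character of the Specht
  module at \<open>F\<close>, hence multiplicative in \<open>F\<close>.\<close>

lemma class_function_Y_mult:
  assumes "class_function n F" "class_function n G"
  shows "convolution n (convolution n F G) Y id = convolution n F Y id * convolution n G Y id"
proof -
  have "convolution n (convolution n F G) Y id = convolution n F (\<lambda>g. convolution n G Y id * Y g) id"
    unfolding convolution_assoc using class_function_Y[OF assms(2)] by simp
  also have "\<dots> = convolution n G Y id * convolution n F Y id"
    unfolding convolution_def[of n F] by (simp add: sum_distrib_left mult_ac)
  finally show ?thesis by simp
qed

end

section \<open>Traces on Specht modules\<close>

lemma fun_sum_apply: "(\<Sum>b\<in>B. f b) g = (\<Sum>b\<in>B. f b g :: 'b :: comm_monoid_add)"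
  by (induction B rule: infinite_finite_induct) auto

lemma convolution_add_left: "convolution n (x + y) z = convolution n x z + convolution n y z"
  by (auto simp: convolution_def fun_eq_iff distrib_right sum.distrib)

lemma convolution_scale_left: "convolution n (\<lambda>g. c * x g) z = (\<lambda>g. c * convolution n x z g)"
  by (auto simp: convolution_def fun_eq_iff sum_distrib_left mult_ac)

lemma convolution_scale_right: "convolution n x (\<lambda>g. c * z g) = (\<lambda>g. c * convolution n x z g)"
  by (auto simp: convolution_def fun_eq_iff sum_distrib_left mult_ac)

lemma convolution_sum_left:
  "convolution n (\<lambda>h. \<Sum>g\<in>A. c g * x g h) z = (\<Sum>g\<in>A. (\<lambda>h. c g * convolution n (x g) z h))"
proof
  fix h
  have "convolution n (\<lambda>h. \<Sum>g\<in>A. c g * x g h) z h = (\<Sum>g\<in>A. \<Sum>u | u permutes {..<n}. c g * x g u * z (inv u \<circ> h))"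
    unfolding convolution_def sum_distrib_right by (rule sum.swap)
  then show "convolution n (\<lambda>h. \<Sum>g\<in>A. c g * x g h) z h = (\<Sum>g\<in>A. (\<lambda>h. c g * convolution n (x g) z h)) h"
    by (simp add: fun_sum_apply convolution_def sum_distrib_left mult.assoc)
qed

definition delta :: "(nat \<Rightarrow> nat) \<Rightarrow> (nat \<Rightarrow> nat) \<Rightarrow> complex" where
  "delta g = (\<lambda>h. if h = g then 1 else 0)"

lemma group_algebra_expand:
  assumes "x \<in> group_algebra n"
  shows "x = (\<lambda>h. \<Sum>g | g permutes {..<n}. x g * delta g h)"
proof
  fix h
  show "x h = (\<Sum>g | g permutes {..<n}. x g * delta g h)"
  proof (cases "h permutes {..<n}")
    case True
    then show ?thesis by (simp add: delta_def if_distrib finite_permutations cong: if_cong)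
  next
    case False
    then have "x h = 0" using assms by (simp add: group_algebra_def)
    moreover have "(\<Sum>g | g permutes {..<n}. x g * delta g h) = 0"
      using False by (intro sum.neutral) (auto simp: delta_def)
    ultimately show ?thesis by simp
  qed
qed

lemma delta_convolution:
  assumes "g permutes {..<n}"
  shows "convolution n (delta g) z h = z (inv g \<circ> h)"
proof -
  have "convolution n (delta g) z h = (\<Sum>u | u permutes {..<n}. if u = g then z (inv u \<circ> h) else 0)"
    unfolding convolution_def delta_def by (intro sum.cong) auto
  then show ?thesis using assms by (simp add: finite_permutations)
qed

lemma left_action_convolution:
  assumes w: "w permutes {..<n}"
  shows "left_action w (convolution n x z) = convolution n (left_action w x) z"
  unfolding left_action_def convolution_def
  by (rule ext, subst (2) setum_permutations_compose_left[OF w])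
    (auto intro!: sum.cong simp: permutes_inv_comp[OF w] o_assoc[symmetric] permutes_inv_comp_cancel[OF w])

lemma left_action_in_group_algebra:
  assumes w: "w permutes {..<n}" and "x \<in> group_algebra n"
  shows "left_action w x \<in> group_algebra n"
  unfolding group_algebra_def
proof (intro CollectI allI impI)
  fix g assume "\<not> g permutes {..<n}"
  then have "\<not> inv w \<circ> g permutes {..<n}"
    using permutes_compose[of "inv w \<circ> g" "{..<n}" w] w permutes_inv_comp_cancel[OF w] by auto
  then show "left_action w x g = 0" using assms(2) by (simp add: group_algebra_def left_action_def)
qed

lemma subspace_specht_module: "fun_space.subspace (specht_module n T)"
  unfolding fun_space.subspace_def specht_module_def
proof (intro conjI ballI allI)
  let ?c = "\<lambda>x. convolution n x (young_symmetrizer n T)"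
  show "0 \<in> ?c ` group_algebra n"
    by (rule image_eqI[of _ _ 0]) (auto simp: convolution_def group_algebra_def fun_eq_iff)
  fix u assume "u \<in> ?c ` group_algebra n"
  then obtain x where x: "u = ?c x" "x \<in> group_algebra n" by auto
  {
    fix v assume "v \<in> ?c ` group_algebra n"
    then obtain y where y: "v = ?c y" "y \<in> group_algebra n" by auto
    show "u + v \<in> ?c ` group_algebra n" using x y
      by (intro image_eqI[of _ _ "x + y"]) (auto simp: convolution_add_left group_algebra_def)
  }
  fix c
  show "(\<lambda>g. c * u g) \<in> ?c ` group_algebra n" using x
    by (intro image_eqI[of _ _ "\<lambda>g. c * x g"]) (auto simp: convolution_scale_left group_algebra_def)
qed

context young
begin

lemma specht_module_subset: "specht_module n T \<subseteq> group_algebra n"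
proof -
  have "convolution n x Y g = 0" if g: "\<not> g permutes {..<n}" for x g
  proof -
    have "Y (inv h \<circ> g) = 0" if h: "h permutes {..<n}" for h
      using g permutes_compose[of "inv h \<circ> g" "{..<n}" h] h permutes_inv_comp_cancel[OF h]
      by (intro Y_not_permutes) auto
    then show ?thesis by (simp add: convolution_def)
  qed
  then show ?thesis by (auto simp: specht_module_def group_algebra_def)
qed

text \<open>
  Right multiplication by \<open>Y\<close> is the scalar \<open>convolution n Y Y id\<close> on the Specht module and maps the
  group algebra into it, so the trace can be computed in the standard basis of the group algebra.
\<close>

lemma specht_trace:
  assumes w: "w permutes {..<n}"
  shows "convolution n Y Y id * fun_space.subspace_trace (specht_module n T) (left_action w) =
    (\<Sum>g | g permutes {..<n}. Y (inv g \<circ> inv w \<circ> g))"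
proof -
  let ?V = "specht_module n T" and ?P = "{g. g permutes {..<n}}"
  let ?\<kappa> = "convolution n Y Y id"
  define B where "B = (SOME B. fun_space.independent B \<and> fun_space.span B = ?V)"
  have "\<exists>B. fun_space.independent B \<and> fun_space.span B = ?V"
    using fun_space.basis_exists[of ?V] subspace_specht_module[of n T]
    by (metis fun_space.span_minimal order_antisym)
  then have B: "fun_space.independent B" "fun_space.span B = ?V"
    unfolding B_def using someI_ex[of "\<lambda>B. fun_space.independent B \<and> fun_space.span B = ?V"] by auto
  have BV: "b \<in> ?V" if "b \<in> B" for b using B(2) fun_space.span_base that by blast
  have BA: "b \<in> group_algebra n" if "b \<in> B" for b using BV[OF that] specht_module_subset by blast
  have "B \<subseteq> fun_space.span (delta ` ?P)"
  proof
    fix b assume "b \<in> B"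
    then have "b = (\<Sum>g\<in>?P. (\<lambda>h. b g * delta g h))"
      using group_algebra_expand[OF BA] by (auto simp: fun_eq_iff fun_sum_apply)
    moreover have "(\<Sum>g\<in>?P. (\<lambda>h. b g * delta g h)) \<in> fun_space.span (delta ` ?P)"
      by (intro fun_space.span_sum fun_space.span_scale fun_space.span_base) auto
    ultimately show "b \<in> fun_space.span (delta ` ?P)" by simp
  qed
  then have finB: "finite B"
    using fun_space.independent_span_bound[of "delta ` ?P" B] B(1) by (simp add: finite_permutations)
  \<comment> \<open>Right multiplication by \<open>Y\<close> followed by \<open>w\<close>. Unlike
    the action of \<open>w\<close> alone, this maps the whole group algebra into the module, where
    it is the scalar times the action of \<open>w\<close>.\<close>
  define F where "F x = left_action w (convolution n x Y)" for x
  have FV: "F x \<in> ?V" if "x \<in> group_algebra n" for x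
    unfolding F_def left_action_convolution[OF w] specht_module_def
    using left_action_in_group_algebra[OF w that] by blast
  have scalar: "F b = (\<lambda>g. ?\<kappa> * left_action w b g)" and fV: "left_action w b \<in> ?V" if b: "b \<in> ?V" for b
  proof -
    obtain x where x: "b = convolution n x Y" "x \<in> group_algebra n"
      using b by (auto simp: specht_module_def)
    have "convolution n b Y = (\<lambda>g. ?\<kappa> * b g)"
      unfolding x(1) convolution_assoc using Y_idempotent convolution_scale_right by metis
    then show "F b = (\<lambda>g. ?\<kappa> * left_action w b g)" by (simp add: F_def left_action_def)
    show "left_action w b \<in> ?V" unfolding x(1) left_action_convolution[OF w] specht_module_def
      using left_action_in_group_algebra[OF w x(2)] by blast
  qed
  let ?rep = "fun_space.representation B"
  have dV: "F (delta g) \<in> ?V" if "g \<in> ?P" for g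
    using that by (intro FV) (auto simp: group_algebra_def delta_def)
  have "?\<kappa> * fun_space.subspace_trace ?V (left_action w) = (\<Sum>b\<in>B. ?\<kappa> * ?rep (left_action w b) b)"
    unfolding fun_space.subspace_trace_def B_def[symmetric] by (simp add: sum_distrib_left)
  also have "\<dots> = (\<Sum>b\<in>B. ?rep (F b) b)"
    using scalar fV BV B by (intro sum.cong refl) (simp add: fun_space.representation_scale)
  also have "\<dots> = (\<Sum>b\<in>B. \<Sum>g\<in>?P. b g * ?rep (F (delta g)) b)"
  proof (rule sum.cong[OF refl])
    fix b assume b: "b \<in> B"
    have "F b = F (\<lambda>h. \<Sum>g\<in>?P. b g * delta g h)" using group_algebra_expand[OF BA[OF b]] by simp
    also have "\<dots> = (\<Sum>g\<in>?P. (\<lambda>h. b g * F (delta g) h))"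
      unfolding F_def convolution_sum_left by (simp add: left_action_def fun_eq_iff fun_sum_apply)
    finally have "?rep (F b) b = ?rep (\<Sum>g\<in>?P. (\<lambda>h. b g * F (delta g) h)) b" by simp
    also have "\<dots> = (\<Sum>g\<in>?P. ?rep (\<lambda>h. b g * F (delta g) h) b)"
      using B dV by (subst fun_space.representation_sum) (auto intro!: fun_space.span_scale simp: fun_sum_apply)
    also have "\<dots> = (\<Sum>g\<in>?P. b g * ?rep (F (delta g)) b)"
      using B dV by (intro sum.cong refl) (simp add: fun_space.representation_scale)
    finally show "?rep (F b) b = (\<Sum>g\<in>?P. b g * ?rep (F (delta g)) b)" .
  qed
  \<comment> \<open>With the sum over the basis innermost, it reassembles \<open>F (delta g)\<close>
    at the point \<open>g\<close>, a diagonal entry of \<open>F\<close> in the standard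
    basis.\<close>
  also have "\<dots> = (\<Sum>g\<in>?P. \<Sum>b\<in>B. ?rep (F (delta g)) b * b g)"
    by (subst sum.swap) (simp add: mult.commute)
  also have "\<dots> = (\<Sum>g\<in>?P. F (delta g) g)"
  proof (rule sum.cong[OF refl])
    fix g assume g: "g \<in> ?P"
    have "(\<Sum>b\<in>B. (\<lambda>h. ?rep (F (delta g)) b * b h)) = F (delta g)"
      using fun_space.sum_representation_eq[OF B(1), of "F (delta g)" B] finB dV[OF g] B(2) by simp
    from fun_cong[OF this, of g] show "(\<Sum>b\<in>B. ?rep (F (delta g)) b * b g) = F (delta g) g"
      by (simp add: fun_sum_apply)
  qed
  also have "\<dots> = (\<Sum>g\<in>?P. Y (inv g \<circ> inv w \<circ> g))"
    by (intro sum.cong refl) (simp add: F_def left_action_def delta_convolution o_assoc)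
  finally show ?thesis .
qed

text \<open>At the identity every summand is \<open>Y id\<close> = 1, so scalar times dimension is
  n!. Hence both are nonzero, and the scalar cancels from the quotient.\<close>

lemma specht_normalized_trace:
  assumes w: "w permutes {..<n}"
  shows "fun_space.subspace_trace (specht_module n T) (left_action w) /
      fun_space.subspace_trace (specht_module n T) (left_action id) =
    (\<Sum>g | g permutes {..<n}. Y (inv g \<circ> inv w \<circ> g)) / fact n"
proof -
  have "convolution n Y Y id * fun_space.subspace_trace (specht_module n T) (left_action id) =
      (\<Sum>g | g permutes {..<n}. Y id)"
    unfolding specht_trace[OF permutes_id]
    by (intro sum.cong refl) (simp add: permutes_inv_comp_cancel)
  also have "\<dots> = fact n"
    using card_permutations[of "{..<n}" n] by (simp add: Y_id)
  finally have 1: "convolution n Y Y id * fun_space.subspace_trace (specht_module n T) (left_action id) = fact n" .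
  then have "convolution n Y Y id \<noteq> 0"
    "fun_space.subspace_trace (specht_module n T) (left_action id) \<noteq> 0" by auto
  then show ?thesis unfolding specht_trace[OF w, symmetric] 1[symmetric] by simp
qed

end

section \<open>Counting cycles\<close>

text \<open>Fixed points count as cycles, so the ground set must be named; it grows by one point at
  a time in the inductions below.\<close>

definition ncyc :: "nat set \<Rightarrow> (nat \<Rightarrow> nat) \<Rightarrow> nat" where
  "ncyc U g = card (orbit g ` U)"

definition invariant_colourings :: "nat set \<Rightarrow> (nat \<Rightarrow> nat) \<Rightarrow> nat set \<Rightarrow> (nat \<Rightarrow> nat) set" where
  "invariant_colourings U g A = {f \<in> U \<rightarrow>\<^sub>E A. \<forall>x\<in>U. f (g x) = f x}"

lemma orbit_eq_of_mem:
  assumes "permutation g" "y \<in> orbit g x"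
  shows "orbit g y = orbit g x"
  using assms by (intro orbit_cyclic_eq3 cyclic_on_orbit') auto

text \<open>An invariant colouring is constant on each orbit, hence the same as a colouring of the
  set of orbits.\<close>

lemma card_invariant_colourings:
  assumes U: "finite U" and g: "g permutes U"
  shows "card (invariant_colourings U g A) = card A ^ ncyc U g"
proof -
  have perm: "permutation g" using U g by (rule permutes_imp_permutation)
  note self = permutation_self_in_orbit[OF perm]
  have sub: "orbit g x \<subseteq> U" if "x \<in> U" for x using permutes_orbit_subset[OF g that] .
  have const: "f y = f x" if "f \<in> invariant_colourings U g A" "x \<in> U" "y \<in> orbit g x" for f x y
    using that(3)
  proof (induction rule: orbit.induct)
    case base
    then show ?case using that by (auto simp: invariant_colourings_def)
  next
    case (step y)
    then have "y \<in> U" using sub[OF that(2)] by blast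
    then show ?case using step that(1) by (auto simp: invariant_colourings_def)
  qed
  have some: "(SOME y. y \<in> orbit g x) \<in> orbit g x" for x
    using self[of x] by (rule someI[where P = "\<lambda>y. y \<in> orbit g x"])
  have "bij_betw (\<lambda>F. \<lambda>x\<in>U. F (orbit g x)) ((orbit g ` U) \<rightarrow>\<^sub>E A) (invariant_colourings U g A)"
  proof (rule bij_betwI[where g = "\<lambda>f. \<lambda>K\<in>orbit g ` U. f (SOME y. y \<in> K)"])
    show "(\<lambda>F. \<lambda>x\<in>U. F (orbit g x)) \<in> ((orbit g ` U) \<rightarrow>\<^sub>E A) \<rightarrow> invariant_colourings U g A"
      using permutes_in_image[OF g] self_in_orbit_step[OF self]
      by (auto simp: invariant_colourings_def)
    show "(\<lambda>f. \<lambda>K\<in>orbit g ` U. f (SOME y. y \<in> K)) \<in> invariant_colourings U g A \<rightarrow> ((orbit g ` U) \<rightarrow>\<^sub>E A)"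
      using some sub by (fastforce simp: invariant_colourings_def)
    fix F assume F: "F \<in> (orbit g ` U) \<rightarrow>\<^sub>E A"
    show "(\<lambda>K\<in>orbit g ` U. (\<lambda>x\<in>U. F (orbit g x)) (SOME y. y \<in> K)) = F"
    proof (rule extensionalityI[of _ "orbit g ` U"])
      fix K assume "K \<in> orbit g ` U"
      then obtain x where x: "x \<in> U" "K = orbit g x" by auto
      then show "(\<lambda>K\<in>orbit g ` U. (\<lambda>x\<in>U. F (orbit g x)) (SOME y. y \<in> K)) K = F K"
        using some[of x] sub[of x] orbit_eq_of_mem[OF perm some[of x]] by auto
    qed (use F in \<open>auto simp: PiE_def\<close>)
  next
    fix f assume f: "f \<in> invariant_colourings U g A"
    show "(\<lambda>x\<in>U. (\<lambda>K\<in>orbit g ` U. f (SOME y. y \<in> K)) (orbit g x)) = f"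
      using f const[OF f _ some]
      by (intro extensionalityI[of _ U]) (auto simp: invariant_colourings_def PiE_def)
  qed
  then have "card (invariant_colourings U g A) = card ((orbit g ` U) \<rightarrow>\<^sub>E A)"
    by (simp add: bij_betw_same_card)
  then show ?thesis using U by (simp add: card_PiE ncyc_def)
qed

text \<open>Two colours suffice to recover the number of cycles from the number of invariant colourings.\<close>

lemma ncyc_eqI:
  assumes "finite U" "g permutes U" "finite V" "h permutes V"
    and "bij_betw \<phi> (invariant_colourings U g {0, 1}) (invariant_colourings V h {0, 1})"
  shows "ncyc U g = ncyc V h"
proof -
  have "(2::nat) ^ ncyc U g = 2 ^ ncyc V h"
    using bij_betw_same_card[OF assms(5)] assms(1-4) by (simp add: card_invariant_colourings numeral_2_eq_2)
  then show ?thesis by simp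
qed

lemma ncyc_conj:
  assumes U: "finite U" and g: "g permutes U" and h: "h permutes U"
  shows "ncyc U (h \<circ> g \<circ> inv h) = ncyc U g"
proof (rule ncyc_eqI[where \<phi> = "\<lambda>f. f \<circ> h"])
  note inU = permutes_in_image[OF g] permutes_in_image[OF h] permutes_in_image[OF permutes_inv[OF h]]
  show "bij_betw (\<lambda>f. f \<circ> h) (invariant_colourings U (h \<circ> g \<circ> inv h) {0, 1}) (invariant_colourings U g {0, 1})"
  proof (rule bij_betwI[where g = "\<lambda>f. f \<circ> inv h"])
    show "(\<lambda>f. f \<circ> h) \<in> invariant_colourings U (h \<circ> g \<circ> inv h) {0, 1} \<rightarrow> invariant_colourings U g {0, 1}"
    proof
      fix f assume f: "f \<in> invariant_colourings U (h \<circ> g \<circ> inv h) {0, 1}"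
      have "f (h (g x)) = f (h x)" if "x \<in> U" for x
      proof -
        have "f ((h \<circ> g \<circ> inv h) (h x)) = f (h x)"
          using f that inU(2)[of x] unfolding invariant_colourings_def by blast
        then show ?thesis by (simp add: permutes_inverses[OF h])
      qed
      then show "f \<circ> h \<in> invariant_colourings U g {0, 1}"
        using f inU(2) unfolding invariant_colourings_def PiE_iff extensional_def by simp
    qed
    show "(\<lambda>f. f \<circ> inv h) \<in> invariant_colourings U g {0, 1} \<rightarrow> invariant_colourings U (h \<circ> g \<circ> inv h) {0, 1}"
    proof
      fix f assume f: "f \<in> invariant_colourings U g {0, 1}"
      then have "f (inv h ((h \<circ> g \<circ> inv h) x)) = f (inv h x)" if "x \<in> U" for x
        using inU(3)[of x] that by (simp add: invariant_colourings_def permutes_inverses[OF h])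
      then show "f \<circ> inv h \<in> invariant_colourings U (h \<circ> g \<circ> inv h) {0, 1}"
        using f inU(3) unfolding invariant_colourings_def PiE_iff extensional_def by simp
    qed
  qed (auto simp: fun_eq_iff permutes_inverses[OF h])
qed (use assms in \<open>auto intro: permutes_compose permutes_inv\<close>)

lemma ncyc_comp_commute:
  assumes "finite U" "g permutes U" "h permutes U"
  shows "ncyc U (g \<circ> h) = ncyc U (h \<circ> g)"
proof -
  have "h \<circ> (g \<circ> h) \<circ> inv h = h \<circ> g"
    by (simp add: fun_eq_iff permutes_inverses[OF assms(3)])
  then show ?thesis
    using ncyc_conj[OF assms(1) permutes_compose[OF assms(3,2)] assms(3)] by simp
qed

lemma ncyc_inv:
  assumes "finite U" "g permutes U"
  shows "ncyc U (inv g) = ncyc U g"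
  using assms by (simp add: ncyc_def orbit_inv_eq permutes_imp_permutation)

lemma ncyc_insert_fixed:
  assumes "finite U" "g permutes U" "b \<notin> U"
  shows "ncyc (insert b U) g = Suc (ncyc U g)"
proof -
  have "orbit g b = {b}" using assms by (simp add: orbit_eq_singleton_iff permutes_not_in)
  moreover have "{b} \<notin> orbit g ` U"
  proof
    assume "{b} \<in> orbit g ` U"
    then obtain x where "x \<in> U" "orbit g x = {b}" by auto
    then show False using permutes_orbit_subset[OF assms(2), of x] assms(3) by auto
  qed
  ultimately show ?thesis using assms by (simp add: ncyc_def)
qed

text \<open>The transposition splices the new point \<open>b\<close> into the cycle of
  \<open>c\<close>, just before \<open>c\<close>. An invariant colouring must give \<open>b\<close>
  the colour of \<open>c\<close> and is otherwise one for \<open>g\<close>.\<close>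

lemma ncyc_insert_transpose:
  assumes U: "finite U" and g: "g permutes U" and b: "b \<notin> U" and c: "c \<in> U"
  shows "ncyc (insert b U) (transpose b c \<circ> g) = ncyc U g"
proof (rule ncyc_eqI[where \<phi> = "\<lambda>f. restrict f U"])
  let ?V = "insert b U" and ?h = "transpose b c \<circ> g"
  have gb: "g b = b" using g b by (simp add: permutes_not_in)
  have gU: "g x \<in> U \<longleftrightarrow> x \<in> U" for x using permutes_in_image[OF g] .
  have iff: "f \<in> invariant_colourings ?V ?h {0, 1} \<longleftrightarrow> restrict f U \<in> invariant_colourings U g {0, 1} \<and> f c = f b \<and> f \<in> extensional ?V" for f
  proof
    assume f: "f \<in> invariant_colourings ?V ?h {0, 1}"
    then have "f (?h b) = f b" unfolding invariant_colourings_def by blast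
    then have bc: "f c = f b" using gb by simp
    have "f (g x) = f x" if "x \<in> U" for x
    proof -
      have "f (?h x) = f x" using f that by (auto simp: invariant_colourings_def)
      moreover have "f (?h x) = f (g x)" using bc gU[of x] that b by (cases "g x = c") (auto simp: transpose_def)
      ultimately show ?thesis by simp
    qed
    then show "restrict f U \<in> invariant_colourings U g {0, 1} \<and> f c = f b \<and> f \<in> extensional ?V"
      using f bc gU unfolding invariant_colourings_def PiE_iff by simp
  next
    assume f: "restrict f U \<in> invariant_colourings U g {0, 1} \<and> f c = f b \<and> f \<in> extensional ?V"
    then have "f (g x) = f x" if "x \<in> U" for x using that gU by (auto simp: invariant_colourings_def)
    note inv = this
    have fcb: "f c = f b" using f by simp
    have "f (?h x) = f x" if "x \<in> ?V" for x
    proof -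
      have "f (transpose b c y) = f y" for y using fcb by (cases "y = b"; cases "y = c") auto
      then have "f (?h x) = f (g x)" by simp
      then show ?thesis using that inv gb by auto
    qed
    moreover have fU: "f x \<in> {0, 1}" if "x \<in> U" for x
      using f that by (auto simp: invariant_colourings_def PiE_iff)
    moreover have "f b \<in> {0, 1}" using fU[OF c] fcb by (simp only:)
    ultimately show "f \<in> invariant_colourings ?V ?h {0, 1}"
      using f unfolding invariant_colourings_def PiE_iff by simp
  qed
  show "bij_betw (\<lambda>f. restrict f U) (invariant_colourings ?V ?h {0, 1}) (invariant_colourings U g {0, 1})"
  proof (rule bij_betwI[where g = "\<lambda>f. f(b := f c)"])
    show "(\<lambda>f. restrict f U) \<in> invariant_colourings ?V ?h {0, 1} \<rightarrow> invariant_colourings U g {0, 1}"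
      using iff by blast
    show "(\<lambda>f. f(b := f c)) \<in> invariant_colourings U g {0, 1} \<rightarrow> invariant_colourings ?V ?h {0, 1}"
    proof
      fix f assume f: "f \<in> invariant_colourings U g {0, 1}"
      have "restrict (f(b := f c)) U = f"
        using f b by (intro extensionalityI[of _ U]) (auto simp: invariant_colourings_def PiE_iff)
      then show "f(b := f c) \<in> invariant_colourings ?V ?h {0, 1}"
        unfolding iff using f b c by (auto simp: invariant_colourings_def PiE_iff extensional_def)
    qed
    fix f assume "f \<in> invariant_colourings ?V ?h {0, 1}"
    then show "(restrict f U)(b := restrict f U c) = f"
      unfolding iff using c by (auto simp: fun_eq_iff extensional_def)
  next
    fix f assume f: "f \<in> invariant_colourings U g {0, 1}"
    then show "restrict (f(b := f c)) U = f"
      using f b by (intro extensionalityI[of _ U]) (auto simp: invariant_colourings_def PiE_iff)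
  qed
  show "?h permutes ?V"
    using g c by (intro permutes_compose[of g] permutes_swap_id) (auto intro: permutes_subset)
qed (use assms in auto)

text \<open>Each point spliced into a cycle costs one transposition, so the sign has the parity of
  \<open>card U\<close> minus the number of cycles; the sum in the exponent avoids natural
  subtraction.\<close>

lemma sign_eq_ncyc:
  assumes "finite U" "g permutes U"
  shows "of_int (sign g) = ((-1) ^ (card U + ncyc U g) :: complex)"
  using assms
proof (induction U arbitrary: g rule: finite_induct)
  case empty
  then have "g = id" by simp
  then show ?case by (simp add: ncyc_def)
next
  case (insert b U)
  obtain c q where c: "c \<in> insert b U" and q: "q permutes U" and g: "g = transpose b c \<circ> q"
  proof
    show "g b \<in> insert b U" using permutes_in_image[OF insert.prems, of b] by blast
    show "transpose b (g b) \<circ> g permutes U" using insert.prems by (rule permutes_insert_lemma)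
  qed (simp add: o_assoc)
  have s: "sign g = (if c = b then 1 else -1) * sign q"
    unfolding g using insert.hyps q
    by (subst sign_compose) (auto simp: sign_swap_id permutation_swap_id intro: permutes_imp_permutation)
  show ?case
  proof (cases "c = b")
    case True
    then show ?thesis using s insert.hyps insert.IH[OF q] g ncyc_insert_fixed[OF insert.hyps(1) q insert.hyps(2)] by simp
  next
    case False
    then have "ncyc (insert b U) g = ncyc U q"
      unfolding g using c by (intro ncyc_insert_transpose[OF insert.hyps(1) q insert.hyps(2)]) auto
    then show ?thesis using False s insert.hyps insert.IH[OF q] by simp
  qed
qed

text \<open>A permutation of \<open>insert b W\<close> is \<open>transpose b c\<close> after one of
  \<open>W\<close>. For \<open>c = b\<close> a new cycle appears, which gives \<open>x\<close>; each
  \<open>c\<close> in \<open>W\<close> splices \<open>b\<close> into an old cycle and gives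
  \<open>t\<close>. The factor \<open>t\<close> is 1 for the trivial character and -1 for the
  sign.\<close>

lemma sum_permutes_insert_ncyc:
  fixes x t :: complex
  assumes \<chi>: "\<And>b c q. b \<noteq> c \<Longrightarrow> permutation q \<Longrightarrow> \<chi> (transpose b c \<circ> q) = t * \<chi> q"
    and "finite U" "W \<subseteq> U" "b \<notin> U" "\<rho> permutes U"
  shows "(\<Sum>s | s permutes insert b W. \<chi> s * x ^ ncyc (insert b U) (\<rho> \<circ> s)) =
    (x + t * of_nat (card W)) * (\<Sum>s | s permutes W. \<chi> s * x ^ ncyc U (\<rho> \<circ> s))"
proof -
  have W: "finite W" "b \<notin> W" using assms finite_subset by auto
  have sU: "s permutes U" if "s permutes W" for s using that assms(3) by (rule permutes_subset)
  have b: "\<chi> (transpose b b \<circ> s) * x ^ ncyc (insert b U) (\<rho> \<circ> (transpose b b \<circ> s)) = x * (\<chi> s * x ^ ncyc U (\<rho> \<circ> s))"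
    if "s permutes W" for s
    using ncyc_insert_fixed[OF assms(2) _ assms(4), of "\<rho> \<circ> s"] sU[OF that] assms(5) by (simp add: permutes_compose)
  have c: "\<chi> (transpose b c \<circ> s) * x ^ ncyc (insert b U) (\<rho> \<circ> (transpose b c \<circ> s)) = t * (\<chi> s * x ^ ncyc U (\<rho> \<circ> s))"
    if s: "s permutes W" and c: "c \<in> W" for s c
  proof -
    let ?V = "insert b U"
    have V: "finite ?V" "\<rho> permutes ?V" "transpose b c \<circ> s permutes ?V"
      using assms c permutes_subset[OF sU[OF s], of ?V]
      by (auto intro: permutes_subset intro!: permutes_compose[of s] permutes_swap_id)
    \<comment> \<open>The transposition has to stand leftmost to be spliced away, and rotating a
      product does not change its number of cycles.\<close>
    have "ncyc ?V (\<rho> \<circ> (transpose b c \<circ> s)) = ncyc ?V ((transpose b c \<circ> s) \<circ> \<rho>)"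
      by (rule ncyc_comp_commute[OF V])
    also have "\<dots> = ncyc ?V (transpose b c \<circ> (s \<circ> \<rho>))" by (simp add: o_assoc)
    also have "\<dots> = ncyc U (s \<circ> \<rho>)"
      using assms c sU[OF s] by (intro ncyc_insert_transpose) (auto intro: permutes_compose)
    also have "\<dots> = ncyc U (\<rho> \<circ> s)" by (rule ncyc_comp_commute[OF assms(2) sU[OF s] assms(5)])
    finally show ?thesis using \<chi>[of b c s] c W s by (auto simp: permutes_imp_permutation)
  qed
  have "(\<Sum>s | s permutes insert b W. \<chi> s * x ^ ncyc (insert b U) (\<rho> \<circ> s)) =
      (\<Sum>s | s permutes W. x * (\<chi> s * x ^ ncyc U (\<rho> \<circ> s))) + (\<Sum>c\<in>W. \<Sum>s | s permutes W. t * (\<chi> s * x ^ ncyc U (\<rho> \<circ> s)))"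
    unfolding sum_over_permutations_insert[OF W]
    by (subst sum.insert[OF W]) (intro arg_cong2[of _ _ _ _ "(+)"] sum.cong refl; use b c in auto)
  then show ?thesis by (simp add: sum_distrib_left[symmetric] distrib_right)
qed

text \<open>The group permutes a set that meets \<open>U\<close> in the single point
  \<open>a\<close>, so the points of \<open>S\<close> can be added one by one, each new to both
  sets; the i-th one contributes x + t i.\<close>

lemma sum_permutes_ncyc:
  fixes x t :: complex
  assumes \<chi>: "\<And>b c q. b \<noteq> c \<Longrightarrow> permutation q \<Longrightarrow> \<chi> (transpose b c \<circ> q) = t * \<chi> q" and \<chi>id: "\<chi> id = 1"
    and U: "finite U" "a \<in> U" "\<rho> permutes U" and S: "finite S" "S \<inter> U = {}"
  shows "(\<Sum>s | s permutes insert a S. \<chi> s * x ^ ncyc (U \<union> S) (\<rho> \<circ> s)) =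
    (\<Prod>i=1..card S. x + t * of_nat i) * x ^ ncyc U \<rho>"
  using S
proof (induction S rule: finite_induct)
  case empty
  have "\<chi> (\<lambda>x. x) = 1" using \<chi>id by (simp add: id_def)
  then show ?case by simp
next
  case (insert b S)
  have a: "a \<notin> S" using insert U by auto
  have p: "(\<Prod>i=1..Suc (card S). x + t * of_nat i) = (x + t * of_nat (Suc (card S))) * (\<Prod>i=1..card S. x + t * of_nat i)"
    by (simp add: mult.commute)
  have "(\<Sum>s | s permutes insert b (insert a S). \<chi> s * x ^ ncyc (insert b (U \<union> S)) (\<rho> \<circ> s)) =
      (x + t * of_nat (card (insert a S))) * (\<Sum>s | s permutes insert a S. \<chi> s * x ^ ncyc (U \<union> S) (\<rho> \<circ> s))"
    using insert U by (intro sum_permutes_insert_ncyc[OF \<chi>]) (auto intro: permutes_subset)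
  also have "card (insert a S) = Suc (card S)" using insert a by simp
  also have "(\<Sum>s | s permutes insert a S. \<chi> s * x ^ ncyc (U \<union> S) (\<rho> \<circ> s)) =
      (\<Prod>i=1..card S. x + t * of_nat i) * x ^ ncyc U \<rho>"
    using insert.IH insert.prems by blast
  finally have "(\<Sum>s | s permutes insert b (insert a S). \<chi> s * x ^ ncyc (insert b (U \<union> S)) (\<rho> \<circ> s)) =
      (\<Prod>i=1..Suc (card S). x + t * of_nat i) * x ^ ncyc U \<rho>"
    unfolding p mult.assoc .
  moreover have "insert b (insert a S) = insert a (insert b S)" "insert b (U \<union> S) = U \<union> insert b S"
    "card (insert b S) = Suc (card S)" using insert by auto
  ultimately show ?case by (simp only:)
qed

section \<open>Hooks\<close>

lemma orbit_enum:
  assumes "permutation w"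
  shows "bij_betw (\<lambda>i. (w ^^ i) x) {..<card (orbit w x)} (orbit w x)" "(w ^^ card (orbit w x)) x = x"
proof -
  have self: "x \<in> orbit w x" using assms by (rule permutation_self_in_orbit)
  let ?d = "funpow_dist1 w x x"
  have b: "bij_betw (\<lambda>i. (w ^^ i) x) {0..<?d} (orbit w x)"
    unfolding bij_betw_def using inj_on_funpow_dist1[OF self] orbit_conv_funpow_dist1[OF self] by simp
  then have d: "card (orbit w x) = ?d" using bij_betw_same_card by fastforce
  show "bij_betw (\<lambda>i. (w ^^ i) x) {..<card (orbit w x)} (orbit w x)"
    using b unfolding d by (simp add: atLeast0LessThan)
  show "(w ^^ card (orbit w x)) x = x" unfolding d by (rule funpow_dist1_prop[OF self])
qed

text \<open>The conjugating permutation matches the iterates of the two starting points and pairs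
  the fixed points arbitrarily.\<close>

lemma single_cycle_conj:
  assumes A: "finite A" and w: "w permutes A" and w': "w' permutes A" and x: "x \<in> A" "x' \<in> A"
    and card: "card (orbit w x) = card (orbit w' x')"
    and fixed: "\<And>y. y \<in> A - orbit w x \<Longrightarrow> w y = y" "\<And>y. y \<in> A - orbit w' x' \<Longrightarrow> w' y = y"
  obtains h where "h permutes A" "w' = h \<circ> w \<circ> inv h"
proof -
  let ?O = "orbit w x" and ?O' = "orbit w' x'"
  define k where "k = card ?O"
  have perm: "permutation w" "permutation w'" using A w w' by (auto intro: permutes_imp_permutation)
  have sub: "?O \<subseteq> A" "?O' \<subseteq> A" using permutes_orbit_subset[OF w x(1)] permutes_orbit_subset[OF w' x(2)] by auto
  let ?f = "\<lambda>i. (w ^^ i) x" and ?f' = "\<lambda>i. (w' ^^ i) x'"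
  have f: "bij_betw ?f {..<k} ?O" and fk: "?f k = x" using orbit_enum[OF perm(1), of x] by (auto simp: k_def)
  have f': "bij_betw ?f' {..<k} ?O'" and fk': "?f' k = x'"
    using orbit_enum[OF perm(2), of x'] by (auto simp: k_def card)
  have k0: "k > 0" using fk f x permutation_self_in_orbit[OF perm(1), of x] by (cases k) (auto simp: bij_betw_def)
  have "card (A - ?O) = card (A - ?O')" using A sub card by (simp add: card_Diff_subset finite_subset)
  then obtain h1 where h1: "bij_betw h1 (A - ?O) (A - ?O')"
    using A by (meson finite_Diff finite_same_card_bij)
  define h0 where "h0 y = ?f' (inv_into {..<k} ?f y)" for y
  have h0f: "h0 (?f i) = ?f' i" if "i < k" for i
    unfolding h0_def using bij_betw_inv_into_left[OF f, of i] that by simp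
  have h0: "bij_betw h0 ?O ?O'"
    unfolding h0_def using bij_betw_trans[OF bij_betw_inv_into[OF f] f'] by (simp add: comp_def)
  define h where "h y = (if y \<in> ?O then h0 y else if y \<in> A then h1 y else y)" for y
  have "bij_betw h ?O ?O'" using h0 bij_betw_cong[of ?O h h0] by (simp add: h_def)
  moreover have "bij_betw h (A - ?O) (A - ?O')" using h1 bij_betw_cong[of "A - ?O" h h1] by (simp add: h_def)
  ultimately have "bij_betw h (?O \<union> (A - ?O)) (?O' \<union> (A - ?O'))" by (rule bij_betw_combine) auto
  moreover have "?O \<union> (A - ?O) = A" "?O' \<union> (A - ?O') = A" using sub by auto
  ultimately have "bij_betw h A A" by simp
  then have h: "h permutes A" by (rule bij_imp_permutes) (use sub in \<open>auto simp: h_def\<close>)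
  have comm: "h (w y) = w' (h y)" for y
  proof -
    consider "y \<in> ?O" | "y \<in> A - ?O" | "y \<notin> A" by blast
    then show ?thesis
    proof cases
      case 1
      then obtain i where i: "i < k" "y = ?f i" using f by (auto simp: bij_betw_def)
      have hO: "h (?f j) = ?f' j" if "j < k" for j
        using that h0f[OF that] bij_betw_apply[OF f, of j] by (simp add: h_def)
      have "h (?f (Suc i)) = ?f' (Suc i)"
      proof (cases "Suc i < k")
        case True
        then show ?thesis by (rule hO)
      next
        case False
        then have "Suc i = k" using i by simp
        then show ?thesis using hO[OF k0] fk fk' by (metis funpow_0)
      qed
      then show ?thesis using hO[OF i(1)] by (simp add: i(2))
    next
      case 2
      then have "h y \<in> A - ?O'" using bij_betw_apply[OF h1, of y] by (simp add: h_def)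
      then show ?thesis using 2 fixed by simp
    next
      case 3
      then show ?thesis using permutes_not_in[OF w] permutes_not_in[OF w'] permutes_not_in[OF h] by simp
    qed
  qed
  have "w' = h \<circ> w \<circ> inv h" by (simp add: fun_eq_iff comm permutes_inverses[OF h])
  then show ?thesis using that h by blast
qed

text \<open>The column carries 0 and \<open>S\<close>, the row carries 0 and all other labels. Each
  label serves as its own coordinate, so the occupied rows and columns may have gaps; stabilizers
  only compare coordinates, and no renumbering is required.\<close>

definition hook :: "nat set \<Rightarrow> nat \<Rightarrow> nat \<times> nat" where
  "hook S m = (if m \<in> S \<or> m = 0 then (m, 0) else (0, m))"

lemma row_stabilizer_hook:
  assumes "S \<subseteq> {1..<k}"
  shows "row_stabilizer k (hook S) = {r. r permutes {..<k} - S}"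
proof (intro set_eqI iffI)
  fix g assume "g \<in> row_stabilizer k (hook S)"
  then have g: "g permutes {..<k}" "\<And>m. m < k \<Longrightarrow> fst (hook S (g m)) = fst (hook S m)"
    by (auto simp: row_stabilizer_def)
  have "g m = m" if "m \<in> S" for m
  proof -
    have "fst (hook S (g m)) = fst (hook S m)" using g(2) that assms by auto
    moreover have "m \<noteq> 0" using that assms by auto
    ultimately show ?thesis using that by (auto simp: hook_def split: if_splits)
  qed
  then have "g permutes {..<k} - S" by (intro permutes_superset[OF g(1)]) auto
  then show "g \<in> {r. r permutes {..<k} - S}" by simp
next
  fix g assume "g \<in> {r. r permutes {..<k} - S}"
  then have g: "g permutes {..<k} - S" by simp
  have "fst (hook S (g m)) = fst (hook S m)" if "m < k" for m
  proof (cases "m \<in> S")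
    case True
    then show ?thesis using permutes_not_in[OF g] by simp
  next
    case False
    then have "g m \<notin> S" using permutes_in_image[OF g, of m] that by auto
    then show ?thesis using False by (auto simp: hook_def)
  qed
  then show "g \<in> row_stabilizer k (hook S)"
    using permutes_subset[OF g, of "{..<k}"] by (simp add: row_stabilizer_def)
qed

lemma column_stabilizer_hook:
  assumes "S \<subseteq> {1..<k}" "k \<ge> 1"
  shows "column_stabilizer k (hook S) = {s. s permutes insert 0 S}"
proof (intro set_eqI iffI)
  fix g assume "g \<in> column_stabilizer k (hook S)"
  then have g: "g permutes {..<k}" "\<And>m. m < k \<Longrightarrow> snd (hook S (g m)) = snd (hook S m)"
    by (auto simp: column_stabilizer_def)
  have "g m = m" if "m < k" "m \<notin> insert 0 S" for m
    using g(2)[OF that(1)] that(2) by (auto simp: hook_def split: if_splits)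
  then show "g \<in> {s. s permutes insert 0 S}" using permutes_superset[OF g(1), of "insert 0 S"] by auto
next
  fix g assume "g \<in> {s. s permutes insert 0 S}"
  then have g: "g permutes insert 0 S" by simp
  have "snd (hook S (g m)) = snd (hook S m)" if "m < k" for m
  proof (cases "m \<in> insert 0 S")
    case True
    then have "g m \<in> insert 0 S" using permutes_in_image[OF g, of m] by (simp only:)
    moreover have "snd (hook S x) = 0" if "x \<in> insert 0 S" for x using that by (auto simp: hook_def)
    ultimately show ?thesis using True by simp
  next
    case False
    then show ?thesis using permutes_not_in[OF g, of m] by simp
  qed
  moreover have "insert 0 S \<subseteq> {..<k}" using assms by auto
  ultimately show "g \<in> column_stabilizer k (hook S)"
    using permutes_subset[OF g, of "{..<k}"] by (simp add: column_stabilizer_def)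
qed

text \<open>By injectivity the row entries are sent by \<open>g\<close> to distinct columns and so
  exhaust them. A column other than 0 holds one entry only, hence an element of \<open>S\<close>
  must go to column 0, and its new cell is its old one.\<close>

lemma young_hook:
  assumes "S \<subseteq> {1..<k}" "k \<ge> 1"
  shows "young k (hook S)"
proof
  show "inj_on (hook S) {..<k}" by (auto simp: inj_on_def hook_def split: if_splits)
next
  fix g assume g: "g permutes {..<k}" and inj: "inj_on (\<lambda>m. (fst (hook S m), snd (hook S (g m)))) {..<k}"
  let ?Row = "{..<k} - S"
  have S0: "0 \<notin> S" using assms by auto
  have fst0: "fst (hook S m) = 0" if "m \<in> ?Row" for m using that by (auto simp: hook_def)
  have snd_mem: "snd (hook S m) \<in> ?Row" if "m < k" for m
    using that assms S0 by (auto simp: hook_def)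
  have "inj_on (\<lambda>m. snd (hook S (g m))) ?Row"
  proof (rule inj_onI)
    fix a b assume "a \<in> ?Row" "b \<in> ?Row" "snd (hook S (g a)) = snd (hook S (g b))"
    then show "a = b" using inj_onD[OF inj, of a b] fst0[of a] fst0[of b] by simp
  qed
  moreover have "(\<lambda>m. snd (hook S (g m))) ` ?Row \<subseteq> ?Row"
  proof
    fix z assume "z \<in> (\<lambda>m. snd (hook S (g m))) ` ?Row"
    then obtain m where "m < k" "z = snd (hook S (g m))" by blast
    then show "z \<in> ?Row" using snd_mem[of "g m"] permutes_in_image[OF g, of m] by simp
  qed
  ultimately have surj: "(\<lambda>m. snd (hook S (g m))) ` ?Row = ?Row"
    by (intro endo_inj_surj) auto
  show "(\<lambda>m. (fst (hook S m), snd (hook S (g m)))) ` {..<k} \<subseteq> hook S ` {..<k}"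
  proof
    fix z assume "z \<in> (\<lambda>m. (fst (hook S m), snd (hook S (g m)))) ` {..<k}"
    then obtain m where m: "m < k" "z = (fst (hook S m), snd (hook S (g m)))" by auto
    define j where "j = snd (hook S (g m))"
    have j: "j \<in> ?Row" unfolding j_def using snd_mem[of "g m"] permutes_in_image[OF g, of m] m(1) by simp
    show "z \<in> hook S ` {..<k}"
    proof (cases "m \<in> S")
      case False
      then have "z = (0, j)" using m fst0[of m] by (simp add: j_def)
      then have "z = hook S j" using j by (auto simp: hook_def)
      then show ?thesis using j by auto
    next
      case True
      have "j = 0"
      proof (rule ccontr)
        assume "j \<noteq> 0"
        have "j \<in> (\<lambda>m. snd (hook S (g m))) ` ?Row" unfolding surj by (rule j)
        then obtain m' where m': "m' \<in> ?Row" "snd (hook S (g m')) = j" by (rule imageE) simp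
        have "y = j" if "snd (hook S y) = j" for y
          using that \<open>j \<noteq> 0\<close> by (simp add: hook_def split: if_splits)
        then have "g m = j" "g m' = j" using m'(2) j_def by simp_all
        then have "m = m'" using permutes_inj[OF g] by (metis injD)
        then show False using True m' by simp
      qed
      then have "z = (fst (hook S m), 0)" using m by (simp add: j_def)
      then have "z = hook S m" using True by (simp add: hook_def)
      then show ?thesis using m by auto
    qed
  qed
qed

lemma (in young) sum_Y:
  "(\<Sum>h | h permutes {..<n}. F h * Y h) = (\<Sum>r\<in>R. \<Sum>s\<in>C. of_int (sign s) * F (r \<circ> s))"
proof -
  have inj: "inj_on (\<lambda>(r, s). r \<circ> s) (R \<times> C)"
  proof (rule inj_onI)
    fix a b assume a: "a \<in> R \<times> C" and b: "b \<in> R \<times> C"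
      and eq: "(case a of (r, s) \<Rightarrow> r \<circ> s) = (case b of (r, s) \<Rightarrow> r \<circ> s)"
    obtain r s r' s' where ab: "a = (r, s)" "b = (r', s')" by (cases a, cases b) auto
    then have m: "r \<in> R" "s \<in> C" "r' \<in> R" "s' \<in> C" "r \<circ> s = r' \<circ> s'" using a b eq by auto
    note p = R_permutes[OF m(1)] C_permutes[OF m(2)] R_permutes[OF m(3)] C_permutes[OF m(4)]
    have "inv r' \<circ> r = s' \<circ> inv s"
    proof
      fix y
      have "r (s (inv s y)) = r' (s' (inv s y))" using fun_cong[OF m(5), of "inv s y"] by simp
      then show "(inv r' \<circ> r) y = (s' \<circ> inv s) y"
        by (simp add: permutes_inverses[OF p(2)] permutes_inverses[OF p(3)])
    qed
    moreover have "inv r' \<circ> r \<in> R" "s' \<circ> inv s \<in> C" using m by (auto intro: comp_in_R comp_in_C inv_in_R inv_in_C)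
    ultimately have "inv r' \<circ> r = id" "s' \<circ> inv s = id" using R_Int_C by metis+
    then have "r = r'" "s = s'"
      using permutes_inv_comp_cancel(4)[OF p(3), of r] permutes_inv_comp_cancel(6)[OF p(2), of s'] by auto
    then show "a = b" using ab by simp
  qed
  have "(\<Sum>h | h permutes {..<n}. F h * Y h) = (\<Sum>h\<in>(\<lambda>(r, s). r \<circ> s) ` (R \<times> C). F h * Y h)"
  proof (rule sum.mono_neutral_right)
    show "(\<lambda>(r, s). r \<circ> s) ` (R \<times> C) \<subseteq> {h. h permutes {..<n}}"
      by (auto intro: permutes_compose R_permutes C_permutes)
    show "\<forall>h\<in>{h. h permutes {..<n}} - (\<lambda>(r, s). r \<circ> s) ` (R \<times> C). F h * Y h = 0"
    proof
      fix h assume "h \<in> {h. h permutes {..<n}} - (\<lambda>(r, s). r \<circ> s) ` (R \<times> C)"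
      then have "Y h = 0" by (intro Y_not_RC) auto
      then show "F h * Y h = 0" by simp
    qed
  qed (simp add: finite_permutations)
  also have "\<dots> = (\<Sum>(r, s)\<in>R \<times> C. F (r \<circ> s) * Y (r \<circ> s))"
    using inj by (simp add: sum.reindex case_prod_unfold comp_def)
  also have "\<dots> = (\<Sum>(r, s)\<in>R \<times> C. of_int (sign s) * F (r \<circ> s))"
    by (intro sum.cong refl) (auto simp: Y_RC)
  finally show ?thesis by (simp add: sum.cartesian_product)
qed

lemma convolution_at_id:
  "convolution n x y id = (\<Sum>h | h permutes {..<n}. x (inv h) * y h)"
  unfolding convolution_def
  by (subst sum_permutations_inverse) (auto intro!: sum.cong simp: permutes_inv_inv)

text \<open>The row group and the column group share only the corner 0, so
  \<open>sum_permutes_ncyc\<close> evaluates the column sum for each fixed \<open>r\<close> and then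
  the row sum.\<close>

lemma hook_double_sum:
  fixes x t1 t2 :: complex
  assumes S: "S \<subseteq> {1..<k}" and k: "k \<ge> 1"
    and \<chi>1: "\<And>b c q. b \<noteq> c \<Longrightarrow> permutation q \<Longrightarrow> \<chi>1 (transpose b c \<circ> q) = t1 * \<chi>1 q" "\<chi>1 id = 1"
    and \<chi>2: "\<And>b c q. b \<noteq> c \<Longrightarrow> permutation q \<Longrightarrow> \<chi>2 (transpose b c \<circ> q) = t2 * \<chi>2 q" "\<chi>2 id = 1"
  shows "(\<Sum>r | r permutes {..<k} - S. \<Sum>s | s permutes insert 0 S. \<chi>1 r * \<chi>2 s * x ^ ncyc {..<k} (r \<circ> s)) =
    x * (\<Prod>i=1..k - 1 - card S. x + t1 * of_nat i) * (\<Prod>i=1..card S. x + t2 * of_nat i)"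
proof -
  let ?U = "{..<k} - S"
  have fS: "finite S" using S finite_subset by blast
  have U: "?U \<union> S = {..<k}" "0 \<in> ?U" using S k by auto
  have cU: "card (?U - {0}) = k - 1 - card S"
    using S fS U(2) by (subst card_Diff_singleton) (auto simp: card_Diff_subset subset_iff)
  have inner: "(\<Sum>s | s permutes insert 0 S. \<chi>1 r * \<chi>2 s * x ^ ncyc {..<k} (r \<circ> s)) =
      (\<Prod>i=1..card S. x + t2 * of_nat i) * (\<chi>1 r * x ^ ncyc ?U r)" if r: "r permutes ?U" for r
  proof -
    have "(\<Sum>s | s permutes insert 0 S. \<chi>2 s * x ^ ncyc (?U \<union> S) (r \<circ> s)) =
        (\<Prod>i=1..card S. x + t2 * of_nat i) * x ^ ncyc ?U r"
      by (rule sum_permutes_ncyc[OF \<chi>2]) (use U r fS in auto)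
    then show ?thesis unfolding U(1) by (simp add: sum_distrib_left[symmetric] mult.assoc mult.left_commute)
  qed
  \<comment> \<open>Now the row group is built up from the single point 0, with the identity as the
    fixed factor.\<close>
  have "(\<Sum>r | r permutes insert 0 (?U - {0}). \<chi>1 r * x ^ ncyc ({0} \<union> (?U - {0})) (id \<circ> r)) =
      (\<Prod>i=1..card (?U - {0}). x + t1 * of_nat i) * x ^ ncyc {0} id"
    by (rule sum_permutes_ncyc[OF \<chi>1]) auto
  moreover have "insert 0 (?U - {0}) = ?U" "{0} \<union> (?U - {0}) = ?U" using U(2) by auto
  moreover have "ncyc {0} id = 1" by (simp add: ncyc_def)
  ultimately have outer: "(\<Sum>r | r permutes ?U. \<chi>1 r * x ^ ncyc ?U r) = (\<Prod>i=1..k - 1 - card S. x + t1 * of_nat i) * x"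
    by (simp add: cU)
  have "(\<Sum>r | r permutes ?U. \<Sum>s | s permutes insert 0 S. \<chi>1 r * \<chi>2 s * x ^ ncyc {..<k} (r \<circ> s)) =
      (\<Sum>r | r permutes ?U. (\<Prod>i=1..card S. x + t2 * of_nat i) * (\<chi>1 r * x ^ ncyc ?U r))"
    by (intro sum.cong refl) (use inner in simp)
  also have "\<dots> = (\<Prod>i=1..card S. x + t2 * of_nat i) * ((\<Prod>i=1..k - 1 - card S. x + t1 * of_nat i) * x)"
    unfolding sum_distrib_left[symmetric] outer ..
  finally show ?thesis by (simp add: mult_ac)
qed

text \<open>The corner has content 0, the arm 1, ..., k - 1 - a and the leg -1, ..., -a; together
  these are the numbers i - a for i < k.\<close>

lemma prod_contents:
  fixes x t :: complex
  assumes "a < k"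
  shows "x * (\<Prod>i=1..k - 1 - a. x + t * of_nat i) * (\<Prod>i=1..a. x + (- t) * of_nat i) =
    (\<Prod>i<k. x + t * (of_nat i - of_nat a))"
proof -
  have "(\<Prod>i<k. x + t * (of_nat i - of_nat a)) =
      (\<Prod>i<a. x + t * (of_nat i - of_nat a)) * (\<Prod>i=a..<k. x + t * (of_nat i - of_nat a))"
    using assms prod.atLeastLessThan_concat[of 0 a k "\<lambda>i. x + t * (of_nat i - of_nat a)"]
    by (simp add: atLeast0LessThan)
  also have "(\<Prod>i=a..<k. x + t * (of_nat i - of_nat a)) = x * (\<Prod>i=Suc a..<k. x + t * (of_nat i - of_nat a))"
    using assms by (subst prod.atLeast_Suc_lessThan) auto
  also have "(\<Prod>i=Suc a..<k. x + t * (of_nat i - of_nat a)) = (\<Prod>i=1..k - 1 - a. x + t * of_nat i)"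
    by (rule prod.reindex_bij_witness[of _ "\<lambda>i. i + a" "\<lambda>i. i - a"]) (use assms in \<open>auto simp: of_nat_diff\<close>)
  also have "(\<Prod>i<a. x + t * (of_nat i - of_nat a)) = (\<Prod>i=1..a. x + (- t) * of_nat i)"
    by (rule prod.reindex_bij_witness[of _ "\<lambda>i. a - i" "\<lambda>i. a - i"]) (auto simp: of_nat_diff algebra_simps)
  finally show ?thesis by (simp add: mult_ac)
qed

section \<open>Cycle-counting class functions on hook modules\<close>

definition cyc_weight :: "nat \<Rightarrow> complex \<Rightarrow> (nat \<Rightarrow> nat) \<Rightarrow> complex" where
  "cyc_weight n x = (\<lambda>g. x ^ ncyc {..<n} g)"

definition signed_cyc_weight :: "nat \<Rightarrow> complex \<Rightarrow> (nat \<Rightarrow> nat) \<Rightarrow> complex" where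
  "signed_cyc_weight n x = (\<lambda>g. of_int (sign g) * x ^ ncyc {..<n} g)"

lemma class_function_cyc_weight: "class_function n (cyc_weight n x)"
  by (simp add: class_function_def cyc_weight_def ncyc_conj)

lemma class_function_signed_cyc_weight: "class_function n (signed_cyc_weight n x)"
  unfolding class_function_def
proof (intro allI impI)
  fix g h assume g: "g permutes {..<n}" and h: "h permutes {..<n}"
  have "sign (h \<circ> g \<circ> inv h) = sign h * sign g * sign (inv h)"
    using g h by (simp add: sign_comp_permutes[of "{..<n}"] permutes_compose permutes_inv)
  also have "\<dots> = sign g" using h by (simp add: sign_inv_permutes[of "{..<n}"] mult_ac)
  finally show "signed_cyc_weight n x (h \<circ> g \<circ> inv h) = signed_cyc_weight n x g"
    using ncyc_conj[of "{..<n}", OF _ g h] by (simp add: signed_cyc_weight_def)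
qed

lemma sign_transpose_comp:
  assumes "b \<noteq> c" "permutation q"
  shows "of_int (sign (transpose b c \<circ> q)) = (- 1 :: complex) * of_int (sign q)"
  using assms by (simp add: sign_compose permutation_swap_id sign_swap_id)

text \<open>Expanding \<open>Y\<close> puts the trivial character on the row group and the sign on
  the column group, which produces the factors x + c over the contents c. The additional sign of
  \<open>r \<circ> s\<close> exchanges the two characters, which negates the contents.\<close>

lemma
  assumes S: "S \<subseteq> {1..<k}" and k: "k \<ge> 1"
  shows cyc_weight_hook: "convolution k (cyc_weight k x) (young_symmetrizer k (hook S)) id =
      (\<Prod>i<k. x + 1 * (of_nat i - of_nat (card S)))"
    and signed_cyc_weight_hook: "convolution k (signed_cyc_weight k x) (young_symmetrizer k (hook S)) id =
      (\<Prod>i<k. x + (- 1) * (of_nat i - of_nat (card S)))"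
proof -
  interpret young k "hook S" by (rule young_hook[OF assms])
  have "card S \<le> card {1..<k}" using S by (intro card_mono) auto
  then have a: "card S < k" using k by simp
  note rc = row_stabilizer_hook[OF S] column_stabilizer_hook[OF S k]
  have "convolution k (cyc_weight k x) Y id = (\<Sum>h | h permutes {..<k}. cyc_weight k x h * Y h)"
    unfolding convolution_at_id by (intro sum.cong refl) (simp add: cyc_weight_def ncyc_inv)
  also have "\<dots> = (\<Sum>r | r permutes {..<k} - S. \<Sum>s | s permutes insert 0 S. 1 * of_int (sign s) * x ^ ncyc {..<k} (r \<circ> s))"
    unfolding sum_Y rc by (simp add: cyc_weight_def)
  also have "\<dots> = x * (\<Prod>i=1..k - 1 - card S. x + 1 * of_nat i) * (\<Prod>i=1..card S. x + (- 1) * of_nat i)"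
    by (rule hook_double_sum[OF S k, where ?\<chi>1.0 = "\<lambda>_. 1" and ?\<chi>2.0 = "\<lambda>s. of_int (sign s)"])
      (auto simp: sign_transpose_comp simp del: o_apply)
  also have "\<dots> = (\<Prod>i<k. x + 1 * (of_nat i - of_nat (card S)))" by (rule prod_contents[OF a])
  finally show "convolution k (cyc_weight k x) Y id = (\<Prod>i<k. x + 1 * (of_nat i - of_nat (card S)))" .
  have "convolution k (signed_cyc_weight k x) Y id = (\<Sum>h | h permutes {..<k}. signed_cyc_weight k x h * Y h)"
    unfolding convolution_at_id
    by (intro sum.cong refl) (simp add: signed_cyc_weight_def ncyc_inv sign_inv_permutes[of "{..<k}"])
  also have "\<dots> = (\<Sum>r | r permutes {..<k} - S. \<Sum>s | s permutes insert 0 S. of_int (sign r) * 1 * x ^ ncyc {..<k} (r \<circ> s))"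
    unfolding sum_Y signed_cyc_weight_def
  proof (intro sum.cong refl, simp_all only: rc)
    fix r s assume rs: "r \<in> {r. r permutes {..<k} - S}" "s \<in> {s. s permutes insert 0 S}"
    have "r permutes {..<k}" "s permutes {..<k}" using rs R_permutes[of r] C_permutes[of s] by (auto simp: rc)
    then have "sign s * sign (r \<circ> s) = sign r" by (simp add: sign_comp_permutes[of "{..<k}"] mult_ac)
    then have "of_int (sign s) * of_int (sign (r \<circ> s)) = (of_int (sign r) :: complex)" by (metis of_int_mult)
    then show "of_int (sign s) * (of_int (sign (r \<circ> s)) * x ^ ncyc {..<k} (r \<circ> s)) =
      of_int (sign r) * 1 * x ^ ncyc {..<k} (r \<circ> s)" by (simp only: mult.assoc[symmetric] mult_1_right)
  qed
  also have "\<dots> = x * (\<Prod>i=1..k - 1 - card S. x + (- 1) * of_nat i) * (\<Prod>i=1..card S. x + 1 * of_nat i)"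
    by (rule hook_double_sum[OF S k, where ?\<chi>2.0 = "\<lambda>_. 1" and ?\<chi>1.0 = "\<lambda>s. of_int (sign s)"])
      (auto simp: sign_transpose_comp simp del: o_apply)
  also have "\<dots> = (\<Prod>i<k. x + (- 1) * (of_nat i - of_nat (card S)))"
    using prod_contents[OF a, of x "- 1"] by simp
  finally show "convolution k (signed_cyc_weight k x) Y id = (\<Prod>i<k. x + (- 1) * (of_nat i - of_nat (card S)))" .
qed

text \<open>The column factor \<open>inv r \<circ> v\<close> is determined by \<open>r\<close>;
  indexing by \<open>r\<close> alone prepares the involution of the next lemma.\<close>

lemma young_symmetrizer_hook:
  assumes "S \<subseteq> {1..<k}" "k \<ge> 1"
  shows "young_symmetrizer k (hook S) v =
    (\<Sum>r | r permutes {..<k} - S \<and> inv r \<circ> v permutes insert 0 S. of_int (sign (inv r \<circ> v)))"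
proof -
  have sub: "r permutes {..<k}" if "r permutes {..<k} - S" for r
    using that by (rule permutes_subset) auto
  have "young_symmetrizer k (hook S) v =
      (\<Sum>r | r permutes {..<k}. if r permutes {..<k} - S \<and> inv r \<circ> v permutes insert 0 S then of_int (sign (inv r \<circ> v)) else 0)"
    unfolding young_symmetrizer_def convolution_def row_symmetrizer_def column_antisymmetrizer_def
      row_stabilizer_hook[OF assms(1)] column_stabilizer_hook[OF assms]
    by (intro sum.cong refl) simp
  also have "\<dots> = (\<Sum>r | r permutes {..<k} - S \<and> inv r \<circ> v permutes insert 0 S. of_int (sign (inv r \<circ> v)))"
    by (rule sum.mono_neutral_cong_right) (use sub in \<open>auto simp: finite_permutations\<close>)
  finally show ?thesis .
qed

text \<open>A sign-reversing involution on the pairs (S, r). Fix a cycle \<open>K\<close> of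
  \<open>v\<close> that avoids 0: it lies either inside \<open>S\<close>, where the column factor
  performs it, or outside, where \<open>r\<close> does. The involution moves \<open>K\<close> to the
  other side: \<open>card S\<close> changes by \<open>card K\<close>, the sign of \<open>r\<close>
  by (-1) ^ (card K + 1), in total a factor -1.\<close>

lemma alternating_hook_sum_eq_0:
  assumes k: "k \<ge> 1" and v: "v permutes {..<k}" and long: "orbit v 0 \<noteq> {..<k}"
  shows "(\<Sum>S\<in>Pow {1..<k}. (-1) ^ card S * young_symmetrizer k (hook S) v) = 0"
proof -
  have perm: "permutation v" using v by (rule permutes_imp_permutation[rotated]) simp
  have "orbit v 0 \<subseteq> {..<k}" using k by (intro permutes_orbit_subset[OF v]) simp
  then obtain x where x: "x < k" "x \<notin> orbit v 0" using long by auto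
  define K where "K = orbit v x"
  have Kk: "K \<subseteq> {..<k}" unfolding K_def using x by (intro permutes_orbit_subset[OF v]) simp
  have xK: "x \<in> K" unfolding K_def using perm by (rule permutation_self_in_orbit)
  have K_orbit: "orbit v m = K" if "m \<in> K" for m
    using that unfolding K_def by (rule orbit_eq_of_mem[OF perm])
  have zK: "0 \<notin> K"
  proof
    assume "0 \<in> K"
    then have "x \<in> orbit v 0" using K_orbit[of 0] xK by simp
    then show False using x by simp
  qed
  have finK: "finite K" using Kk finite_subset by blast
  have vK: "v m \<in> K" if "m \<in> K" for m using K_orbit[OF that] orbit.base[of v m] by simp
  have vK': "v m \<notin> K" if "m \<notin> K" for m
  proof
    assume "v m \<in> K"
    then have "orbit v m = K" using K_orbit[of "v m"] orbit_eq_of_mem[OF perm orbit.base[of v m]] by simp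
    then show False using that permutation_self_in_orbit[OF perm, of m] by simp
  qed
  define u where "u m = (if m \<in> K then v m else m)" for m
  have u: "u permutes K"
  proof (rule inj_imp_permutes)
    show "inj_on u K" using permutes_inj[OF v] by (auto simp: inj_on_def u_def)
  qed (use vK finK in \<open>auto simp: u_def\<close>)
  have uk: "u permutes {..<k}" using u Kk by (rule permutes_subset)
  have uv: "inv u (v m) = m" if "m \<in> K" for m
    using permutes_inverses(2)[OF u, of m] that by (simp add: u_def)
  have inv_u_fix: "inv u m = m" if "m \<notin> K" for m
    using permutes_not_in[OF permutes_inv[OF u] that] .
  have "orbit u m = K" if "m \<in> K" for m
  proof -
    have "orbit u m = orbit v m"
      by (rule orbit_cong0[of _ K]) (use that vK in \<open>auto simp: u_def\<close>)
    then show ?thesis using K_orbit that by simp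
  qed
  then have "orbit u ` K = {K}" using xK by auto
  then have su: "of_int (sign u) = ((-1) ^ (card K + 1) :: complex)"
    using sign_eq_ncyc[OF finK u] by (simp add: ncyc_def)
  define D where "D = (SIGMA S:Pow {1..<k}. {r. r permutes {..<k} - S \<and> inv r \<circ> v permutes insert 0 S})"
  define W where "W = (\<lambda>(S :: nat set, r). (-1) ^ card S * of_int (sign (inv r \<circ> v)) :: complex)"
  define \<phi> where "\<phi> = (\<lambda>(S, r :: nat \<Rightarrow> nat). if K \<subseteq> S then (S - K, u \<circ> r) else (S \<union> K, inv u \<circ> r))"
  have Q: "(\<Sum>S\<in>Pow {1..<k}. (-1) ^ card S * young_symmetrizer k (hook S) v) = sum W D"
  proof -
    have "(\<Sum>S\<in>Pow {1..<k}. (-1) ^ card S * young_symmetrizer k (hook S) v) =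
        (\<Sum>S\<in>Pow {1..<k}. \<Sum>r | r permutes {..<k} - S \<and> inv r \<circ> v permutes insert 0 S. W (S, r))"
    proof (rule sum.cong[OF refl])
      fix S assume "S \<in> Pow {1..<k}"
      then show "(-1) ^ card S * young_symmetrizer k (hook S) v =
          (\<Sum>r | r permutes {..<k} - S \<and> inv r \<circ> v permutes insert 0 S. W (S, r))"
        using young_symmetrizer_hook[of S k v] k by (simp add: W_def sum_distrib_left)
    qed
    also have "\<dots> = sum W D" unfolding D_def
      by (subst sum.Sigma) (auto intro!: finite_subset[OF _ finite_permutations])
    finally show ?thesis .
  qed
  have step: "\<phi> (S, r) \<in> D \<and> \<phi> (\<phi> (S, r)) = (S, r) \<and> W (\<phi> (S, r)) = - W (S, r)" if "(S, r) \<in> D" for S r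
  proof -
    have S: "S \<subseteq> {1..<k}" and r: "r permutes {..<k} - S" and s: "inv r \<circ> v permutes insert 0 S"
      using that by (auto simp: D_def)
    have rk: "r permutes {..<k}" using r by (rule permutes_subset) auto
    have fS: "finite S" using S finite_subset by blast
    have sfix: "inv r (v m) = m" if "m \<notin> S" "m \<noteq> 0" for m
      using permutes_not_in[OF s, of m] that by simp
    have rfix: "r m = m" if "m \<in> S" for m using permutes_not_in[OF r, of m] that by simp
    have rv: "r m = v m" if "m \<notin> S" "m \<noteq> 0" for m
      using sfix[OF that] permutes_inverses(1)[OF rk, of "v m"] by simp
    have signs: "of_int (sign (inv r' \<circ> v)) = (of_int (sign r') * of_int (sign v) :: complex)"
      if "r' permutes {..<k}" for r'
    proof -
      have "sign (inv r' \<circ> v) = sign r' * sign v"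
        using that v by (simp add: sign_comp_permutes[of "{..<k}"] sign_inv_permutes[of "{..<k}"] permutes_inv)
      then show ?thesis by simp
    qed
    show ?thesis
    proof (cases "K \<subseteq> S")
      case True
      let ?S = "S - K" and ?r = "u \<circ> r"
      have \<phi>: "\<phi> (S, r) = (?S, ?r)" using True by (simp add: \<phi>_def)
      have r': "?r permutes {..<k} - ?S"
        by (rule permutes_compose; rule permutes_subset[OF r] permutes_subset[OF u]) (use Kk in auto)
      have rk': "?r permutes {..<k}" by (rule permutes_compose[OF rk uk])
      have "(inv ?r \<circ> v) m = m" if "m \<notin> insert 0 ?S" for m
      proof (cases "m \<in> K")
        case mK: True
        then have "inv r m = m" using rfix[of m] True permutes_inverses(2)[OF rk, of m] by auto
        then show ?thesis using uv[OF mK] by (simp add: permutes_inv_comp[OF uk rk])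
      next
        case False
        then show ?thesis using inv_u_fix[OF vK'[OF False]] sfix[of m] that by (simp add: permutes_inv_comp[OF uk rk])
      qed
      then have "inv ?r \<circ> v permutes insert 0 ?S"
        by (intro permutes_superset[OF permutes_compose[OF v permutes_inv[OF rk']]]) auto
      then have "\<phi> (S, r) \<in> D" unfolding \<phi> D_def using S r' by auto
      moreover have "\<not> K \<subseteq> ?S" using xK by auto
      then have "\<phi> (?S, ?r) = (?S \<union> K, inv u \<circ> ?r)" by (simp add: \<phi>_def)
      then have "\<phi> (\<phi> (S, r)) = (S, r)" unfolding \<phi>
        using True permutes_inv_comp_cancel(3)[OF u, of r] by auto
      moreover have "W (\<phi> (S, r)) = - W (S, r)"
      proof -
        have "sign ?r = sign u * sign r" by (rule sign_comp_permutes[OF _ uk rk]) simp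
        then have "W (\<phi> (S, r)) = (-1) ^ card ?S * ((-1) ^ (card K + 1) * (of_int (sign r) * of_int (sign v)))"
          unfolding \<phi> W_def by (simp add: signs[OF rk'] su)
        also have "\<dots> = - ((-1) ^ (card ?S + card K) * (of_int (sign r) * of_int (sign v)))"
          by (simp add: power_add)
        also have "card ?S + card K = card S" using True fS finK by (simp add: card_Diff_subset card_mono)
        finally show ?thesis unfolding W_def by (simp add: signs[OF rk])
      qed
      ultimately show ?thesis by simp
    next
      case False
      then obtain m0 where m0: "m0 \<in> K" "m0 \<notin> S" by auto
      \<comment> \<open>Outside \<open>insert 0 S\<close> the column factor is trivial, so
        \<open>r\<close> agrees with \<open>v\<close> there; as \<open>r\<close> preserves the
        complement of \<open>S\<close>, the cycle cannot enter \<open>S\<close>.\<close>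
      have "y \<in> K - S" if "y \<in> orbit v m0" for y
        using that
      proof (induction rule: orbit.induct)
        have *: "v m \<in> K - S" if "m \<in> K - S" for m
        proof -
          have "m \<noteq> 0" using that zK by (cases "m = 0") auto
          then have "r m = v m" using rv that by simp
          moreover have "r m \<in> {..<k} - S"
            using permutes_in_image[OF r, of m] that Kk by blast
          ultimately show ?thesis using vK that by simp
        qed
        case base
        then show ?case using * m0 by simp
        case (step y)
        then show ?case using * by blast
      qed
      then have disj: "m \<notin> S" if "m \<in> K" for m using that K_orbit[OF m0(1)] by blast
      let ?S = "S \<union> K" and ?r = "inv u \<circ> r"
      have \<phi>: "\<phi> (S, r) = (?S, ?r)" using False by (simp add: \<phi>_def)
      have rk': "?r permutes {..<k}" by (rule permutes_compose[OF rk permutes_inv[OF uk]])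
      have "?r permutes {..<k} - S"
        by (rule permutes_compose[OF r], rule permutes_subset[OF permutes_inv[OF u]]) (use Kk disj in auto)
      then have r': "?r permutes {..<k} - ?S"
      proof (rule permutes_superset)
        fix m assume "m \<in> {..<k} - S - ({..<k} - ?S)"
        then have m: "m \<in> K" by auto
        then have "m \<noteq> 0" using zK by (cases "m = 0") auto
        then show "?r m = m" using rv[OF disj[OF m]] uv[OF m] by simp
      qed
      have ri: "inv ?r = inv r \<circ> u"
        using permutes_inv_comp[OF permutes_inv[OF uk] rk] by (simp add: permutes_inv_inv[OF uk])
      have "(inv ?r \<circ> v) m = m" if "m \<notin> insert 0 ?S" for m
        using that vK'[of m] sfix[of m] by (simp add: ri u_def)
      then have "inv ?r \<circ> v permutes insert 0 ?S"
        by (intro permutes_superset[OF permutes_compose[OF v permutes_inv[OF rk']]]) auto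
      moreover have "K \<subseteq> {1..<k}"
      proof
        fix m assume "m \<in> K"
        then show "m \<in> {1..<k}" using zK Kk by (cases m) auto
      qed
      ultimately have "\<phi> (S, r) \<in> D" unfolding \<phi> D_def using S r' by simp
      moreover have "\<phi> (?S, ?r) = (?S - K, u \<circ> ?r)" by (simp add: \<phi>_def)
      then have "\<phi> (\<phi> (S, r)) = (S, r)" unfolding \<phi>
        using disj permutes_inv_comp_cancel(4)[OF u, of r] by auto
      moreover have "W (\<phi> (S, r)) = - W (S, r)"
      proof -
        have "sign ?r = sign u * sign r"
          using sign_comp_permutes[OF _ permutes_inv[OF uk] rk] sign_inv_permutes[OF finK u] by simp
        then have "W (\<phi> (S, r)) = (-1) ^ card ?S * ((-1) ^ (card K + 1) * (of_int (sign r) * of_int (sign v)))"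
          unfolding \<phi> W_def by (simp add: signs[OF rk'] su)
        also have "card ?S = card S + card K" using disj fS finK by (intro card_Un_disjoint) auto
        also have "(-1) ^ (card S + card K) * ((-1) ^ (card K + 1) * (of_int (sign r) * of_int (sign v))) =
            - ((-1) ^ card S * (of_int (sign r) * of_int (sign v)) :: complex)"
          by (simp add: power_add minus_one_power_iff)
        finally show ?thesis unfolding W_def by (simp add: signs[OF rk])
      qed
      ultimately show ?thesis by simp
    qed
  qed
  have "sum W D = sum (\<lambda>z. - W z) D"
    by (rule sum.reindex_bij_witness[of _ \<phi> \<phi>]) (use step in auto)
  then have "sum W D = 0" by (simp add: sum_negf)
  then show ?thesis unfolding Q .
qed

lemma sum_Pow_card:
  assumes "finite A"
  shows "(\<Sum>S\<in>Pow A. f (card S)) = (\<Sum>a\<le>card A. of_nat (card A choose a) * f a :: complex)"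
proof -
  have "(\<Sum>S\<in>Pow A. f (card S)) = (\<Sum>a\<le>card A. \<Sum>S | S \<in> Pow A \<and> card S = a. f (card S))"
    by (rule sum.group[symmetric]) (use assms in \<open>auto intro: card_mono\<close>)
  also have "\<dots> = (\<Sum>a\<le>card A. of_nat (card A choose a) * f a)"
    using n_subsets[OF assms] by (intro sum.cong refl) simp
  finally show ?thesis .
qed

text \<open>
  The alternating sum of hook symmetrizers is a multiple of the indicator of the long cycles (an
  instance of the Murnaghan-Nakayama rule); evaluating at the constant function 1 identifies the multiple.
\<close>

lemma class_function_at_long_cycle:
  assumes k: "k \<ge> 1" and F: "class_function k F" and v: "v permutes {..<k}" "orbit v 0 = {..<k}"
  shows "fact k * F v = (\<Sum>S\<in>Pow {1..<k}. (-1) ^ card S * convolution k F (young_symmetrizer k (hook S)) id)"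
proof -
  let ?P = "{h. h permutes {..<k}}"
  define L where "L = {w. w permutes {..<k} \<and> orbit w 0 = {..<k}}"
  define Q where "Q w = (\<Sum>S\<in>Pow {1..<k}. (-1) ^ card S * young_symmetrizer k (hook S) w)" for w
  have expand: "(\<Sum>S\<in>Pow {1..<k}. (-1) ^ card S * convolution k G (young_symmetrizer k (hook S)) id) = G v * sum Q L"
    if G: "class_function k G" for G
  proof -
    have "(\<Sum>S\<in>Pow {1..<k}. (-1) ^ card S * convolution k G (young_symmetrizer k (hook S)) id) =
        (\<Sum>S\<in>Pow {1..<k}. \<Sum>h\<in>?P. G (inv h) * ((-1) ^ card S * young_symmetrizer k (hook S) h))"
      unfolding convolution_at_id sum_distrib_left by (simp add: mult_ac)
    also have "\<dots> = (\<Sum>h\<in>?P. G (inv h) * Q h)"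
      by (subst sum.swap) (simp add: Q_def sum_distrib_left)
    also have "\<dots> = (\<Sum>h\<in>L. G (inv h) * Q h)"
    proof (rule sum.mono_neutral_right)
      show "\<forall>h\<in>?P - L. G (inv h) * Q h = 0"
      proof
        fix h assume "h \<in> ?P - L"
        then have "Q h = 0" unfolding Q_def L_def by (intro alternating_hook_sum_eq_0[OF k]) simp_all
        then show "G (inv h) * Q h = 0" by simp
      qed
    qed (auto simp: L_def finite_permutations)
    also have "\<dots> = (\<Sum>h\<in>L. G v * Q h)"
    proof (rule sum.cong[OF refl])
      fix h assume "h \<in> L"
      then have h: "h permutes {..<k}" "orbit h 0 = {..<k}" by (auto simp: L_def)
      \<comment> \<open>The inverse of a long cycle is again one, hence conjugate to
        \<open>v\<close>, and \<open>G\<close> takes the same value on both.\<close>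
      have o: "orbit (inv h) 0 = {..<k}"
        using orbit_inv_eq[OF permutes_imp_permutation[OF _ h(1)], of 0] h(2) by simp
      have "card (orbit v 0) = card (orbit (inv h) 0)" unfolding v o ..
      from single_cycle_conj[OF _ v(1) permutes_inv[OF h(1)] _ _ this] k v o
      obtain c where c: "c permutes {..<k}" "inv h = c \<circ> v \<circ> inv c" by auto
      have "G (inv h) = G v" unfolding c(2) using G c(1) v(1) unfolding class_function_def by blast
      then show "G (inv h) * Q h = G v * Q h" by simp
    qed
    finally show ?thesis by (simp add: sum_distrib_left)
  qed
  \<comment> \<open>At x = 1 the factor of index card S - 1 vanishes unless \<open>S\<close> is
    empty, and the empty leg contributes k!.\<close>
  have "sum Q L = (\<Sum>S\<in>Pow {1..<k}. (-1) ^ card S * convolution k (cyc_weight k 1) (young_symmetrizer k (hook S)) id)"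
    unfolding expand[OF class_function_cyc_weight] by (simp add: cyc_weight_def)
  also have "\<dots> = (\<Sum>S\<in>Pow {1..<k}. (-1) ^ card S * (\<Prod>i<k. 1 + 1 * (of_nat i - of_nat (card S))))"
    using cyc_weight_hook[OF _ k] by (intro sum.cong refl) auto
  also have "\<dots> = (\<Sum>S\<in>{{} :: nat set}. (-1) ^ card S * (\<Prod>i<k. 1 + 1 * (of_nat i - of_nat (card S))))"
  proof (rule sum.mono_neutral_right)
    show "\<forall>S\<in>Pow {1..<k} - {{}}. (-1) ^ card S * (\<Prod>i<k. 1 + 1 * (of_nat i - of_nat (card S))) = (0 :: complex)"
    proof
      fix S assume S: "S \<in> Pow {1..<k} - {{}}"
      then have fS: "finite S" "S \<noteq> {}" "S \<subseteq> {1..<k}" using finite_subset by auto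
      then have "card S \<le> card {1..<k}" "card S > 0" by (auto intro: card_mono simp: card_gt_0_iff simp del: card_atLeastLessThan)
      then have "card S - 1 \<in> {..<k}" "of_nat (card S - 1) = (of_nat (card S) - 1 :: complex)"
        using k by (auto simp: of_nat_diff)
      then have "(\<Prod>i<k. 1 + 1 * (of_nat i - of_nat (card S))) = (0 :: complex)"
        by (intro prod_zero bexI[of _ "card S - 1"]) auto
      then show "(-1) ^ card S * (\<Prod>i<k. 1 + 1 * (of_nat i - of_nat (card S))) = (0 :: complex)" by simp
    qed
  qed auto
  also have "\<dots> = fact k" by (simp add: fact_prod_Suc atLeast0LessThan)
  finally have "sum Q L = fact k" .
  then show ?thesis unfolding expand[OF F] by simp
qed

text \<open>Since the sign of a permutation is (-1)^(k + number of cycles), this is (-1)^k times the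
  sum of p^(cycles of the first factor) (-q)^(cycles of the second) over all factorizations of
  \<open>v\<close>.\<close>

definition factorization_poly :: "nat \<Rightarrow> (nat \<Rightarrow> nat) \<Rightarrow> complex \<Rightarrow> complex \<Rightarrow> complex" where
  "factorization_poly k v p q = convolution k (cyc_weight k p) (signed_cyc_weight k q) v"

text \<open>Multiplicativity on hooks pairs the factors p + c and q - c over the contents c; the
  binomial coefficient counts the sets \<open>S\<close> of size \<open>a\<close>.\<close>

lemma factorization_poly_long_cycle:
  assumes k: "k \<ge> 1" and v: "v permutes {..<k}" "orbit v 0 = {..<k}"
  shows "fact k * factorization_poly k v p q =
    (\<Sum>a\<le>k - 1. (-1) ^ a * of_nat ((k - 1) choose a) *
      (\<Prod>i<k. (p + of_nat i - of_nat a) * (q - of_nat i + of_nat a)))"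
proof -
  let ?g = "\<lambda>a. \<Prod>i<k. (p + of_nat i - of_nat a) * (q - of_nat i + of_nat a)"
  have "fact k * factorization_poly k v p q =
      (\<Sum>S\<in>Pow {1..<k}. (-1) ^ card S * ?g (card S))"
    unfolding factorization_poly_def
      class_function_at_long_cycle[OF k class_function_convolution[OF class_function_cyc_weight class_function_signed_cyc_weight] v]
  proof (rule sum.cong[OF refl])
    fix S assume "S \<in> Pow {1..<k}"
    then have S: "S \<subseteq> {1..<k}" by simp
    interpret young k "hook S" by (rule young_hook[OF S k])
    have "convolution k (convolution k (cyc_weight k p) (signed_cyc_weight k q)) Y id =
        (\<Prod>i<k. p + 1 * (of_nat i - of_nat (card S))) * (\<Prod>i<k. q + (- 1) * (of_nat i - of_nat (card S)))"
      unfolding class_function_Y_mult[OF class_function_cyc_weight class_function_signed_cyc_weight]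
        cyc_weight_hook[OF S k] signed_cyc_weight_hook[OF S k] ..
    also have "\<dots> = ?g (card S)" unfolding prod.distrib[symmetric] by (simp add: algebra_simps)
    finally show "(-1) ^ card S * convolution k (convolution k (cyc_weight k p) (signed_cyc_weight k q)) Y id = (-1) ^ card S * ?g (card S)"
      by simp
  qed
  also have "\<dots> = (\<Sum>a\<le>k - 1. of_nat ((k - 1) choose a) * ((-1) ^ a * ?g a))"
    using sum_Pow_card[of "{1..<k}" "\<lambda>a. (-1) ^ a * ?g a"] by simp
  finally show ?thesis by (simp add: mult_ac)
qed

section \<open>Characters of rectangles\<close>

definition compat :: "nat \<Rightarrow> (nat \<Rightarrow> nat \<times> nat) \<Rightarrow> (nat \<Rightarrow> nat) \<Rightarrow> (nat \<Rightarrow> nat) \<Rightarrow> bool" where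
  "compat k f \<sigma> \<tau> \<longleftrightarrow> (\<forall>m<k. fst (f (\<sigma> m)) = fst (f m)) \<and> (\<forall>m<k. snd (f (\<tau> m)) = snd (f m))"

text \<open>For an injective placement this is a coefficient of a Young symmetrizer; the formula
  still makes sense when cells are repeated.\<close>

definition signed_count :: "nat \<Rightarrow> (nat \<Rightarrow> nat) \<Rightarrow> (nat \<Rightarrow> nat \<times> nat) \<Rightarrow> complex" where
  "signed_count k v f =
     (\<Sum>\<sigma> | \<sigma> permutes {..<k}. if compat k f \<sigma> (inv \<sigma> \<circ> v) then of_int (sign (inv \<sigma> \<circ> v)) else 0)"

lemma signed_count_cong:
  assumes v: "v permutes {..<k}" and eq: "\<And>m. m < k \<Longrightarrow> f m = g m"
  shows "signed_count k v f = signed_count k v g"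
  unfolding signed_count_def
proof (rule sum.cong[OF refl])
  fix \<sigma> assume "\<sigma> \<in> {\<sigma>. \<sigma> permutes {..<k}}"
  then have s: "\<sigma> permutes {..<k}" by simp
  have "\<sigma> m < k" "(inv \<sigma> \<circ> v) m < k" if "m < k" for m
    using that permutes_in_image[OF s, of m] permutes_in_image[OF permutes_compose[OF v permutes_inv[OF s]], of m] by simp_all
  then have "compat k f \<sigma> (inv \<sigma> \<circ> v) \<longleftrightarrow> compat k g \<sigma> (inv \<sigma> \<circ> v)"
    unfolding compat_def using eq by simp
  then show "(if compat k f \<sigma> (inv \<sigma> \<circ> v) then of_int (sign (inv \<sigma> \<circ> v)) else 0 :: complex) =
    (if compat k g \<sigma> (inv \<sigma> \<circ> v) then of_int (sign (inv \<sigma> \<circ> v)) else 0)" by simp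
qed

text \<open>Composing \<open>\<sigma>\<close> with the transposition of two labels in one cell keeps
  compatibility and flips the sign of the other factor.\<close>

lemma signed_count_not_inj:
  assumes v: "v permutes {..<k}" and ab: "a < k" "b < k" "a \<noteq> b" "f a = f b"
  shows "signed_count k v f = 0"
proof -
  let ?t = "transpose a b"
  have t: "?t permutes {..<k}" using ab by (intro permutes_swap_id) auto
  have ft: "f (?t m) = f m" for m using ab(4) by (cases "m = a"; cases "m = b") auto
  have tt: "?t (?t m) = m" for m by simp
  have tk: "?t m < k \<longleftrightarrow> m < k" for m using permutes_in_image[OF t, of m] by simp
  have "signed_count k v f = (\<Sum>\<sigma> | \<sigma> permutes {..<k}. if compat k f (\<sigma> \<circ> ?t) (inv (\<sigma> \<circ> ?t) \<circ> v) then of_int (sign (inv (\<sigma> \<circ> ?t) \<circ> v)) else 0)"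
    unfolding signed_count_def by (rule sum_permutations_compose_right[OF t])
  also have "\<dots> = (\<Sum>\<sigma> | \<sigma> permutes {..<k}. - (if compat k f \<sigma> (inv \<sigma> \<circ> v) then of_int (sign (inv \<sigma> \<circ> v)) else 0))"
  proof (rule sum.cong[OF refl])
    fix \<sigma> assume "\<sigma> \<in> {\<sigma>. \<sigma> permutes {..<k}}"
    then have s: "\<sigma> permutes {..<k}" by simp
    have i: "inv (\<sigma> \<circ> ?t) \<circ> v = ?t \<circ> (inv \<sigma> \<circ> v)"
      by (simp add: permutes_inv_comp[OF s t] o_assoc)
    have "(\<forall>m<k. fst (f (\<sigma> (?t m))) = fst (f m)) \<longleftrightarrow> (\<forall>m<k. fst (f (\<sigma> m)) = fst (f m))"
    proof
      assume L: "\<forall>m<k. fst (f (\<sigma> (?t m))) = fst (f m)"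
      show "\<forall>m<k. fst (f (\<sigma> m)) = fst (f m)"
      proof (intro allI impI)
        fix m assume "m < k"
        then have "fst (f (\<sigma> (?t (?t m)))) = fst (f (?t m))" using L tk[of m] by blast
        then show "fst (f (\<sigma> m)) = fst (f m)" by (simp add: ft)
      qed
    next
      assume L: "\<forall>m<k. fst (f (\<sigma> m)) = fst (f m)"
      show "\<forall>m<k. fst (f (\<sigma> (?t m))) = fst (f m)"
      proof (intro allI impI)
        fix m assume "m < k"
        then have "fst (f (\<sigma> (?t m))) = fst (f (?t m))" using L tk[of m] by blast
        then show "fst (f (\<sigma> (?t m))) = fst (f m)" by (simp add: ft)
      qed
    qed
    then have c: "compat k f (\<sigma> \<circ> ?t) (inv (\<sigma> \<circ> ?t) \<circ> v) \<longleftrightarrow> compat k f \<sigma> (inv \<sigma> \<circ> v)"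
      unfolding compat_def i by (simp add: ft)
    have "sign (?t \<circ> (inv \<sigma> \<circ> v)) = sign ?t * sign (inv \<sigma> \<circ> v)"
      by (rule sign_comp_permutes[OF _ t permutes_compose[OF v permutes_inv[OF s]]]) simp
    then have "sign (inv (\<sigma> \<circ> ?t) \<circ> v) = - sign (inv \<sigma> \<circ> v)"
      unfolding i using ab(3) by (simp add: sign_swap_id)
    then show "(if compat k f (\<sigma> \<circ> ?t) (inv (\<sigma> \<circ> ?t) \<circ> v) then of_int (sign (inv (\<sigma> \<circ> ?t) \<circ> v)) else 0 :: complex) =
      - (if compat k f \<sigma> (inv \<sigma> \<circ> v) then of_int (sign (inv \<sigma> \<circ> v)) else 0)"
      unfolding c by simp
  qed
  also have "\<dots> = - signed_count k v f" by (simp add: signed_count_def sum_negf)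
  finally show ?thesis by simp
qed

text \<open>In a rectangle rows and columns are chosen independently: a compatible placement is a
  row colouring invariant under \<open>\<sigma>\<close> together with a column colouring invariant
  under \<open>\<tau>\<close>.\<close>

lemma card_compat:
  assumes "\<sigma> permutes {..<k}" "\<tau> permutes {..<k}"
  shows "card {f \<in> {..<k} \<rightarrow>\<^sub>E {..<p} \<times> {..<q}. compat k f \<sigma> \<tau>} = p ^ ncyc {..<k} \<sigma> * q ^ ncyc {..<k} \<tau>"
proof -
  let ?I = "invariant_colourings {..<k} \<sigma> {..<p}" and ?J = "invariant_colourings {..<k} \<tau> {..<q}"
  have lt: "\<sigma> m < k" "\<tau> m < k" if "m < k" for m
    using that permutes_in_image[OF assms(1), of m] permutes_in_image[OF assms(2), of m] by simp_all
  have "bij_betw (\<lambda>f. (\<lambda>m\<in>{..<k}. fst (f m), \<lambda>m\<in>{..<k}. snd (f m)))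
      {f \<in> {..<k} \<rightarrow>\<^sub>E {..<p} \<times> {..<q}. compat k f \<sigma> \<tau>} (?I \<times> ?J)"
  proof (rule bij_betwI[where g = "\<lambda>(x, y). \<lambda>m\<in>{..<k}. (x m, y m)"])
    show "(\<lambda>f. (\<lambda>m\<in>{..<k}. fst (f m), \<lambda>m\<in>{..<k}. snd (f m))) \<in> {f \<in> {..<k} \<rightarrow>\<^sub>E {..<p} \<times> {..<q}. compat k f \<sigma> \<tau>} \<rightarrow> ?I \<times> ?J"
    proof
      fix f assume f: "f \<in> {f \<in> {..<k} \<rightarrow>\<^sub>E {..<p} \<times> {..<q}. compat k f \<sigma> \<tau>}"
      then have "f m \<in> {..<p} \<times> {..<q}" if "m < k" for m using that by (auto simp: PiE_iff)
      then have "fst (f m) < p" "snd (f m) < q" if "m < k" for m using that by (simp_all add: mem_Times_iff)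
      moreover have "compat k f \<sigma> \<tau>" using f by simp
      ultimately show "(\<lambda>m\<in>{..<k}. fst (f m), \<lambda>m\<in>{..<k}. snd (f m)) \<in> ?I \<times> ?J"
        using lt by (simp add: invariant_colourings_def compat_def)
    qed
    show "(\<lambda>(x, y). \<lambda>m\<in>{..<k}. (x m, y m)) \<in> ?I \<times> ?J \<rightarrow> {f \<in> {..<k} \<rightarrow>\<^sub>E {..<p} \<times> {..<q}. compat k f \<sigma> \<tau>}"
    proof
      fix z assume "z \<in> ?I \<times> ?J"
      then obtain x y where z: "z = (x, y)" "x \<in> ?I" "y \<in> ?J" by auto
      then have "x m < p" "y m < q" if "m < k" for m using that by (auto simp: invariant_colourings_def PiE_iff)
      moreover have "x (\<sigma> m) = x m" "y (\<tau> m) = y m" if "m < k" for m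
        using that z by (auto simp: invariant_colourings_def)
      ultimately show "(case z of (x, y) \<Rightarrow> \<lambda>m\<in>{..<k}. (x m, y m)) \<in> {f \<in> {..<k} \<rightarrow>\<^sub>E {..<p} \<times> {..<q}. compat k f \<sigma> \<tau>}"
        using lt by (simp add: z(1) compat_def)
    qed
    fix f assume f: "f \<in> {f \<in> {..<k} \<rightarrow>\<^sub>E {..<p} \<times> {..<q}. compat k f \<sigma> \<tau>}"
    show "(case (\<lambda>m\<in>{..<k}. fst (f m), \<lambda>m\<in>{..<k}. snd (f m)) of (x, y) \<Rightarrow> \<lambda>m\<in>{..<k}. (x m, y m)) = f"
      by (rule extensionalityI[of _ "{..<k}"]) (use f in \<open>simp_all add: PiE_iff\<close>)
  next
    fix z assume "z \<in> ?I \<times> ?J"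
    then obtain x y where z: "z = (x, y)" "x \<in> ?I" "y \<in> ?J" by auto
    have "(\<lambda>m\<in>{..<k}. fst ((\<lambda>m\<in>{..<k}. (x m, y m)) m)) = x"
      by (rule extensionalityI[of _ "{..<k}"]) (use z in \<open>simp_all add: invariant_colourings_def PiE_iff\<close>)
    moreover have "(\<lambda>m\<in>{..<k}. snd ((\<lambda>m\<in>{..<k}. (x m, y m)) m)) = y"
      by (rule extensionalityI[of _ "{..<k}"]) (use z in \<open>simp_all add: invariant_colourings_def PiE_iff\<close>)
    ultimately show "((\<lambda>m\<in>{..<k}. fst ((case z of (x, y) \<Rightarrow> \<lambda>m\<in>{..<k}. (x m, y m)) m)),
      (\<lambda>m\<in>{..<k}. snd ((case z of (x, y) \<Rightarrow> \<lambda>m\<in>{..<k}. (x m, y m)) m))) = z" unfolding z(1) by simp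
  qed
  then have "card {f \<in> {..<k} \<rightarrow>\<^sub>E {..<p} \<times> {..<q}. compat k f \<sigma> \<tau>} = card (?I \<times> ?J)"
    by (rule bij_betw_same_card)
  then show ?thesis using assms by (simp add: card_cartesian_product card_invariant_colourings)
qed

text \<open>Non-injective placements contribute 0, so the sum may run over all placements, where the
  count factors.\<close>

lemma sum_signed_count:
  assumes v: "v permutes {..<k}"
  shows "(\<Sum>f | f \<in> {..<k} \<rightarrow>\<^sub>E {..<p} \<times> {..<q} \<and> inj_on f {..<k}. signed_count k v f) =
    factorization_poly k v (of_nat p) (of_nat q)"
proof -
  let ?E = "{..<k} \<rightarrow>\<^sub>E {..<p} \<times> {..<q}"
  have fin: "finite ?E" by (intro finite_PiE) auto
  have "(\<Sum>f | f \<in> ?E \<and> inj_on f {..<k}. signed_count k v f) = (\<Sum>f\<in>?E. signed_count k v f)"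
  proof (rule sum.mono_neutral_left[OF fin])
    show "\<forall>f\<in>?E - {f. f \<in> ?E \<and> inj_on f {..<k}}. signed_count k v f = 0"
    proof
      fix f assume "f \<in> ?E - {f. f \<in> ?E \<and> inj_on f {..<k}}"
      then have "\<not> inj_on f {..<k}" by simp
      then obtain a b where "a < k" "b < k" "a \<noteq> b" "f a = f b" unfolding inj_on_def by auto
      then show "signed_count k v f = 0" by (rule signed_count_not_inj[OF v])
    qed
  qed auto
  also have "\<dots> = (\<Sum>\<sigma> | \<sigma> permutes {..<k}. \<Sum>f\<in>?E. if compat k f \<sigma> (inv \<sigma> \<circ> v) then of_int (sign (inv \<sigma> \<circ> v)) else 0)"
    unfolding signed_count_def by (rule sum.swap)
  also have "\<dots> = (\<Sum>\<sigma> | \<sigma> permutes {..<k}. cyc_weight k (of_nat p) \<sigma> * signed_cyc_weight k (of_nat q) (inv \<sigma> \<circ> v))"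
  proof (rule sum.cong[OF refl])
    fix \<sigma> assume "\<sigma> \<in> {\<sigma>. \<sigma> permutes {..<k}}"
    then have s: "\<sigma> permutes {..<k}" by simp
    let ?t = "inv \<sigma> \<circ> v"
    have t: "?t permutes {..<k}" by (rule permutes_compose[OF v permutes_inv[OF s]])
    have "(\<Sum>f\<in>?E. if compat k f \<sigma> ?t then of_int (sign ?t) else 0 :: complex) =
        (\<Sum>f | f \<in> ?E \<and> compat k f \<sigma> ?t. of_int (sign ?t))"
      by (simp only: sum.inter_filter[OF fin])
    also have "\<dots> = of_nat (p ^ ncyc {..<k} \<sigma> * q ^ ncyc {..<k} ?t) * of_int (sign ?t)"
      unfolding card_compat[OF s t, symmetric] by simp
    finally show "(\<Sum>f\<in>?E. if compat k f \<sigma> ?t then of_int (sign ?t) else 0) =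
        cyc_weight k (of_nat p) \<sigma> * signed_cyc_weight k (of_nat q) ?t"
      by (simp add: cyc_weight_def signed_cyc_weight_def mult_ac)
  qed
  finally show ?thesis by (simp add: factorization_poly_def convolution_def)
qed

text \<open>A pair of a row and a column permutation of a tableau is supported on the support of its product.\<close>

lemma young_sum_conj:
  assumes T: "inj_on T {..<n}" and v: "v permutes {..<k}" and k: "k \<le> n" and g: "g permutes {..<n}"
  shows "young_symmetrizer n T (inv g \<circ> v \<circ> g) = signed_count k v (T \<circ> inv g)"
proof -
  let ?P = "{h. h permutes {..<n}}"
  let ?t = "T \<circ> inv g"
  have sub: "h permutes {..<n}" if "h permutes {..<k}" for h
    using that by (rule permutes_subset) (use k in auto)
  have vn: "v permutes {..<n}" using v by (rule sub)
  have gi: "inv (inv g) = g" using g by (rule permutes_inv_inv)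
  have gn: "g m < n \<longleftrightarrow> m < n" "inv g m < n \<longleftrightarrow> m < n" for m
    using permutes_in_image[OF g, of m] permutes_in_image[OF permutes_inv[OF g], of m] by simp_all
  have tinj: "inj_on ?t {..<n}"
  proof (rule inj_onI)
    fix a b assume ab: "a \<in> {..<n}" "b \<in> {..<n}" "?t a = ?t b"
    then have "inv g a = inv g b" using T gn by (auto simp: inj_on_def)
    then show "a = b" by (metis g permutes_inverses(1))
  qed
  have conj: "(\<forall>m<n. F (T ((inv g \<circ> h \<circ> g) m)) = F (T m)) \<longleftrightarrow> (\<forall>m<n. F (?t (h m)) = F (?t m))"
    for h and F :: "nat \<times> nat \<Rightarrow> nat"
  proof
    assume L: "\<forall>m<n. F (T ((inv g \<circ> h \<circ> g) m)) = F (T m)"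
    show "\<forall>m<n. F (?t (h m)) = F (?t m)"
    proof (intro allI impI)
      fix m assume "m < n"
      then have "F (T ((inv g \<circ> h \<circ> g) (inv g m))) = F (T (inv g m))" using L gn by blast
      then show "F (?t (h m)) = F (?t m)" by (simp add: permutes_inverses[OF g])
    qed
  next
    assume L: "\<forall>m<n. F (?t (h m)) = F (?t m)"
    show "\<forall>m<n. F (T ((inv g \<circ> h \<circ> g) m)) = F (T m)"
    proof (intro allI impI)
      fix m assume "m < n"
      then have "F (?t (h (g m))) = F (?t (g m))" using L gn by blast
      then show "F (T ((inv g \<circ> h \<circ> g) m)) = F (T m)" by (simp add: permutes_inverses[OF g])
    qed
  qed
  let ?w = "\<lambda>\<sigma>. if compat n ?t \<sigma> (inv \<sigma> \<circ> v) then of_int (sign (inv \<sigma> \<circ> v)) else 0 :: complex"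
  have "young_symmetrizer n T (inv g \<circ> v \<circ> g) =
      (\<Sum>\<sigma>\<in>?P. row_symmetrizer n T (inv g \<circ> \<sigma> \<circ> inv (inv g)) *
        column_antisymmetrizer n T (inv (inv g \<circ> \<sigma> \<circ> inv (inv g)) \<circ> (inv g \<circ> v \<circ> g)))"
    unfolding young_symmetrizer_def convolution_def by (rule sum_permutations_conj[OF permutes_inv[OF g]])
  also have "\<dots> = (\<Sum>\<sigma>\<in>?P. ?w \<sigma>)"
  proof (rule sum.cong[OF refl])
    fix \<sigma> assume "\<sigma> \<in> ?P"
    then have s: "\<sigma> permutes {..<n}" by simp
    have "inv (inv g \<circ> \<sigma> \<circ> g) = inv g \<circ> inv \<sigma> \<circ> g"
      using permutes_inv_comp[OF permutes_compose[OF s permutes_inv[OF g]] g] permutes_inv_comp[OF permutes_inv[OF g] s]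
      by (simp add: gi o_assoc)
    then have i: "inv (inv g \<circ> \<sigma> \<circ> g) \<circ> (inv g \<circ> v \<circ> g) = inv g \<circ> (inv \<sigma> \<circ> v) \<circ> g"
      by (simp add: fun_eq_iff permutes_inverses[OF g])
    have p1: "inv g \<circ> h \<circ> g permutes {..<n}" if "h permutes {..<n}" for h
      by (rule permutes_compose[OF g permutes_compose[OF that permutes_inv[OF g]]])
    have sv: "inv \<sigma> \<circ> v permutes {..<n}" by (rule permutes_compose[OF vn permutes_inv[OF s]])
    have "sign (inv g \<circ> (inv \<sigma> \<circ> v) \<circ> g) = sign (inv g) * sign (inv \<sigma> \<circ> v) * sign g"
      using sign_comp_permutes[OF _ permutes_compose[OF sv permutes_inv[OF g]] g]
        sign_comp_permutes[OF _ permutes_inv[OF g] sv] by simp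
    then have sg: "sign (inv g \<circ> (inv \<sigma> \<circ> v) \<circ> g) = sign (inv \<sigma> \<circ> v)"
      using sign_inv_permutes[OF _ g] by simp
    have "inv g \<circ> \<sigma> \<circ> g \<in> row_stabilizer n T \<longleftrightarrow> (\<forall>m<n. fst (?t (\<sigma> m)) = fst (?t m))"
      unfolding row_stabilizer_def using p1[OF s] conj[of fst \<sigma>] by blast
    moreover have "inv g \<circ> (inv \<sigma> \<circ> v) \<circ> g \<in> column_stabilizer n T \<longleftrightarrow> (\<forall>m<n. snd (?t ((inv \<sigma> \<circ> v) m)) = snd (?t m))"
      unfolding column_stabilizer_def using p1[OF sv] conj[of snd "inv \<sigma> \<circ> v"] by blast
    ultimately show "row_symmetrizer n T (inv g \<circ> \<sigma> \<circ> inv (inv g)) *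
        column_antisymmetrizer n T (inv (inv g \<circ> \<sigma> \<circ> inv (inv g)) \<circ> (inv g \<circ> v \<circ> g)) = ?w \<sigma>"
      unfolding gi i row_symmetrizer_def column_antisymmetrizer_def compat_def sg by simp
  qed
  also have "\<dots> = (\<Sum>\<sigma> | \<sigma> permutes {..<k}. ?w \<sigma>)"
  proof (rule sum.mono_neutral_right)
    show "\<forall>\<sigma>\<in>?P - {\<sigma>. \<sigma> permutes {..<k}}. ?w \<sigma> = 0"
    proof
      fix \<sigma> assume "\<sigma> \<in> ?P - {\<sigma>. \<sigma> permutes {..<k}}"
      then have s: "\<sigma> permutes {..<n}" and ns: "\<not> \<sigma> permutes {..<k}" by auto
      have "\<not> compat n ?t \<sigma> (inv \<sigma> \<circ> v)"
      proof
        assume c: "compat n ?t \<sigma> (inv \<sigma> \<circ> v)"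
        \<comment> \<open>As \<open>v\<close> fixes \<open>m\<close>, the label
          \<open>inv \<sigma> m\<close> lies both in the column and in the row of \<open>m\<close>,
          hence in its cell.\<close>
        have "\<sigma> m = m" if m: "m \<in> {..<n} - {..<k}" for m
        proof -
          have mn: "m < n" "v m = m" using m permutes_not_in[OF v, of m] by auto
          have im: "inv \<sigma> m < n" using permutes_in_image[OF permutes_inv[OF s], of m] mn by simp
          have "snd (?t ((inv \<sigma> \<circ> v) m)) = snd (?t m)" using c mn unfolding compat_def by blast
          then have "snd (?t (inv \<sigma> m)) = snd (?t m)" using mn by simp
          moreover have "fst (?t (\<sigma> (inv \<sigma> m))) = fst (?t (inv \<sigma> m))" using c im unfolding compat_def by blast
          then have "fst (?t (inv \<sigma> m)) = fst (?t m)" by (simp add: permutes_inverses[OF s])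
          ultimately have "?t (inv \<sigma> m) = ?t m" by (simp add: prod_eq_iff)
          then have "inv \<sigma> m = m" using inj_onD[OF tinj, of "inv \<sigma> m" m] im mn by simp
          then show "\<sigma> m = m" using permutes_inverses(1)[OF s, of m] by simp
        qed
        then have "\<sigma> permutes {..<k}" by (rule permutes_superset[OF s])
        then show False using ns by simp
      qed
      then show "?w \<sigma> = 0" by simp
    qed
  qed (use sub in \<open>auto simp: finite_permutations\<close>)
  also have "\<dots> = signed_count k v ?t"
    unfolding signed_count_def
  proof (rule sum.cong[OF refl])
    fix \<sigma> assume "\<sigma> \<in> {\<sigma>. \<sigma> permutes {..<k}}"
    then have s: "\<sigma> permutes {..<k}" by simp
    have fix1: "\<sigma> m = m" "(inv \<sigma> \<circ> v) m = m" if "\<not> m < k" for m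
      using that permutes_not_in[OF s, of m] permutes_not_in[OF permutes_compose[OF v permutes_inv[OF s]], of m] by simp_all
    have all: "(\<forall>m<n. F (?t (h m)) = F (?t m)) \<longleftrightarrow> (\<forall>m<k. F (?t (h m)) = F (?t m))"
      if "\<And>m. \<not> m < k \<Longrightarrow> h m = m" for h and F :: "nat \<times> nat \<Rightarrow> nat"
    proof
      assume L: "\<forall>m<k. F (?t (h m)) = F (?t m)"
      show "\<forall>m<n. F (?t (h m)) = F (?t m)"
      proof (intro allI impI)
        fix m
        show "F (?t (h m)) = F (?t m)"
          by (cases "m < k") (use L that[of m] in simp_all)
      qed
    next
      assume L: "\<forall>m<n. F (?t (h m)) = F (?t m)"
      show "\<forall>m<k. F (?t (h m)) = F (?t m)"
      proof (intro allI impI)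
        fix m assume "m < k"
        then have "m < n" using k by simp
        then show "F (?t (h m)) = F (?t m)" using L by blast
      qed
    qed
    have "compat n ?t \<sigma> (inv \<sigma> \<circ> v) \<longleftrightarrow> compat k ?t \<sigma> (inv \<sigma> \<circ> v)"
      unfolding compat_def using all[of \<sigma> fst, OF fix1(1)] all[of "inv \<sigma> \<circ> v" snd, OF fix1(2)] by blast
    then show "?w \<sigma> = (if compat k ?t \<sigma> (inv \<sigma> \<circ> v) then of_int (sign (inv \<sigma> \<circ> v)) else 0)"
      by simp
  qed
  finally show ?thesis .
qed

lemma card_permutes_extending:
  assumes k: "k \<le> n" and inj: "inj_on f {..<k}" and ran: "f ` {..<k} \<subseteq> {..<n}"
  shows "card {g. g permutes {..<n} \<and> (\<forall>m<k. g m = f m)} = fact (n - k)"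
proof -
  have "card ({..<n} - f ` {..<k}) = card {k..<n}"
    by (simp only: card_Diff_subset[OF finite_imageI[OF finite_lessThan] ran] card_image[OF inj]
        card_lessThan card_atLeastLessThan)
  then obtain e where e: "bij_betw e {k..<n} ({..<n} - f ` {..<k})"
    using finite_same_card_bij[of "{k..<n}" "{..<n} - f ` {..<k}"] by auto
  define g0 where "g0 m = (if m < k then f m else if m < n then e m else m)" for m
  have g0k: "g0 m = f m" if "m < k" for m using that by (simp add: g0_def)
  have "bij_betw g0 {..<k} (f ` {..<k})"
    using inj_on_imp_bij_betw[OF inj] bij_betw_cong[of "{..<k}" g0 f] by (simp add: g0_def)
  moreover have "bij_betw g0 {k..<n} ({..<n} - f ` {..<k})"
    using e bij_betw_cong[of "{k..<n}" g0 e] by (simp add: g0_def)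
  ultimately have "bij_betw g0 ({..<k} \<union> {k..<n}) (f ` {..<k} \<union> ({..<n} - f ` {..<k}))"
    by (rule bij_betw_combine) auto
  moreover have "{..<k} \<union> {k..<n} = {..<n}" using k by auto
  moreover have "f ` {..<k} \<union> ({..<n} - f ` {..<k}) = {..<n}"
    using ran by (simp only: Un_Diff_cancel Un_absorb1)
  ultimately have "bij_betw g0 {..<n} {..<n}" by (simp only:)
  then have g0: "g0 permutes {..<n}" by (rule bij_imp_permutes) (use k in \<open>simp add: g0_def\<close>)
  have "bij_betw (\<lambda>h. g0 \<circ> h) {h. h permutes {k..<n}} {g. g permutes {..<n} \<and> (\<forall>m<k. g m = f m)}"
  proof (rule bij_betwI[where g = "\<lambda>g. inv g0 \<circ> g"])
    show "(\<lambda>h. g0 \<circ> h) \<in> {h. h permutes {k..<n}} \<rightarrow> {g. g permutes {..<n} \<and> (\<forall>m<k. g m = f m)}"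
    proof
      fix h assume "h \<in> {h. h permutes {k..<n}}"
      then have h: "h permutes {k..<n}" by simp
      have "h permutes {..<n}" using h by (rule permutes_subset) auto
      then have "g0 \<circ> h permutes {..<n}" using g0 by (rule permutes_compose)
      moreover have "(g0 \<circ> h) m = f m" if "m < k" for m
        using that permutes_not_in[OF h, of m] g0k[OF that] by simp
      ultimately show "g0 \<circ> h \<in> {g. g permutes {..<n} \<and> (\<forall>m<k. g m = f m)}" by simp
    qed
    show "(\<lambda>g. inv g0 \<circ> g) \<in> {g. g permutes {..<n} \<and> (\<forall>m<k. g m = f m)} \<rightarrow> {h. h permutes {k..<n}}"
    proof
      fix g assume "g \<in> {g. g permutes {..<n} \<and> (\<forall>m<k. g m = f m)}"
      then have g: "g permutes {..<n}" "\<And>m. m < k \<Longrightarrow> g m = f m" by auto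
      have "(inv g0 \<circ> g) m = m" if "m < k" for m
        using permutes_inverses(2)[OF g0, of m] g(2)[OF that] g0k[OF that] by simp
      then have "inv g0 \<circ> g permutes {k..<n}"
        by (intro permutes_superset[OF permutes_compose[OF g(1) permutes_inv[OF g0]]]) auto
      then show "inv g0 \<circ> g \<in> {h. h permutes {k..<n}}" by simp
    qed
  qed (simp_all only: permutes_inv_comp_cancel[OF g0])
  then have "card {g. g permutes {..<n} \<and> (\<forall>m<k. g m = f m)} = card {h. h permutes {k..<n}}"
    by (rule bij_betw_same_card[symmetric])
  also have "\<dots> = fact (n - k)" by (rule card_permutations) simp_all
  finally show ?thesis .
qed

text \<open>\<open>F\<close> sees only the first \<open>k\<close> labels, and each injective
  placement of these extends to (n - k)! fillings.\<close>

lemma sum_over_tableaux: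
  assumes T: "bij_betw T {..<n} A" and k: "k \<le> n"
    and cong: "\<And>f g. (\<And>m. m < k \<Longrightarrow> f m = g m) \<Longrightarrow> F f = (F g :: complex)"
  shows "(\<Sum>g | g permutes {..<n}. F (T \<circ> g)) =
    fact (n - k) * (\<Sum>f | f \<in> {..<k} \<rightarrow>\<^sub>E A \<and> inj_on f {..<k}. F f)"
proof -
  let ?P = "{g. g permutes {..<n}}" and ?I = "{f. f \<in> {..<k} \<rightarrow>\<^sub>E A \<and> inj_on f {..<k}}"
  let ?r = "\<lambda>g. restrict (T \<circ> g) {..<k}"
  have injT: "inj_on T {..<n}" and imT: "T ` {..<n} = A" using T by (auto simp: bij_betw_def)
  have finA: "finite A" unfolding imT[symmetric] by simp
  then have "finite ({..<k} \<rightarrow>\<^sub>E A)" by (intro finite_PiE) simp_all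
  then have finI: "finite ?I" by simp
  have rI: "?r ` ?P \<subseteq> ?I"
  proof
    fix f assume "f \<in> ?r ` ?P"
    then obtain g where g: "g permutes {..<n}" "f = ?r g" by auto
    have lt: "g m < n" if "m < k" for m using permutes_in_image[OF g(1), of m] that k by simp
    then have "T (g m) \<in> A" if "m < k" for m using that unfolding imT[symmetric] by simp
    then have "f \<in> {..<k} \<rightarrow>\<^sub>E A" using g(2) by simp
    moreover have "inj_on f {..<k}"
    proof (rule inj_onI)
      fix a b assume ab: "a \<in> {..<k}" "b \<in> {..<k}" "f a = f b"
      then have "T (g a) = T (g b)" using g(2) by simp
      then have "g a = g b" using inj_onD[OF injT, of "g a" "g b"] lt ab by simp
      then show "a = b" using permutes_inj[OF g(1)] by (simp add: inj_eq)
    qed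
    ultimately show "f \<in> ?I" by simp
  qed
  have "(\<Sum>g\<in>?P. F (T \<circ> g)) = (\<Sum>g\<in>?P. F (?r g))"
    by (rule sum.cong[OF refl], rule cong) simp
  also have "\<dots> = (\<Sum>f\<in>?I. \<Sum>g | g \<in> ?P \<and> ?r g = f. F (?r g))"
    by (rule sum.group[symmetric, OF _ finI rI]) (simp add: finite_permutations)
  also have "\<dots> = (\<Sum>f\<in>?I. fact (n - k) * F f)"
  proof (rule sum.cong[OF refl])
    fix f assume f: "f \<in> ?I"
    define f' where "f' m = inv_into {..<n} T (f m)" for m
    have fA: "f m \<in> T ` {..<n}" if "m < k" for m
    proof -
      have "f \<in> {..<k} \<rightarrow>\<^sub>E A" using f by simp
      then have "f m \<in> A" by (rule PiE_mem) (use that in simp)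
      then show ?thesis by (simp only: imT)
    qed
    have Tf': "T (f' m) = f m" "f' m < n" if "m < k" for m
      using f_inv_into_f[OF fA[OF that]] inv_into_into[OF fA[OF that]] by (simp_all add: f'_def)
    have inj: "inj_on f' {..<k}"
    proof (rule inj_onI)
      fix a b assume "a \<in> {..<k}" "b \<in> {..<k}" "f' a = f' b"
      then have "f a = f b" using Tf'(1)[of a] Tf'(1)[of b] by simp
      moreover have "inj_on f {..<k}" using f by simp
      ultimately show "a = b" using inj_onD \<open>a \<in> {..<k}\<close> \<open>b \<in> {..<k}\<close> by metis
    qed
    have "{g. g \<in> ?P \<and> ?r g = f} = {g. g permutes {..<n} \<and> (\<forall>m<k. g m = f' m)}"
    proof (intro set_eqI iffI)
      fix g assume "g \<in> {g. g \<in> ?P \<and> ?r g = f}"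
      then have g: "g permutes {..<n}" "f = ?r g" by auto
      have "g m = f' m" if "m < k" for m
      proof -
        have "T (g m) = T (f' m)" using Tf'(1)[OF that] that g(2) by simp
        then show ?thesis using inj_onD[OF injT, of "g m" "f' m"] Tf'(2)[OF that]
            permutes_in_image[OF g(1), of m] that k by simp
      qed
      then show "g \<in> {g. g permutes {..<n} \<and> (\<forall>m<k. g m = f' m)}" using g by simp
    next
      fix g assume "g \<in> {g. g permutes {..<n} \<and> (\<forall>m<k. g m = f' m)}"
      then have g: "g permutes {..<n}" "\<And>m. m < k \<Longrightarrow> g m = f' m" by auto
      have "?r g = f"
        by (rule extensionalityI[of _ "{..<k}"]) (use f g(2) Tf'(1) in \<open>simp_all add: PiE_iff\<close>)
      then show "g \<in> {g. g \<in> ?P \<and> ?r g = f}" using g by simp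
    qed
    note fibre = this
    have "f' ` {..<k} \<subseteq> {..<n}" using Tf'(2) by (simp add: image_subset_iff)
    then have c: "card {g. g \<in> ?P \<and> ?r g = f} = fact (n - k)"
      unfolding fibre by (rule card_permutes_extending[OF k inj])
    have "(\<Sum>g | g \<in> ?P \<and> ?r g = f. F (?r g)) = (\<Sum>g | g \<in> ?P \<and> ?r g = f. F f)"
    proof (rule sum.cong[OF refl])
      fix g assume "g \<in> {g. g \<in> ?P \<and> ?r g = f}"
      then have "?r g = f" by blast
      then show "F (?r g) = F f" by (simp only:)
    qed
    also have "\<dots> = fact (n - k) * F f" unfolding sum_constant c of_nat_fact ..
    finally show "(\<Sum>g | g \<in> ?P \<and> ?r g = f. F (?r g)) = fact (n - k) * F f" .
  qed
  finally show ?thesis unfolding sum_distrib_left .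
qed

section \<open>The standard k-cycle and permutations of its cycle type\<close>

definition long_cycle :: "nat \<Rightarrow> nat \<Rightarrow> nat" where
  "long_cycle k i = (if Suc i < k then Suc i else if Suc i = k then 0 else i)"

lemma long_cycle_permutes: "long_cycle k permutes {..<k}"
proof (rule inj_imp_permutes)
  show "inj_on (long_cycle k) {..<k}"
  proof (rule inj_onI)
    fix a b assume "a \<in> {..<k}" "b \<in> {..<k}" "long_cycle k a = long_cycle k b"
    then show "a = b" by (simp add: long_cycle_def split: if_splits)
  qed
qed (simp_all add: long_cycle_def)

lemma orbit_long_cycle:
  assumes "k \<ge> 1"
  shows "orbit (long_cycle k) 0 = {..<k}"
proof
  show "orbit (long_cycle k) 0 \<subseteq> {..<k}"
    using assms by (intro permutes_orbit_subset[OF long_cycle_permutes]) simp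
  have "i < k \<Longrightarrow> i \<in> orbit (long_cycle k) 0" for i
  proof (induction i)
    case 0
    show ?case
      using permutation_self_in_orbit[OF permutes_imp_permutation[OF _ long_cycle_permutes]] by simp
  next
    case (Suc i)
    then have "long_cycle k i \<in> orbit (long_cycle k) 0" by (intro orbit.step) simp
    moreover have "long_cycle k i = Suc i" using Suc.prems by (simp add: long_cycle_def)
    ultimately show ?case by simp
  qed
  then show "{..<k} \<subseteq> orbit (long_cycle k) 0" by auto
qed

lemma cycle_type_long_cycle:
  assumes "k \<ge> 1" "k \<le> n"
  shows "cycle_type n (long_cycle k) = mset ([k] @ replicate (n - k) 1)"
proof -
  have o1: "orbit (long_cycle k) i = {..<k}" if "i < k" for i
    using orbit_eq_of_mem[OF permutes_imp_permutation[OF _ long_cycle_permutes], of k i 0]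
      orbit_long_cycle[OF assms(1)] that by simp
  have o2: "orbit (long_cycle k) i = {i}" if "i \<ge> k" for i
    using that by (simp add: orbit_eq_singleton_iff long_cycle_def)
  have "{..<n} = {..<k} \<union> {k..<n}" using assms by auto
  then have "orbit (long_cycle k) ` {..<n} = orbit (long_cycle k) ` {..<k} \<union> orbit (long_cycle k) ` {k..<n}"
    by (simp only: image_Un)
  also have "orbit (long_cycle k) ` {..<k} = (\<lambda>_. {..<k}) ` {..<k}" using o1 by (intro image_cong) auto
  also have "\<dots> = {{..<k}}" using assms by (intro image_constant[of 0]) simp
  also have "orbit (long_cycle k) ` {k..<n} = (\<lambda>i. {i}) ` {k..<n}" using o2 by (intro image_cong) auto
  finally have im: "orbit (long_cycle k) ` {..<n} = insert {..<k} ((\<lambda>i. {i}) ` {k..<n})" by simp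
  have "{..<k} \<noteq> {i}" if "i \<ge> k" for i
  proof
    assume "{..<k} = {i}"
    then have "i \<in> {..<k}" by (simp only: singletonI)
    then show False using that by simp
  qed
  then have "{..<k} \<notin> (\<lambda>i. {i}) ` {k..<n}" by (simp add: image_iff)
  then have "mset_set (orbit (long_cycle k) ` {..<n}) = add_mset {..<k} (image_mset (\<lambda>i. {i}) (mset_set {k..<n}))"
    unfolding im by (simp add: image_mset_mset_set)
  then have "cycle_type n (long_cycle k) = add_mset k (image_mset (\<lambda>i. card {i}) (mset_set {k..<n}))"
    unfolding cycle_type_def by (simp add: multiset.map_comp comp_def)
  also have "image_mset (\<lambda>i. card {i}) (mset_set {k..<n}) = replicate_mset (n - k) 1"
    by (simp add: image_mset_const_eq)
  finally show ?thesis by simp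
qed

text \<open>\<open>irr_char_at\<close> evaluates at an arbitrarily chosen permutation of the given
  cycle type, so all of these must be recognized as single cycles.\<close>

lemma cycle_type_single_cycle:
  assumes w: "w permutes {..<n}" and ct: "cycle_type n w = mset ([k] @ replicate (n - k) 1)"
  obtains x where "x < n" "card (orbit w x) = k" "\<forall>y\<in>{..<n} - orbit w x. w y = y"
proof -
  have perm: "permutation w" using w by (rule permutes_imp_permutation[rotated]) simp
  let ?M = "mset_set (orbit w ` {..<n})"
  have ct': "image_mset card ?M = add_mset k (replicate_mset (n - k) 1)"
    using ct by (simp add: cycle_type_def)
  then have "k \<in># image_mset card ?M" by simp
  then obtain K where K: "K \<in># ?M" "card K = k" by auto
  then obtain x where x: "x < n" "K = orbit w x" by auto
  \<comment> \<open>One orbit of size \<open>k\<close> is removed from the multiset, so that the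
    others have size 1 also when k = 1.\<close>
  obtain M' where M': "?M = add_mset K M'" using K(1) by (metis multi_member_split)
  have cM': "image_mset card M' = replicate_mset (n - k) 1" using ct' M' K by simp
  have "w y = y" if y: "y \<in> {..<n} - orbit w x" for y
  proof -
    have yo: "y \<in> orbit w y" by (rule permutation_self_in_orbit[OF perm])
    then have "orbit w y \<noteq> K" using y x by auto
    moreover have "orbit w y \<in># ?M" using y by simp
    ultimately have "orbit w y \<in># M'" unfolding M' by simp
    then have "card (orbit w y) \<in># image_mset card M'" by simp
    then have "card (orbit w y) = 1" unfolding cM' by (auto split: if_splits)
    then have "orbit w y = {y}" using yo by (auto simp: card_1_singleton_iff)
    then show ?thesis by (simp add: orbit_eq_singleton_iff)
  qed
  then show ?thesis using that[of x] x K by simp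
qed

lemma cells_rect: "cells (rect p q) = {..<p} \<times> {..<q}"
  by (auto simp: cells_def rect_def)

text \<open>The chosen \<open>w\<close> is conjugate to \<open>long_cycle k\<close>, and averaging
  over \<open>g\<close> absorbs the conjugation. The inverse of the cycle comes from the trace
  formula, where \<open>inv w\<close> appears.\<close>

theorem Ch_rect_eq_factorization_poly:
  assumes k: "k \<ge> 1"
  shows "Ch [k] (rect p q) = factorization_poly k (inv (long_cycle k)) (of_nat p) (of_nat q)"
proof -
  let ?n = "p * q" and ?lam = "rect p q" and ?A = "{..<p} \<times> {..<q}"
  let ?c = "long_cycle k"
  let ?v = "inv ?c"
  have n: "sum_list ?lam = ?n" by (simp add: rect_def sum_list_replicate)
  have v: "?v permutes {..<k}" by (rule permutes_inv[OF long_cycle_permutes])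
  let ?I = "{f. f \<in> {..<k} \<rightarrow>\<^sub>E ?A \<and> inj_on f {..<k}}"
  have fp: "(\<Sum>f\<in>?I. signed_count k ?v f) = factorization_poly k ?v (of_nat p) (of_nat q)"
    by (rule sum_signed_count[OF v])
  show ?thesis
  proof (cases "k \<le> ?n")
    case False
    \<comment> \<open>If \<open>k\<close> exceeds the number of cells there is no injective
      placement, so the polynomial vanishes, in accordance with the default value of
      \<open>Ch\<close>.\<close>
    have "?I = {}"
    proof (rule ccontr)
      assume "?I \<noteq> {}"
      then obtain f where "f \<in> ?I" by (rule ex_in_conv[THEN iffD2, THEN exE])
      then have f: "f \<in> {..<k} \<rightarrow>\<^sub>E ?A" "inj_on f {..<k}" by simp_all
      have "f ` {..<k} \<subseteq> ?A" using PiE_mem[OF f(1)] by (rule image_subsetI)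
      then have "card {..<k} \<le> card ?A" by (rule card_inj_on_le[OF f(2)]) simp
      then show False using False by (simp add: card_cartesian_product)
    qed
    then have "factorization_poly k ?v (of_nat p) (of_nat q) = 0" unfolding fp[symmetric] by (simp only: sum.empty)
    then show ?thesis using False by (simp add: Ch_def n)
  next
    case True
    define T where "T = (SOME T. is_tableau ?lam T)"
    have "\<exists>T. is_tableau ?lam T"
      unfolding is_tableau_def n cells_rect
      by (rule finite_same_card_bij) (simp_all add: card_cartesian_product)
    then have "is_tableau ?lam T" unfolding T_def by (rule someI_ex)
    then have T: "bij_betw T {..<?n} ?A" by (simp add: is_tableau_def n cells_rect)
    then have injT: "inj_on T {..<?n}" and imT: "T ` {..<?n} = ?A" by (auto simp: bij_betw_def)
    \<comment> \<open>Every row meets every column in a rectangle, so \<open>full\<close> holds for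
      every \<open>g\<close>.\<close>
    interpret young ?n T
    proof
      show "inj_on T {..<?n}" by (rule injT)
      fix g assume g: "g permutes {..<?n}"
      have mem: "T m \<in> ?A" if "m < ?n" for m using that imT by blast
      show "(\<lambda>m. (fst (T m), snd (T (g m)))) ` {..<?n} \<subseteq> T ` {..<?n}"
        unfolding imT
      proof
        fix z assume "z \<in> (\<lambda>m. (fst (T m), snd (T (g m)))) ` {..<?n}"
        then obtain m where m: "m < ?n" "z = (fst (T m), snd (T (g m)))" by auto
        have "g m < ?n" using permutes_in_image[OF g, of m] m by simp
        then show "z \<in> ?A" using mem[OF m(1)] mem[of "g m"] m(2) by (simp add: mem_Times_iff)
      qed
    qed
    define w where "w = (SOME w. w permutes {..<?n} \<and> cycle_type ?n w = mset ([k] @ replicate (?n - k) 1))"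
    have cn: "?c permutes {..<?n}" by (rule permutes_subset[OF long_cycle_permutes]) (use True in auto)
    have "\<exists>w. w permutes {..<?n} \<and> cycle_type ?n w = mset ([k] @ replicate (?n - k) 1)"
      by (rule exI, rule conjI[OF cn cycle_type_long_cycle[OF k True]])
    then have "w permutes {..<?n} \<and> cycle_type ?n w = mset ([k] @ replicate (?n - k) 1)"
      unfolding w_def by (rule someI_ex)
    then have w: "w permutes {..<?n}" and ct: "cycle_type ?n w = mset ([k] @ replicate (?n - k) 1)" by auto
    obtain x where x: "x < ?n" "card (orbit w x) = k" "\<forall>y\<in>{..<?n} - orbit w x. w y = y"
      by (rule cycle_type_single_cycle[OF w ct])
    have same: "card (orbit ?c 0) = card (orbit w x)" using x(2) orbit_long_cycle[OF k] by simp
    have c_fixed: "?c y = y" if "y \<in> {..<?n} - orbit ?c 0" for y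
      using that orbit_long_cycle[OF k] by (simp add: long_cycle_def)
    have "0 < ?n" using x(1) by (rule le_less_trans[OF le0])
    then have mem: "0 \<in> {..<?n}" "x \<in> {..<?n}" using x(1) by (simp_all only: lessThan_iff)
    obtain h where h: "h permutes {..<?n}" "w = h \<circ> ?c \<circ> inv h"
      by (rule single_cycle_conj[OF finite_lessThan cn w mem same c_fixed bspec[OF x(3)]])
    have iw: "inv w = h \<circ> ?v \<circ> inv h"
      unfolding h(2)
      using permutes_inv_comp[OF permutes_compose[OF cn h(1)] permutes_inv[OF h(1)]] permutes_inv_comp[OF h(1) cn]
        permutes_inv_inv[OF h(1)] by (simp add: o_assoc)
    have "(\<Sum>g | g permutes {..<?n}. Y (inv g \<circ> inv w \<circ> g)) =
        (\<Sum>g | g permutes {..<?n}. Y (inv (h \<circ> g) \<circ> inv w \<circ> (h \<circ> g)))"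
      by (rule setum_permutations_compose_left[OF h(1)])
    also have "\<dots> = (\<Sum>g | g permutes {..<?n}. Y (inv g \<circ> ?v \<circ> g))"
    proof (rule sum.cong[OF refl])
      fix g assume "g \<in> {g. g permutes {..<?n}}"
      then have g: "g permutes {..<?n}" by simp
      have "inv (h \<circ> g) \<circ> inv w \<circ> (h \<circ> g) = inv g \<circ> ?v \<circ> g"
        unfolding iw permutes_inv_comp[OF h(1) g] by (simp add: fun_eq_iff permutes_inverses[OF h(1)])
      then show "Y (inv (h \<circ> g) \<circ> inv w \<circ> (h \<circ> g)) = Y (inv g \<circ> ?v \<circ> g)" by simp
    qed
    also have "\<dots> = (\<Sum>g | g permutes {..<?n}. signed_count k ?v (T \<circ> inv g))"
      by (intro sum.cong refl young_sum_conj[OF injT v True]) simp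
    also have "\<dots> = (\<Sum>g | g permutes {..<?n}. signed_count k ?v (T \<circ> g))"
      by (rule sum_permutations_inverse[symmetric])
    also have "\<dots> = fact (?n - k) * (\<Sum>f\<in>?I. signed_count k ?v f)"
      by (rule sum_over_tableaux[OF T True]) (rule signed_count_cong[OF v])
    finally have N: "(\<Sum>g | g permutes {..<?n}. Y (inv g \<circ> inv w \<circ> g)) =
      fact (?n - k) * factorization_poly k ?v (of_nat p) (of_nat q)" unfolding fp .
    have "sum_list [k] = k" by simp
    then have "Ch [k] ?lam = falling_factorial (of_nat ?n) k *
        (fun_space.subspace_trace (specht_module ?n T) (left_action w) /
         fun_space.subspace_trace (specht_module ?n T) (left_action id))"
      using True unfolding Ch_def irr_char_at_def irr_char_def Let_def n T_def[symmetric]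
      by (simp only: w_def[symmetric] if_True times_divide_eq_right)
    also have "\<dots> = fact ?n / fact (?n - k) * (fact (?n - k) * factorization_poly k ?v (of_nat p) (of_nat q) / fact ?n)"
      unfolding specht_normalized_trace[OF w] N falling_factorial_closed[OF True] ..
    also have "\<dots> = factorization_poly k ?v (of_nat p) (of_nat q)" by simp
    finally show ?thesis .
  qed
qed


section \<open>Polynomials in two variables determined by positive integers\<close>

lemma poly_eq_of_pos_nat:
  fixes p q :: "complex poly"
  assumes "\<And>n :: nat. n > 0 \<Longrightarrow> poly p (of_nat n) = poly q (of_nat n)"
  shows "p = q"
proof (rule poly_eqI_degree)
  let ?A = "of_nat ` {1..Suc (degree p + degree q)} :: complex set"
  have "card ?A = Suc (degree p + degree q)" by (subst card_image) (auto simp: inj_on_def)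
  then show "degree p < card ?A" "degree q < card ?A" by simp_all
  fix x assume "x \<in> ?A"
  then show "poly p x = poly q x" using assms by auto
qed

text \<open>For fixed \<open>q\<close> the coefficients in \<open>p\<close> are determined, and each
  of these, as a polynomial in \<open>q\<close>, is determined in turn.\<close>

lemma eval2_inject:
  assumes "\<And>p q :: nat. p > 0 \<Longrightarrow> q > 0 \<Longrightarrow> eval2 P (of_nat p) (of_nat q) = eval2 Q (of_nat p) (of_nat q)"
  shows "P = Q"
proof (rule poly_eqI)
  fix i
  have "poly (map_poly of_rat (coeff P i)) (of_nat q) = poly (map_poly of_rat (coeff Q i)) (of_nat q :: complex)"
    if q: "q > 0" for q :: nat
  proof -
    let ?h = "\<lambda>c. poly (map_poly of_rat c) (of_nat q) :: complex"
    have "map_poly ?h P = map_poly ?h Q"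
      by (rule poly_eq_of_pos_nat) (use assms q in \<open>simp add: eval2_def\<close>)
    then have "coeff (map_poly ?h P) i = coeff (map_poly ?h Q) i" by simp
    then show ?thesis by (simp add: coeff_map_poly)
  qed
  then have *: "map_poly (of_rat :: rat \<Rightarrow> complex) (coeff P i) = map_poly of_rat (coeff Q i)"
    by (rule poly_eq_of_pos_nat)
  show "coeff P i = coeff Q i"
  proof (rule poly_eqI)
    fix l
    have "coeff (map_poly (of_rat :: rat \<Rightarrow> complex) (coeff P i)) l = coeff (map_poly of_rat (coeff Q i)) l"
      using * by simp
    then show "coeff (coeff P i) l = coeff (coeff Q i) l" by (simp add: coeff_map_poly)
  qed
qed

lemma eval2_add: "eval2 (P + Q) p q = eval2 P p q + eval2 Q p q"
proof -
  have "map_poly (of_rat :: rat \<Rightarrow> complex) (c + d) = map_poly of_rat c + map_poly of_rat d" for c d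
    by (rule poly_eqI) (simp add: coeff_map_poly of_rat_add)
  then have "map_poly (\<lambda>c. poly (map_poly of_rat c) q) (P + Q) =
      map_poly (\<lambda>c. poly (map_poly of_rat c) q) P + map_poly (\<lambda>c. poly (map_poly of_rat c) q) Q"
    by (intro poly_eqI) (simp add: coeff_map_poly)
  then show ?thesis by (simp add: eval2_def)
qed

lemma eval2_sum: "eval2 (\<Sum>x\<in>A. P x) p q = (\<Sum>x\<in>A. eval2 (P x) p q)"
  by (induction A rule: infinite_finite_induct) (simp_all add: eval2_add, simp_all add: eval2_def)

lemma eval2_monom: "eval2 (monom (monom c b) a) p q = of_rat c * q ^ b * p ^ a"
  by (simp add: eval2_def map_poly_monom poly_monom)

text \<open>An explicit polynomial with integer coefficients resolves the definite description in
  \<open>Ch_rect_poly\<close>; \<open>eval2_inject\<close> makes it the only one.\<close>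

lemma Ch_rect_eq:
  assumes k: "k \<ge> 1"
  shows "Ch_rect [k] p q = factorization_poly k (inv (long_cycle k)) p q"
proof -
  let ?v = "inv (long_cycle k)"
  define P :: "rat poly poly" where
    "P = (\<Sum>\<sigma> | \<sigma> permutes {..<k}. monom (monom (of_int (sign (inv \<sigma> \<circ> ?v))) (ncyc {..<k} (inv \<sigma> \<circ> ?v))) (ncyc {..<k} \<sigma>))"
  have P: "eval2 P x y = factorization_poly k ?v x y" for x y
    unfolding P_def eval2_sum eval2_monom factorization_poly_def convolution_def cyc_weight_def signed_cyc_weight_def
    by (intro sum.cong refl) (simp add: mult_ac)
  have "Ch_rect_poly [k] = P"
    unfolding Ch_rect_poly_def
  proof (rule the_equality)
    show "\<forall>p q::nat. p > 0 \<longrightarrow> q > 0 \<longrightarrow> eval2 P (of_nat p) (of_nat q) = Ch [k] (rect p q)"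
      by (simp add: P Ch_rect_eq_factorization_poly[OF k])
    fix P' assume P': "\<forall>p q::nat. p > 0 \<longrightarrow> q > 0 \<longrightarrow> eval2 P' (of_nat p) (of_nat q) = Ch [k] (rect p q)"
    show "P' = P"
      by (rule eval2_inject) (simp add: P' P Ch_rect_eq_factorization_poly[OF k])
  qed
  then show ?thesis by (simp add: Ch_rect_def P)
qed

theorem theorem1p1:
  fixes j :: nat and d e :: complex
  assumes "j \<ge> 1"
  shows "Ch_rect [2 * j - 1] (e - d) (e + d) =
    (-1) ^ (j - 1) * Cat (j - 1) *
    (\<Sum>k=0..j. f_coeff k j * (\<Prod>r=0..<k. d\<^sup>2 - (of_nat r)\<^sup>2) * (\<Prod>r=k..<j. e\<^sup>2 - (of_nat r)\<^sup>2))"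
proof -
  let ?k = "2 * j - 1"
  have k: "?k \<ge> 1" "?k - 1 = 2 * j - 2" using assms by auto
  have v: "inv (long_cycle ?k) permutes {..<?k}" by (rule permutes_inv[OF long_cycle_permutes])
  have o: "orbit (inv (long_cycle ?k)) 0 = {..<?k}"
    using orbit_inv_eq[OF permutes_imp_permutation[OF finite_lessThan long_cycle_permutes], of ?k 0] orbit_long_cycle[OF k(1)] by simp
  have "fact ?k * Ch_rect [?k] (e - d) (e + d) = (\<Sum>a\<le>2 * j - 2. (-1) ^ a * of_nat ((2 * j - 2) choose a) *
      (\<Prod>i<?k. (e - d + of_nat i - of_nat a) * (e + d - of_nat i + of_nat a)))"
    unfolding Ch_rect_eq[OF k(1)] factorization_poly_long_cycle[OF k(1) v o] k(2) ..
  \<comment> \<open>Each factor is a difference of squares, e^2 - (d + a - i)^2.\<close>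
  also have "\<dots> = (bdiff ^^ (2 * j - 2)) (Phi ?k (e\<^sup>2)) d"
    unfolding bdiff_funpow Phi_def
    by (intro sum.cong refl arg_cong2[of _ _ _ _ "(*)"] prod.cong) (simp add: power2_eq_square algebra_simps)
  also have "\<dots> = fact ?k * ((-1) ^ (j - 1) * Cat (j - 1) *
    (\<Sum>k=0..j. f_coeff k j * (\<Prod>r=0..<k. d\<^sup>2 - (of_nat r)\<^sup>2) * (\<Prod>r=k..<j. e\<^sup>2 - (of_nat r)\<^sup>2)))"
    by (rule bdiff_Phi[OF assms])
  finally show ?thesis by simp
qed

end
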